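(* Let $f:S^2\to S^2$ be a topological ramified covering and let $\mathcal A$ be a contracted strongly $f$-stable set of disjoint $\alpha$-paths in $S^2$. Let $\Phi:S^2\setminus\operatorname{Im}\mathcal A\to S^2\setminus\operatorname{Im}\mathcal B$ be a regluing of $\mathcal A$ into some contracted set $\mathcal B$ of disjoint $\beta$-paths in $S^2$. Then the map $g=\Phi\circ f\circ\Phi^{-1}$ extends by continuity to a ramified self-covering of $S^2$.
   Context: $S^2$ is an oriented topological sphere with a fixed metric inducing its topology. A continuous map $f:S^2\to S^2$ is a ramified covering if every $x\in S^2$ has a neighborhood $U$, and $f(x)$ has a neighborhood $V$, with homeomorphisms $\phi:U\to\Delta$, $\psi:V\to\Delta$ onto the open unit disk such that $\psi\circ f\circ\phi^{-1}$ is $z\mapsto z^k$ for some positive integer $k$ (the local degree at $x$). Critical points are those of local degree $>1$; a critical point is simple if its local degree is $2$. Let $S^1=\{(t_1,t_2)\in\mathbb R^2: t_1^2+t_2^2=1\}$ and let $\Delta_\infty$ be the region $t_1^2+t_2^2>1$ in the one-point compactification of the $(t_1,t_2)$-plane, with closure $\overline\Delta_\infty$. An $\alpha$-path is a continuous map $\alpha:S^1\to S^2$ such that $\alpha(t_1,t_2)=\alpha(t_1',t_2')$ if and only if $t_1'=t_1$ and $t_2'=\pm t_2$. A $\beta$-path is a continuous map $\beta:S^1\to S^2$ such that $\beta(t_1,t_2)=\beta(t_1',t_2')$ if and only if $t_1'=\pm t_1$ and $t_2'=t_2$. Every $\alpha$-path $\alpha$ extends to a continuous map $\hat\alpha:\overline\Delta_\infty\to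 S^2$ that is an orientation preserving homeomorphism from $\Delta_\infty$ onto $S^2\setminus\alpha(S^1)$; it is unique up to homotopy relative to $S^1$. A set of such paths is disjoint if different paths in it have disjoint images. For a set $\mathcal A$ of paths, $\operatorname{Im}\mathcal A$ is the union of their images. A set of disjoint paths is contracted if for every $\varepsilon>0$ only finitely many of the paths have image of diameter exceeding $\varepsilon$. Given a set $\mathcal A$ of disjoint $\alpha$-paths, a set $\mathcal B$ of disjoint $\beta$-paths, and a one-to-one correspondence between them, a regluing of $\mathcal A$ into $\mathcal B$ is a continuous bijection $\Phi:S^2\setminus\operatorname{Im}\mathcal A\to S^2\setminus\operatorname{Im}\mathcal B$ such that, for every $\alpha\in\mathcal A$ with corresponding $\beta\in\mathcal B$, the map $\Phi\circ\hat\alpha$ (defined at the points of $\Delta_\infty$ that $\hat\alpha$ sends outside $\operatorname{Im}\mathcal A$) extends to $\overline\Delta_\infty$ in such a way that the extension is continuous at every point of $S^1$ and coincides with $\beta$ on $S^1$. A countable set $\mathcal A$ of disjoint $\alpha$-paths is $f$-stable if: (forward semi-invariance) for every $\alpha\in\mathcal A$, either $f\circ\alpha\in\mathcal A$, or $f\circ\alpha(t_1,t_2)=f\circ\alpha(-t_1,t_2)$ for all $(t_1,t_2)\in S^1$, and in the latter case $f(\alpha(S^1))$ is disjoint from $\operatorname{Im}\mathcal A$; (backward invariance) $f^{-1}(\operatorname{Im}\mathcal A)\subseteq\operatorname{Im}\mathcal A$. A contracted set $\mathcal A$ of disjoint $\alpha$-paths is strongly $f$-stable if it is $f$-stable and all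 critical points of $f$ in $\operatorname{Im}\mathcal A$ are simple and have the form $\alpha(0,1)$, where $\alpha\in\mathcal A$ is such that $f\circ\alpha(t_1,t_2)=f\circ\alpha(-t_1,t_2)$ for all $(t_1,t_2)\in S^1$. *)

theory Defs
  imports "HOL-Complex_Analysis.Complex_Analysis"
begin

text \<open>The \<open>(t\<^sub>1, t\<^sub>2)\<close>-plane with its standard orientation is \<^typ>\<open>complex\<close>,
  with \<open>t\<^sub>1 = Re t\<close> and \<open>t\<^sub>2 = Im t\<close>; in its one-point compactification, of type
  \<^typ>\<open>complex option\<close>, the point at infinity is \<^term>\<open>None\<close>.\<close>

abbreviation circle :: "complex set"
  where "circle \<equiv> sphere 0 1"

definition plane_compactification :: "complex option topology"
  where "plane_compactification = Alexandroff_compactification euclidean"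

definition Delta_inf :: "complex option set"
  where "Delta_inf = insert None (Some ` {t. norm t > 1})"

definition closed_Delta_inf :: "complex option set"
  where "closed_Delta_inf = plane_compactification closure_of Delta_inf"


text \<open>A local homeomorphism of the plane preserves orientation at \<open>z\<close> iff small positively
  oriented circles about \<open>z\<close> are mapped to loops winding once (and not \<open>-1\<close> times) about the
  image of \<open>z\<close>. An orientation of a surface is given by an atlas with orientation preserving
  transition maps.\<close>

definition preserves_orientation_at :: "(complex \<Rightarrow> complex) \<Rightarrow> complex \<Rightarrow> bool"
  where "preserves_orientation_at h z \<longleftrightarrow>
    (\<forall>\<^sub>F r in at_right 0. winding_number (h \<circ> circlepath z r) (h z) = 1)"

definition oriented_atlas :: "'a topology \<Rightarrow> ('a set \<times> ('a \<Rightarrow> complex)) set \<Rightarrow> bool"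
  where "oriented_atlas X \<O> \<longleftrightarrow>
    (\<forall>(U, \<phi>) \<in> \<O>. openin X U \<and> open (\<phi> ` U) \<and>
       homeomorphic_map (subtopology X U) (top_of_set (\<phi> ` U)) \<phi>) \<and>
    topspace X \<subseteq> (\<Union>(U, \<phi>) \<in> \<O>. U) \<and>
    (\<forall>(U, \<phi>) \<in> \<O>. \<forall>(V, \<psi>) \<in> \<O>. \<forall>x \<in> U \<inter> V.
       preserves_orientation_at (\<psi> \<circ> inv_into U \<phi>) (\<phi> x))"

definition orientation_preserving_on ::
    "'a set \<Rightarrow> ('a set \<times> ('a \<Rightarrow> complex)) set \<Rightarrow> ('b set \<times> ('b \<Rightarrow> complex)) set \<Rightarrow>
      ('a \<Rightarrow> 'b) \<Rightarrow> bool"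
  where "orientation_preserving_on D \<O> \<O>' h \<longleftrightarrow>
    (\<forall>x \<in> D. \<forall>(U, \<phi>) \<in> \<O>. \<forall>(V, \<psi>) \<in> \<O>'. x \<in> U \<and> h x \<in> V \<longrightarrow>
       preserves_orientation_at (\<psi> \<circ> h \<circ> inv_into U \<phi>) (\<phi> x))"

definition plane_compactification_atlas ::
    "(complex option set \<times> (complex option \<Rightarrow> complex)) set"
  where "plane_compactification_atlas =
    {(range Some, the),
     (insert None (Some ` (- {0})), case_option 0 inverse)}"

definition oriented_sphere ::
    "'a::metric_space set \<Rightarrow> ('a set \<times> ('a \<Rightarrow> complex)) set \<Rightarrow> bool"
  where "oriented_sphere S \<O> \<longleftrightarrow>
    S homeomorphic sphere (0 :: real^3) 1 \<and> oriented_atlas (top_of_set S) \<O>"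


text \<open>The normalisation \<open>\<phi> x = 0\<close> makes \<open>k\<close> unique: away from the centre of the disk, the
  power map is itself locally injective.\<close>

definition has_local_degree ::
    "'a::topological_space set \<Rightarrow> ('a \<Rightarrow> 'a) \<Rightarrow> 'a \<Rightarrow> nat \<Rightarrow> bool"
  where "has_local_degree S f x k \<longleftrightarrow> k > 0 \<and>
    (\<exists>U V \<phi> \<phi>' \<psi> \<psi>'.
       openin (top_of_set S) U \<and> x \<in> U \<and> openin (top_of_set S) V \<and> f x \<in> V \<and> f ` U \<subseteq> V \<and>
       homeomorphism U (ball (0::complex) 1) \<phi> \<phi>' \<and>
       homeomorphism V (ball (0::complex) 1) \<psi> \<psi>' \<and>
       \<phi> x = 0 \<and> (\<forall>z \<in> ball 0 1. \<psi> (f (\<phi>' z)) = z ^ k))"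

definition ramified_covering :: "'a::topological_space set \<Rightarrow> ('a \<Rightarrow> 'a) \<Rightarrow> bool"
  where "ramified_covering S f \<longleftrightarrow>
    continuous_on S f \<and> f ` S \<subseteq> S \<and> (\<forall>x \<in> S. \<exists>k. has_local_degree S f x k)"

definition critical_point :: "'a::topological_space set \<Rightarrow> ('a \<Rightarrow> 'a) \<Rightarrow> 'a \<Rightarrow> bool"
  where "critical_point S f x \<longleftrightarrow> x \<in> S \<and> (\<exists>k > 1. has_local_degree S f x k)"

definition simple_critical_point :: "'a::topological_space set \<Rightarrow> ('a \<Rightarrow> 'a) \<Rightarrow> 'a \<Rightarrow> bool"
  where "simple_critical_point S f x \<longleftrightarrow> x \<in> S \<and> has_local_degree S f x 2"


text \<open>Paths are extensional functions, so that a set of paths is a set of maps on \<^term>\<open>circle\<close>,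
  without regard to the values of the HOL functions elsewhere.\<close>

definition alpha_path :: "'a::topological_space set \<Rightarrow> (complex \<Rightarrow> 'a) \<Rightarrow> bool"
  where "alpha_path S \<alpha> \<longleftrightarrow>
    \<alpha> \<in> circle \<rightarrow>\<^sub>E S \<and> continuous_on circle \<alpha> \<and>
    (\<forall>t \<in> circle. \<forall>t' \<in> circle.
       \<alpha> t = \<alpha> t' \<longleftrightarrow> Re t' = Re t \<and> (Im t' = Im t \<or> Im t' = - Im t))"

definition beta_path :: "'a::topological_space set \<Rightarrow> (complex \<Rightarrow> 'a) \<Rightarrow> bool"
  where "beta_path S \<beta> \<longleftrightarrow>
    \<beta> \<in> circle \<rightarrow>\<^sub>E S \<and> continuous_on circle \<beta> \<and>
    (\<forall>t \<in> circle. \<forall>t' \<in> circle.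
       \<beta> t = \<beta> t' \<longleftrightarrow> (Re t' = Re t \<or> Re t' = - Re t) \<and> Im t' = Im t)"

definition disjoint_alpha_paths :: "'a::topological_space set \<Rightarrow> (complex \<Rightarrow> 'a) set \<Rightarrow> bool"
  where "disjoint_alpha_paths S \<A> \<longleftrightarrow>
    (\<forall>\<alpha> \<in> \<A>. alpha_path S \<alpha>) \<and> disjoint_family_on (\<lambda>\<alpha>. \<alpha> ` circle) \<A>"

definition disjoint_beta_paths :: "'a::topological_space set \<Rightarrow> (complex \<Rightarrow> 'a) set \<Rightarrow> bool"
  where "disjoint_beta_paths S \<B> \<longleftrightarrow>
    (\<forall>\<beta> \<in> \<B>. beta_path S \<beta>) \<and> disjoint_family_on (\<lambda>\<beta>. \<beta> ` circle) \<B>"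

definition Im_paths :: "(complex \<Rightarrow> 'a) set \<Rightarrow> 'a set"
  where "Im_paths \<A> = (\<Union>\<alpha> \<in> \<A>. \<alpha> ` circle)"

definition contracted :: "(complex \<Rightarrow> 'a::metric_space) set \<Rightarrow> bool"
  where "contracted \<A> \<longleftrightarrow> (\<forall>\<epsilon> > 0. finite {\<alpha> \<in> \<A>. diameter (\<alpha> ` circle) > \<epsilon>})"

definition alpha_extension ::
    "'a::metric_space set \<Rightarrow> ('a set \<times> ('a \<Rightarrow> complex)) set \<Rightarrow> (complex \<Rightarrow> 'a) \<Rightarrow>
      (complex option \<Rightarrow> 'a) \<Rightarrow> bool"
  where "alpha_extension S \<O> \<alpha> h \<longleftrightarrow>
    continuous_map (subtopology plane_compactification closed_Delta_inf) (top_of_set S) h \<and>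
    (\<forall>t \<in> circle. h (Some t) = \<alpha> t) \<and>
    homeomorphic_map (subtopology plane_compactification Delta_inf)
      (top_of_set (S - \<alpha> ` circle)) h \<and>
    orientation_preserving_on Delta_inf plane_compactification_atlas \<O> h"

text \<open>The map \<open>c\<close> is the one-to-one correspondence between \<open>\<A>\<close> and \<open>\<B>\<close>. The condition on
  \<open>h\<close> does not depend on its choice: any two choices differ by a homeomorphism of
  \<^term>\<open>Delta_inf\<close> extending continuously by the identity of \<^term>\<open>circle\<close>.\<close>

definition regluing ::
    "'a::metric_space set \<Rightarrow> ('a set \<times> ('a \<Rightarrow> complex)) set \<Rightarrow>
      (complex \<Rightarrow> 'a) set \<Rightarrow> (complex \<Rightarrow> 'a) set \<Rightarrow> ((complex \<Rightarrow> 'a) \<Rightarrow> (complex \<Rightarrow> 'a)) \<Rightarrow>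
      ('a \<Rightarrow> 'a) \<Rightarrow> bool"
  where "regluing S \<O> \<A> \<B> c \<Phi> \<longleftrightarrow>
    disjoint_alpha_paths S \<A> \<and> disjoint_beta_paths S \<B> \<and> bij_betw c \<A> \<B> \<and>
    continuous_on (S - Im_paths \<A>) \<Phi> \<and>
    bij_betw \<Phi> (S - Im_paths \<A>) (S - Im_paths \<B>) \<and>
    (\<forall>\<alpha> \<in> \<A>. \<exists>h. alpha_extension S \<O> \<alpha> h \<and>
       (\<exists>E \<in> closed_Delta_inf \<rightarrow> S.
          (\<forall>p \<in> Delta_inf. h p \<notin> Im_paths \<A> \<longrightarrow> E p = \<Phi> (h p)) \<and>
          (\<forall>t \<in> circle. E (Some t) = c \<alpha> t) \<and>
          (\<forall>t \<in> circle. topcontinuous_at (subtopology plane_compactification closed_Delta_inf)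
             (top_of_set S) E (Some t))))"

definition folded_by :: "('a \<Rightarrow> 'a) \<Rightarrow> (complex \<Rightarrow> 'a) \<Rightarrow> bool"
  where "folded_by f \<alpha> \<longleftrightarrow> (\<forall>t \<in> circle. f (\<alpha> t) = f (\<alpha> (Complex (- Re t) (Im t))))"

definition f_stable :: "'a::topological_space set \<Rightarrow> ('a \<Rightarrow> 'a) \<Rightarrow> (complex \<Rightarrow> 'a) set \<Rightarrow> bool"
  where "f_stable S f \<A> \<longleftrightarrow>
    countable \<A> \<and> disjoint_alpha_paths S \<A> \<and>
    (\<forall>\<alpha> \<in> \<A>. compose circle f \<alpha> \<in> \<A> \<or>
       folded_by f \<alpha> \<and> f ` (\<alpha> ` circle) \<inter> Im_paths \<A> = {}) \<and>
    {x \<in> S. f x \<in> Im_paths \<A>} \<subseteq> Im_paths \<A>"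

definition strongly_f_stable ::
    "'a::metric_space set \<Rightarrow> ('a \<Rightarrow> 'a) \<Rightarrow> (complex \<Rightarrow> 'a) set \<Rightarrow> bool"
  where "strongly_f_stable S f \<A> \<longleftrightarrow>
    contracted \<A> \<and> f_stable S f \<A> \<and>
    (\<forall>x \<in> Im_paths \<A>. critical_point S f x \<longrightarrow>
       simple_critical_point S f x \<and>
       (\<exists>\<alpha> \<in> \<A>. folded_by f \<alpha> \<and> x = \<alpha> (Complex 0 1)))"

end

theory Submission
  imports Defs
begin

text \<open>
  Write \<open>X\<close> and \<open>Y\<close> for the complements of the \<open>\<alpha>\<close>-arcs and of the \<open>\<beta>\<close>-arcs, so that \<open>\<Phi>\<close> maps \<open>X\<close>
  onto \<open>Y\<close>. Each arc is seen from the complement through its slit map \<open>H \<alpha>\<close>, defined on the exterior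
  of the unit disk: a point of the complement close to \<open>\<alpha> t\<close> is \<open>H \<alpha> z\<close> with \<open>z\<close> close to \<open>t\<close> or to
  \<open>cnj t\<close>, the two sides of the \<open>\<alpha>\<close>-arc, whereas \<open>\<Phi> (H \<alpha> z)\<close> is close to \<open>c \<alpha> t\<close> exactly when \<open>z\<close> is
  close to \<open>t\<close> or to \<open>flip t = - cnj t\<close>. Regluing thus replaces the identification of \<open>t\<close> with
  \<open>cnj t\<close> by that of \<open>t\<close> with \<open>flip t\<close>.

  Compactness of the sphere shows that \<open>\<Phi>\<inverse>\<close> is continuous on \<open>Y\<close>, and that points tending to
  \<open>c \<alpha> t\<close> in \<open>Y\<close> come from slit coordinates tending to \<open>t\<close> or \<open>flip t\<close>
  (\<open>\<Phi>_inverse_limit_regular\<close>, \<open>\<Phi>_inverse_limit_arc\<close>). As the \<open>\<alpha>\<close>-arcs are contracted, whole small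
  arcs follow nearby points (\<open>arcs_near_regular\<close>, \<open>arcs_near_arc\<close>).

  There are two kinds of arcs. If \<open>f \<circ> \<alpha>\<close> is again in \<open>\<A>\<close>, then \<open>f\<close> is a local homeomorphism along
  \<open>\<alpha>\<close>, and in slit coordinates it either preserves both sides or exchanges them, the latter when it
  reverses orientation there (\<open>unfolded_boundary_map\<close>). The boundary correspondence (\<open>id\<close> or \<open>cnj\<close>)
  commutes with \<open>flip\<close>, so it descends to a map between \<open>\<beta>\<close>-arcs. If \<open>f\<close> folds \<open>\<alpha>\<close>, then
  \<open>f (\<alpha> t) = f (\<alpha> (flip t))\<close> lies in \<open>X\<close>, and \<open>\<Phi> (f (\<alpha> t))\<close> is a well defined value at \<open>c \<alpha> t\<close>. This
  yields an extension \<open>G\<close> of \<open>\<Phi> \<circ> f \<circ> \<Phi>\<inverse>\<close>, which is continuous because \<open>Y\<close> is dense.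

  It remains to see that \<open>G\<close> is ramified. A continuous surface map has a power map as local model at
  a point if it is locally injective and different from its value there on a punctured neighbourhood
  (\<open>isolated_branch_point_has_local_degree\<close>). Over a point where \<open>f\<close> is locally injective, and over an
  unfolded arc, \<open>G\<close> inherits local injectivity from \<open>f\<close>. For a folded arc, two preimages of a point
  near \<open>f (\<alpha> t)\<close> lie near \<open>\<alpha> t\<close> and \<open>\<alpha> (flip t)\<close> and are exchanged by the local deck transformation
  of \<open>f\<close>, a half turn about the midpoint of the arc. A half turn exchanges the two sides of the arc
  (\<open>not_pinched_midpoint\<close>), so the points brought together at \<open>c \<alpha> t\<close>, which lie on one side, have
  different images, and \<open>G\<close> is locally injective there. The branch point of \<open>f\<close> at the midpoint
  disappears, and the midpoint \<open>c \<alpha> 1\<close> of the new arc, where full neighbourhoods of the two tips \<open>\<alpha> 1\<close>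
  and \<open>\<alpha> (- 1)\<close> of the old one are glued crosswise, is a new isolated branch point.
\<close>

section \<open>Branch points of plane maps\<close>

text \<open>Invariance of domain, applied locally.\<close>

lemma open_image_locally_injective:
  fixes F :: "complex \<Rightarrow> complex"
  assumes "continuous_on c F"
    and "\<And>z. z \<in> c \<Longrightarrow> \<exists>N. open N \<and> z \<in> N \<and> N \<subseteq> c \<and> inj_on F N"
    and "open M" "M \<subseteq> c"
  shows "open (F ` M)"
proof (rule Topological_Spaces.openI)
  fix w assume "w \<in> F ` M"
  then obtain z where z: "z \<in> M" "w = F z" by auto
  obtain N where N: "open N" "z \<in> N" "N \<subseteq> c" "inj_on F N" using assms(2,4) z by blast
  have "open (F ` (N \<inter> M))"
    by (rule invariance_of_domain)
      (use N assms in \<open>auto intro: continuous_on_subset inj_on_subset\<close>)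
  then show "\<exists>T. open T \<and> w \<in> T \<and> T \<subseteq> F ` M" using z N by (intro exI[of _ "F ` (N \<inter> M)"]) auto
qed

text \<open>A fibre is compact and discrete, hence finite. Around its points there are disjoint
  disks on which \<open>F\<close> is injective, and properness keeps the image of the rest of a compact piece of
  \<open>c\<close> away from the base point; what remains is an evenly covered neighbourhood. Surjectivity comes
  out of the same neighbourhoods, since the image is open and closed in the connected set \<open>S\<close>.\<close>

lemma proper_locally_injective_covering:
  fixes F :: "complex \<Rightarrow> complex"
  assumes c: "open c" "c \<noteq> {}" and S: "open S" "connected S"
    and F: "continuous_on c F" "F ` c \<subseteq> S"
    and inj: "\<And>z. z \<in> c \<Longrightarrow> \<exists>N. open N \<and> z \<in> N \<and> N \<subseteq> c \<and> inj_on F N"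
    and proper: "\<And>K. compact K \<Longrightarrow> K \<subseteq> S \<Longrightarrow> compact (c \<inter> F -` K)"
  shows "covering_space c F S" and "\<And>x. x \<in> S \<Longrightarrow> finite (c \<inter> F -` {x})"
proof -
  note open_map = open_image_locally_injective[OF F(1) inj]
  show fin: "finite (c \<inter> F -` {x})" if "x \<in> S" for x
  proof -
    let ?P = "c \<inter> F -` {x}"
    have cpt: "compact ?P" using proper[of "{x}"] that by simp
    obtain N where N: "\<And>z. z \<in> ?P \<Longrightarrow> open (N z) \<and> z \<in> N z \<and> inj_on F (N z)"
      using inj by (metis IntD1)
    have cover: "?P \<subseteq> (\<Union>z\<in>?P. N z)" using N by blast
    have opn: "\<And>z. z \<in> ?P \<Longrightarrow> open (N z)" using N by blast
    obtain Q where Q: "Q \<subseteq> ?P" "finite Q" "?P \<subseteq> (\<Union>z\<in>Q. N z)"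
      by (rule compactE_image[OF cpt opn cover])
    have "?P \<subseteq> Q"
    proof
      fix z assume z: "z \<in> ?P"
      then obtain q where q: "q \<in> Q" "z \<in> N q" using Q by auto
      then have "q \<in> ?P" using Q by auto
      then have "z = q" using N[of q] q z by (auto dest: inj_onD)
      then show "z \<in> Q" using q by simp
    qed
    then show ?thesis using Q finite_subset by blast
  qed
  have sheets: "\<exists>T v. open T \<and> x \<in> T \<and> T \<subseteq> S \<and> \<Union>v = c \<inter> F -` T \<and> (\<forall>u\<in>v. open u) \<and> pairwise disjnt v \<and>
      (\<forall>u\<in>v. \<exists>q. homeomorphism u T F q)" if x: "x \<in> S" for x
  proof -
    define P where "P = c \<inter> F -` {x}"
    have finP: "finite P" using fin[OF x] by (simp add: P_def)
    have "\<exists>r>0. ball a r \<subseteq> c \<and> inj_on F (ball a r) \<and> (\<forall>b\<in>P. b \<noteq> a \<longrightarrow> 2 * r \<le> dist a b)"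
      if "a \<in> P" for a
    proof -
      have "a \<in> c" using that by (simp add: P_def)
      then obtain N where N: "open N" "a \<in> N" "N \<subseteq> c" "inj_on F N" by (metis inj)
      obtain r1 where r1: "r1 > 0" "ball a r1 \<subseteq> N" using N(1,2) open_contains_ball by blast
      obtain d where d: "d > 0" "\<forall>b\<in>P. b \<noteq> a \<longrightarrow> d \<le> dist a b"
        using finite_set_avoid[OF finP] by blast
      have "ball a (min r1 (d/2)) \<subseteq> ball a r1" by auto
      then have "ball a (min r1 (d/2)) \<subseteq> c \<and> inj_on F (ball a (min r1 (d/2)))"
        using r1 N by (meson inj_on_subset subset_trans)
      then show ?thesis using r1 d by (intro exI[of _ "min r1 (d/2)"]) auto
    qed
    then obtain r where r: "\<And>a. a \<in> P \<Longrightarrow> r a > 0 \<and> ball a (r a) \<subseteq> c \<and> inj_on F (ball a (r a)) \<and>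
        (\<forall>b\<in>P. b \<noteq> a \<longrightarrow> 2 * r a \<le> dist a b)" by metis
    define O' where "O' = (\<Union>a\<in>P. ball a (r a))"
    obtain \<eta> where \<eta>: "\<eta> > 0" "cball x \<eta> \<subseteq> S" using S x open_contains_cball by blast
    \<comment> \<open>the part of the preimage outside the chosen disks, whose image is to be avoided\<close>
  define R where "R = c \<inter> F -` cball x \<eta> - O'"
    have "compact R" unfolding R_def O'_def
      by (intro compact_diff proper) (use \<eta> in auto)
    moreover have "continuous_on R F" using F(1) by (rule continuous_on_subset) (auto simp: R_def)
    ultimately have "closed (F ` R)" by (intro compact_imp_closed compact_continuous_image)
    define T where "T = (ball x \<eta> \<inter> (\<Inter>a\<in>P. F ` ball a (r a))) - F ` R"
    have "open (F ` ball a (r a))" if "a \<in> P" for a using open_map r that by simp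
    then have "open T" unfolding T_def
      by (intro open_Diff open_Int open_INT finP) (use \<open>closed (F ` R)\<close> in auto)
    have "a \<in> ball a (r a)" if "a \<in> P" for a using r[OF that] by simp
    moreover have "x \<notin> F ` R" using \<open>\<And>a. a \<in> P \<Longrightarrow> a \<in> ball a (r a)\<close>
      by (auto simp: R_def O'_def P_def)
    ultimately have "x \<in> T" unfolding T_def using \<eta> by (auto simp: P_def intro!: image_eqI)
    have TS: "T \<subseteq> S" using \<eta> by (auto simp: T_def)
    define v where "v = (\<lambda>a. ball a (r a) \<inter> F -` T) ` P"
    have "\<Union>v = c \<inter> F -` T"
    proof
      show "\<Union>v \<subseteq> c \<inter> F -` T" using r by (auto simp: v_def)
      show "c \<inter> F -` T \<subseteq> \<Union>v"
      proof
        fix z assume z: "z \<in> c \<inter> F -` T"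
        then have "z \<notin> R" by (auto simp: T_def)
        moreover have "F z \<in> cball x \<eta>" using z by (auto simp: T_def)
        ultimately have "z \<in> O'" using z by (auto simp: R_def)
        then show "z \<in> \<Union>v" using z by (auto simp: v_def O'_def)
      qed
    qed
    moreover have openv: "open (ball a (r a) \<inter> F -` T)" if "a \<in> P" for a
      by (rule continuous_open_preimage[OF _ open_ball \<open>open T\<close>])
        (use r[OF that] F(1) continuous_on_subset in blast)
    moreover have "pairwise disjnt v"
    proof -
      have "disjnt (ball a (r a)) (ball b (r b))" if "a \<in> P" "b \<in> P" "a \<noteq> b" for a b
      proof -
        have "2 * r a \<le> dist a b" "2 * r b \<le> dist b a"
          using r that by auto
        then have "r a + r b \<le> dist a b" by (simp add: dist_commute)
        then show ?thesis unfolding disjnt_def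
          by (metis disjoint_ballI)
      qed
      then have disj: "disjnt (ball a (r a) \<inter> F -` T) (ball b (r b) \<inter> F -` T)"
        if "a \<in> P" "b \<in> P" "a \<noteq> b" for a b
        using that by (meson disjnt_subset1 disjnt_subset2 inf_le1)
      show ?thesis unfolding v_def
        by (rule pairwise_imageI) (use disj in simp)
    qed
    moreover have "\<exists>q. homeomorphism (ball a (r a) \<inter> F -` T) T F q" if "a \<in> P" for a
    proof -
      have "T \<subseteq> F ` ball a (r a)" using that by (auto simp: T_def)
      then have "F ` (ball a (r a) \<inter> F -` T) = T" by blast
      moreover have "continuous_on (ball a (r a) \<inter> F -` T) F" using F(1) r[OF that]
        by (meson Int_lower1 continuous_on_subset)
      moreover have "inj_on F (ball a (r a) \<inter> F -` T)" using r[OF that] by (auto intro: inj_on_subset)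
      ultimately show ?thesis using invariance_of_domain_homeomorphism[OF openv[OF that], where f = F]
        by (metis order_refl)
    qed
    ultimately show ?thesis using \<open>open T\<close> \<open>x \<in> T\<close> TS
      by (intro exI[of _ T] exI[of _ v]) (auto simp: v_def)
  qed
  have "open (F ` c)" using open_map c by simp
  moreover have "open (S - F ` c)"
  proof (rule Topological_Spaces.openI)
    fix x assume x: "x \<in> S - F ` c"
    then have "x \<in> S" by simp
    from sheets[OF this] obtain T v where T: "open T" "x \<in> T" "T \<subseteq> S" "\<Union>v = c \<inter> F -` T"
        and homeo: "\<forall>u\<in>v. \<exists>q. homeomorphism u T F q"
      by blast
    have "v = {}"
    proof (rule ccontr)
      assume "v \<noteq> {}"
      then obtain u where u: "u \<in> v" by blast
      then obtain q where "homeomorphism u T F q" using homeo by blast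
      then obtain z where "z \<in> u" "F z = x" using T(2) unfolding homeomorphism_def by blast
      moreover have "u \<subseteq> c" using u T(4) by blast
      ultimately show False using x by auto
    qed
    then have "T \<inter> F ` c = {}" using T(4) by auto
    then show "\<exists>T. open T \<and> x \<in> T \<and> T \<subseteq> S - F ` c" using T(1-3) by blast
  qed
  ultimately have "F ` c = S"
    using connectedD[OF S(2), of "F ` c" "S - F ` c"] F(2) c(2) by blast
  show "covering_space c F S"
  proof
    show "continuous_on c F" "F ` c = S" by fact+
    fix x assume "x \<in> S"
    from sheets[OF this] obtain T v where *: "open T" "x \<in> T" "T \<subseteq> S" "\<Union>v = c \<inter> F -` T"
      "\<forall>u\<in>v. open u" "pairwise disjnt v" "\<forall>u\<in>v. \<exists>q. homeomorphism u T F q" by blast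
    have "openin (top_of_set S) T" using * by (simp add: open_openin_trans S)
    moreover have "\<forall>u\<in>v. openin (top_of_set c) u"
      using * c by (metis Sup_upper le_inf_iff open_subset)
    ultimately show "\<exists>T. x \<in> T \<and> openin (top_of_set S) T \<and> (\<exists>v. \<Union>v = c \<inter> F -` T \<and>
       (\<forall>u \<in> v. openin (top_of_set c) u) \<and> pairwise disjnt v \<and> (\<forall>u \<in> v. \<exists>q. homeomorphism u T F q))"
      using * by blast
  qed
qed

text \<open>The half plane is the universal cover of the punctured disk, so \<open>exp\<close> factors through the
  covering \<open>F\<close>. Two lifts agreeing at one point agree everywhere; hence the periods \<open>2 * pi * \<i> * j\<close>
  of the lift form a subgroup of the integers, nontrivial because the fibres are finite, and \<open>k\<close> is
  its generator.\<close>

lemma punctured_disk_lift_of_exp: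
  fixes F :: "complex \<Rightarrow> complex"
  assumes cov: "covering_space c F (ball 0 m - {0})" and "m > 0"
    and fin: "\<And>x. x \<in> ball 0 m - {0} \<Longrightarrow> finite (c \<inter> F -` {x})"
  obtains k e where "k > 0" "continuous_on {w. Re w < ln m} e" "e ` {w. Re w < ln m} \<subseteq> c"
    "\<And>w. Re w < ln m \<Longrightarrow> F (e w) = exp w"
    "\<And>w w'. Re w < ln m \<Longrightarrow> Re w' < ln m \<Longrightarrow>
       e w = e w' \<longleftrightarrow> (\<exists>q::int. w' = w + of_int (int k * q) * (2 * pi * \<i>))"
proof -
  let ?H = "{w. Re w < ln m}"
  have convH: "convex ?H" by (rule convex_halfspace_Re_lt)
  have expH: "exp \<in> ?H \<rightarrow> ball 0 m - {0}"
  proof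
    fix w assume "w \<in> ?H"
    then have "exp (Re w) < exp (ln m)" by simp
    then show "exp w \<in> ball 0 m - {0}" using \<open>m > 0\<close> by simp
  qed
  have exp_cont: "continuous_on ?H exp" by (intro continuous_intros)
  obtain e where e: "continuous_on ?H e" "e \<in> ?H \<rightarrow> c" "\<And>w. w \<in> ?H \<Longrightarrow> F (e w) = exp w"
    by (rule covering_space_lift[OF cov convex_imp_simply_connected[OF convH]
        convex_imp_locally_path_connected[OF convH] exp_cont expH], rule that, assumption+)
  define sh :: "int \<Rightarrow> complex \<Rightarrow> complex" where "sh = (\<lambda>j w. w + of_int j * (2 * pi * \<i>))"
  have exp_sh: "exp (sh j w) = exp w" for j w
    using exp_plus_2pin[of w j] by (simp add: sh_def algebra_simps)
  have sh_H: "sh j w \<in> ?H \<longleftrightarrow> w \<in> ?H" for j w by (simp add: sh_def)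
  have sh_sh: "sh i (sh j w) = sh (i + j) w" for i j w by (simp add: sh_def algebra_simps)
  have lift_unique: "e (sh j w) = e w" if "e (sh j w0) = e w0" "w0 \<in> ?H" "w \<in> ?H" for j w w0
  proof (rule covering_space_lift_unique[where ?g1.0 = "\<lambda>w. e (sh j w)" and ?g2.0 = e and T = ?H and f = exp and a = w0,
        OF cov that(1) _ expH _ _ _ e(1,2)])
    show "continuous_on ?H exp" by (rule exp_cont)
    show "continuous_on ?H (\<lambda>w. e (sh j w))"
      by (intro continuous_on_compose2[OF e(1)]) (auto simp: sh_def intro!: continuous_intros)
    show "(\<lambda>w. e (sh j w)) \<in> ?H \<rightarrow> c" using e(2) sh_H by blast
    show "exp x = F (e (sh j x))" if "x \<in> ?H" for x
      using e(3)[of "sh j x"] sh_H that exp_sh by simp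
    show "exp x = F (e x)" if "x \<in> ?H" for x using e(3) that by simp
    show "connected ?H" using convH convex_connected by blast
  qed (use that in auto)
  define w0 :: complex where "w0 = of_real (ln m - 1)"
  have w0: "w0 \<in> ?H" by (simp add: w0_def)
  define per where "per = (\<lambda>j::nat. j > 0 \<and> e (sh (int j) w0) = e w0)"
  have "\<exists>j. per j"
  proof -
    let ?g = "\<lambda>j::nat. e (sh (int j) w0)"
    have "range ?g \<subseteq> c \<inter> F -` {exp w0}"
    proof (intro subsetI, elim rangeE)
      fix z j assume z: "z = ?g j"
      have "sh (int j) w0 \<in> ?H" using sh_H w0 by blast
      then show "z \<in> c \<inter> F -` {exp w0}" using e exp_sh z by auto
    qed
    moreover have "finite (c \<inter> F -` {exp w0})" using fin expH w0 by blast
    ultimately have "\<not> inj ?g" using finite_subset finite_imageD by (metis infinite_UNIV_nat)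
    then obtain i j where "i \<noteq> j" "?g i = ?g j" by (auto simp: inj_def)
    then obtain i j where ij: "i < j" "?g i = ?g j" by (metis linorder_neqE_nat)
    have "sh (int j) w0 = sh (int (j - i)) (sh (int i) w0)" using ij by (simp add: sh_sh)
    then have "e (sh (int (j - i)) (sh (int i) w0)) = e (sh (int i) w0)" using ij by simp
    moreover have "sh (int i) w0 \<in> ?H" using sh_H w0 by blast
    ultimately have "e (sh (int (j - i)) w0) = e w0" using lift_unique w0 by blast
    then show ?thesis using ij by (intro exI[of _ "j - i"]) (simp add: per_def)
  qed
  define k where "k = (LEAST j. per j)"
  have perk: "per k" unfolding k_def using \<open>\<exists>j. per j\<close> by (rule LeastI_ex)
  then have k0: "k > 0" by (simp add: per_def)
  have shk: "e (sh (int k) w) = e w" if "w \<in> ?H" for w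
    using lift_unique[OF _ w0 that] perk by (simp add: per_def)
  have shkn: "e (sh (int k * int n) w) = e w" if "w \<in> ?H" for w n
  proof (induction n)
    case 0 show ?case by (simp add: sh_def)
  next
    case (Suc n)
    have "e (sh (int k) (sh (int k * int n) w)) = e (sh (int k * int n) w)"
      using shk sh_H that by blast
    then show ?case using Suc by (simp add: sh_sh algebra_simps)
  qed
  have shkq: "e (sh (int k * q) w) = e w" if "w \<in> ?H" for w q
  proof (cases "q \<ge> 0")
    case True then show ?thesis using shkn[OF that, of "nat q"] by simp
  next
    case False
    then have q: "q = - int (nat (- q))" by simp
    have "e (sh (int k * int (nat (-q))) (sh (int k * q) w)) = e (sh (int k * q) w)"
      using shkn sh_H that by blast
    moreover have "sh (int k * int (nat (-q))) (sh (int k * q) w) = w"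
      by (subst (2) q) (simp add: sh_sh, simp add: sh_def)
    ultimately show ?thesis by simp
  qed
  have e_eq: "e w = e w' \<longleftrightarrow> (\<exists>q::int. w' = w + of_int (int k * q) * (2 * pi * \<i>))"
    if w: "w \<in> ?H" "w' \<in> ?H" for w w'
  proof
    assume eq: "e w = e w'"
    then have "exp w = exp w'" using e(3) w by metis
    then obtain n :: int where "w' = w + (of_int (2 * n) * pi) * \<i>"
      unfolding exp_eq[of w' w, unfolded eq_commute[of "exp w'"]] by blast
    then have n: "w' = sh n w" by (simp add: sh_def algebra_simps)
    \<comment> \<open>the remainder of a period modulo the least period is itself a period, so it vanishes\<close>
    define r where "r = n mod int k"
    have nr: "n = int k * (n div int k) + r" by (simp add: r_def)
    have "0 \<le> r" "r < int k" using k0 by (auto simp: r_def)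
    have "sh r w \<in> ?H" using sh_H w by blast
    then have "e (sh r w) = e (sh (int k * (n div int k)) (sh r w))" using shkq by simp
    also have "\<dots> = e w" using eq n nr by (simp add: sh_sh)
    finally have "e (sh r w0) = e w0" using lift_unique w w0 by blast
    then have "\<not> nat r < k \<or> nat r = 0" using not_less_Least[of "nat r" per] \<open>0 \<le> r\<close>
      by (auto simp: per_def k_def)
    then have "r = 0" using \<open>0 \<le> r\<close> \<open>r < int k\<close> by auto
    then have "w' = sh (int k * (n div int k)) w" using n nr by simp
    then show "\<exists>q::int. w' = w + of_int (int k * q) * (2 * pi * \<i>)" unfolding sh_def by blast
  next
    assume "\<exists>q::int. w' = w + of_int (int k * q) * (2 * pi * \<i>)"
    then obtain q where "w' = sh (int k * q) w" by (auto simp: sh_def)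
    then show "e w = e w'" using shkq w by simp
  qed
  show thesis
    by (rule that[of k e]) (use k0 e e_eq in auto)
qed

text \<open>Any logarithm may be used in place of the principal one, since \<open>k * 2 * pi * \<i>\<close> is a period
  of \<open>e\<close>. This gives continuity across the cut of \<open>Ln\<close>.\<close>

lemma exp_lift_power:
  fixes e :: "complex \<Rightarrow> complex"
  assumes k: "k > 0" and m: "0 < m" and e: "continuous_on {w. Re w < ln m} e"
    and e_eq: "\<forall>w w'. Re w < ln m \<longrightarrow> Re w' < ln m \<longrightarrow>
       (e w = e w' \<longleftrightarrow> (\<exists>q::int. w' = w + of_int (int k * q) * (2 * pi * \<i>)))"
  defines "\<psi> \<equiv> \<lambda>z. e (of_nat k * Ln z)"
  shows "continuous_on (ball 0 (root k m) - {0}) \<psi>" and "inj_on \<psi> (ball 0 (root k m) - {0})"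
    and "\<And>z. z \<in> ball 0 (root k m) - {0} \<Longrightarrow> Re (of_nat k * Ln z) < ln m"
proof -
  have lt: "Re (of_nat k * l) < ln m" if "exp l \<in> ball 0 (root k m) - {0}" for l
  proof -
    have "exp (Re l) < root k m" using that by simp
    then have "exp (Re l) ^ k < root k m ^ k" using k by (intro power_strict_mono) auto
    then have "exp (of_nat k * Re l) < m" using k m by (simp add: exp_of_nat_mult)
    then have "of_nat k * Re l < ln m" using m by (metis exp_less_cancel_iff exp_ln)
    then show ?thesis by simp
  qed
  then show less: "Re (of_nat k * Ln z) < ln m" if "z \<in> ball 0 (root k m) - {0}" for z
    using that lt[of "Ln z"] by (simp add: exp_Ln)
  have any_log: "\<psi> z = e (of_nat k * l)" if "exp l = z" "z \<in> ball 0 (root k m) - {0}" for z l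
  proof -
    have "exp (Ln z) = exp l" using that by (simp add: exp_Ln)
    then obtain n :: int where "l = Ln z + (of_int (2 * n) * pi) * \<i>"
      using exp_eq[of l "Ln z"] by auto
    then have "of_nat k * l = of_nat k * Ln z + of_int (int k * n) * (2 * pi * \<i>)"
      by (simp add: algebra_simps)
    then show ?thesis unfolding \<psi>_def using e_eq less lt[of l] that
      by metis
  qed
  have cont_log: "continuous_on V \<psi>"
    if V_exp: "\<And>z. z \<in> V \<Longrightarrow> exp (l z) = z" and "continuous_on V l" and
      "V \<subseteq> ball 0 (root k m) - {0}" for V l
  proof -
    have "exp (l z) \<in> ball 0 (root k m) - {0}" if "z \<in> V" for z
      using that \<open>V \<subseteq> _\<close> V_exp by auto
    then have "(\<lambda>z. of_nat k * l z) ` V \<subseteq> {w. Re w < ln m}" using lt by blast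
    then have "continuous_on V (\<lambda>z. e (of_nat k * l z))"
      by (intro continuous_on_compose2[OF e] continuous_intros \<open>continuous_on V l\<close>)
    then show ?thesis by (rule continuous_on_eq) (use any_log that in fastforce)
  qed
  let ?D = "ball 0 (root k m) - {0} :: complex set"
  have "continuous_on (?D - \<real>\<^sub>\<le>\<^sub>0) \<psi>"
    by (rule cont_log[of _ Ln]) (auto intro!: continuous_intros)
  moreover have "continuous_on (?D - \<real>\<^sub>\<ge>\<^sub>0) \<psi>"
  proof (rule cont_log[of _ "\<lambda>z. Ln (- z) + \<i> * pi"])
    show "continuous_on (?D - \<real>\<^sub>\<ge>\<^sub>0) (\<lambda>z. Ln (- z) + \<i> * pi)"
      by (intro continuous_intros) (auto simp: complex_nonneg_Reals_iff complex_nonpos_Reals_iff)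
  qed (auto simp: exp_add exp_Ln)
  moreover have "open (?D - \<real>\<^sub>\<le>\<^sub>0)" "open (?D - \<real>\<^sub>\<ge>\<^sub>0)"
    by (auto intro!: open_Diff closed_nonpos_Reals_complex closed_nonneg_Reals_complex)
  ultimately have "continuous_on ((?D - \<real>\<^sub>\<le>\<^sub>0) \<union> (?D - \<real>\<^sub>\<ge>\<^sub>0)) \<psi>"
    by (intro continuous_on_open_Un) auto
  moreover have "(?D - \<real>\<^sub>\<le>\<^sub>0) \<union> (?D - \<real>\<^sub>\<ge>\<^sub>0) = ?D"
    by (auto simp: complex_nonneg_Reals_iff complex_nonpos_Reals_iff complex_eq_iff)
  ultimately show "continuous_on ?D \<psi>" by simp
  show "inj_on \<psi> ?D"
  proof (rule inj_onI)
    fix z z' assume z: "z \<in> ?D" "z' \<in> ?D" "\<psi> z = \<psi> z'"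
    then obtain q :: int where "of_nat k * Ln z' = of_nat k * Ln z + of_int (int k * q) * (2 * pi * \<i>)"
      unfolding \<psi>_def using e_eq less by metis
    then have "of_nat k * Ln z' = of_nat k * (Ln z + of_int q * (2 * pi * \<i>))"
      by (simp add: algebra_simps)
    then have "Ln z' = Ln z + of_int q * (2 * pi * \<i>)" using k by (simp only: mult_cancel_left of_nat_eq_0_iff) auto
    then have "exp (Ln z') = exp (Ln z)" unfolding exp_eq by (intro exI[of _ q]) simp
    then show "z = z'" using z by (simp add: exp_Ln)
  qed
qed

text \<open>The topological form of the local normal form of holomorphic maps. Over a small disk of
  radius \<open>m\<close> about the critical value, \<open>F\<close> is a covering away from \<open>0\<close>; with \<open>e\<close> and \<open>k\<close> as in
  \<open>punctured_disk_lift_of_exp\<close>, the map \<open>z \<mapsto> e (k * Ln z)\<close> is an injective parametrisation of a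
  neighbourhood of \<open>0\<close> in which \<open>F\<close> becomes \<open>z \<mapsto> z ^ k\<close>. Its image is open by invariance of domain.\<close>

lemma isolated_branch_point_power_map:
  fixes F :: "complex \<Rightarrow> complex"
  assumes r: "r > 0" and F: "continuous_on (ball 0 r) F" "F 0 = 0"
    and nz: "\<And>z. z \<in> ball 0 r - {0} \<Longrightarrow> F z \<noteq> 0"
    and inj: "\<And>z. z \<in> ball 0 r - {0} \<Longrightarrow> \<exists>N. open N \<and> z \<in> N \<and> inj_on F N"
  obtains k m \<xi> \<xi>' U where "k > 0" "0 < m" "m \<le> 1" "open U" "U \<subseteq> ball 0 r" "\<xi> 0 = 0"
    "homeomorphism (ball 0 1) U \<xi> \<xi>'" "\<And>z. z \<in> ball 0 1 \<Longrightarrow> F (\<xi> z) = of_real m * z ^ k"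
proof -
  define s where "s = r / 2"
  have s: "s > 0" "cball 0 s \<subseteq> ball (0::complex) r" using r by (auto simp: s_def)
  have Fs: "continuous_on (cball 0 s) F" using F(1) s(2) by (rule continuous_on_subset)
  have away: "\<exists>\<eta>>0. \<forall>z\<in>cball 0 s. \<epsilon> \<le> norm z \<longrightarrow> \<eta> \<le> norm (F z)" if "\<epsilon> > 0" for \<epsilon>
  proof (cases "cball 0 s \<inter> {z::complex. \<epsilon> \<le> norm z} = {}")
    case True
    then have "\<not> \<epsilon> \<le> norm z" if "z \<in> cball 0 s" for z :: complex using that by blast
    then show ?thesis by (intro exI[of _ 1]) auto
  next
    case False
    have "compact (cball 0 s \<inter> {z::complex. \<epsilon> \<le> norm z})"
      by (intro compact_Int_closed compact_cball closed_Collect_le continuous_intros)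
    moreover have "continuous_on (cball 0 s \<inter> {z. \<epsilon> \<le> norm z}) (\<lambda>z. norm (F z))"
      by (intro continuous_intros continuous_on_subset[OF Fs]) auto
    ultimately obtain z0 where z0: "z0 \<in> cball 0 s \<inter> {z. \<epsilon> \<le> norm z}"
      "\<And>z. z \<in> cball 0 s \<inter> {z. \<epsilon> \<le> norm z} \<Longrightarrow> norm (F z0) \<le> norm (F z)"
      using continuous_attains_inf[OF _ False] by metis
    have "z0 \<in> ball 0 r - {0}" using z0(1) s(2) that by auto
    then have "norm (F z0) > 0" using nz by simp
    then show ?thesis using z0(2) by (intro exI[of _ "norm (F z0)"]) auto
  qed
  obtain m1 where m1: "m1 > 0" "\<And>z. z \<in> cball 0 s \<Longrightarrow> s \<le> norm z \<Longrightarrow> m1 \<le> norm (F z)"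
    using away[OF s(1)] by blast
  define m where "m = min m1 1"
  have m: "0 < m" "m \<le> 1" "m \<le> m1" using m1 by (auto simp: m_def)
  define c where "c = {z \<in> ball 0 s - {0}. norm (F z) < m}"
  have c_sub: "c \<subseteq> ball 0 r - {0}" "c \<subseteq> cball 0 s" using s(2) by (auto simp: c_def)
  have Fc: "continuous_on c F" using Fs c_sub(2) by (rule continuous_on_subset)
  have "c = (ball 0 s - {0}) \<inter> F -` ball 0 m" by (auto simp: c_def)
  moreover have "open ((ball 0 s - {0}) \<inter> F -` ball 0 m)"
    by (rule continuous_open_preimage) (auto intro!: continuous_on_subset[OF Fs])
  ultimately have "open c" by simp
  have "c \<noteq> {}"
  proof -
    have "continuous (at 0) F" using F(1) r by (simp add: continuous_on_eq_continuous_at)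
    then obtain d where d: "d > 0" "\<And>z. dist z 0 < d \<Longrightarrow> dist (F z) (F 0) < m"
      using m(1) by (metis continuous_at_eps_delta dist_commute)
    define z :: complex where "z = of_real (min d s / 2)"
    have "norm z = min d s / 2" using d(1) s(1) by (simp add: z_def)
    then have "z \<in> c" using d(1) d(2)[of z] s(1) F(2) by (auto simp: c_def z_def)
    then show ?thesis by blast
  qed
  have Fim: "F ` c \<subseteq> ball 0 m - {0}" using nz c_sub(1) by (auto simp: c_def)
  have proper: "compact (c \<inter> F -` K)" if "compact K" "K \<subseteq> ball 0 m - {0}" for K
  proof -
    have "c \<inter> F -` K = cball 0 s \<inter> F -` K"
    proof (intro equalityI subsetI)
      fix z assume z: "z \<in> cball 0 s \<inter> F -` K"
      then have "norm (F z) < m" "z \<noteq> 0" using that F(2) by auto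
      moreover have "norm z < s"
        using m1(2)[of z] z \<open>norm (F z) < m\<close> m(3) by (auto simp: not_le[symmetric])
      ultimately show "z \<in> c \<inter> F -` K" using z by (auto simp: c_def)
    qed (use c_sub in auto)
    moreover have "closed (cball 0 s \<inter> F -` K)"
      by (rule continuous_closed_preimage[OF Fs]) (use that compact_imp_closed in auto)
    ultimately show ?thesis
      using compact_Int_closed[OF compact_cball, of "cball 0 s \<inter> F -` K" 0 s]
      by (metis Int_assoc Int_absorb)
  qed
  have injc: "\<exists>N. open N \<and> z \<in> N \<and> N \<subseteq> c \<and> inj_on F N" if "z \<in> c" for z
  proof -
    have "z \<in> ball 0 r - {0}" using that c_sub(1) by blast
    from inj[OF this] obtain N where "open N" "z \<in> N" "inj_on F N" by blast
    then show ?thesis using \<open>open c\<close> that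
      by (intro exI[of _ "N \<inter> c"]) (auto intro: inj_on_subset)
  qed
  have connV: "connected (ball (0::complex) m - {0})"
    by (rule connected_punctured_ball) simp
  have openV: "open (ball (0::complex) m - {0})" by auto
  note cov = proper_locally_injective_covering[OF \<open>open c\<close> \<open>c \<noteq> {}\<close> openV connV Fc Fim injc proper]
  obtain k e where k: "k > 0" and e: "continuous_on {w. Re w < ln m} e" "e ` {w. Re w < ln m} \<subseteq> c"
    "\<And>w. Re w < ln m \<Longrightarrow> F (e w) = exp w"
    and e_eq: "\<And>w w'. Re w < ln m \<Longrightarrow> Re w' < ln m \<Longrightarrow>
       e w = e w' \<longleftrightarrow> (\<exists>q::int. w' = w + of_int (int k * q) * (2 * pi * \<i>))"
    by (rule punctured_disk_lift_of_exp[OF cov(1) m(1) cov(2)]) (use openV in auto)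
  let ?D = "ball 0 (root k m) - {0} :: complex set"
  have "\<forall>w w'. Re w < ln m \<longrightarrow> Re w' < ln m \<longrightarrow>
       (e w = e w' \<longleftrightarrow> (\<exists>q::int. w' = w + of_int (int k * q) * (2 * pi * \<i>)))"
    using e_eq by simp
  note \<psi> = exp_lift_power[OF k m(1) e(1) this]
  define \<psi> where "\<psi> = (\<lambda>z. if z = 0 then 0 else e (of_nat k * Ln z))"
  have \<psi>c: "\<psi> z \<in> c" if "z \<in> ?D" for z using \<psi>(3)[OF that] e(2) that by (auto simp: \<psi>_def)
  have F\<psi>: "F (\<psi> z) = z ^ k" if "z \<in> ball 0 (root k m)" for z
  proof (cases "z = 0")
    case False
    then have "z \<in> ?D" using that by simp
    then show ?thesis using \<psi>(3) e(3) False by (simp add: \<psi>_def exp_of_nat_mult exp_Ln)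
  qed (use F k in \<open>simp add: \<psi>_def\<close>)
  have "continuous_on ?D \<psi>" using \<psi>(1) by (rule continuous_on_eq) (auto simp: \<psi>_def)
  moreover have "open ?D" by auto
  ultimately have "continuous (at z) \<psi>" if "z \<in> ?D" for z
    using that continuous_on_eq_continuous_at by blast
  moreover have "continuous (at 0) \<psi>"
    unfolding continuous_at_eps_delta
  proof (intro allI impI)
    fix \<epsilon> :: real assume "\<epsilon> > 0"
    then obtain \<eta> where \<eta>: "\<eta> > 0" "\<And>z. z \<in> cball 0 s \<Longrightarrow> \<epsilon> \<le> norm z \<Longrightarrow> \<eta> \<le> norm (F z)"
      using away by blast
    have "dist (\<psi> z) (\<psi> 0) < \<epsilon>" if z: "dist z 0 < min (root k m) (root k \<eta>)" for z
    proof (cases "z = 0")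
      case False
      then have "z \<in> ?D" using z by simp
      then have "\<psi> z \<in> cball 0 s" "norm (F (\<psi> z)) = norm z ^ k"
        using \<psi>c[OF \<open>z \<in> ?D\<close>] c_sub(2) F\<psi>[of z] \<open>z \<in> ?D\<close> by (blast, simp add: norm_power)
      moreover have "norm z ^ k < root k \<eta> ^ k" using z k by (intro power_strict_mono) auto
      moreover have "root k \<eta> ^ k = \<eta>" using k \<eta>(1) by simp
      ultimately have "norm (\<psi> z) < \<epsilon>" using \<eta>(2)[of "\<psi> z"] by linarith
      then show ?thesis by (simp add: \<psi>_def)
    qed (use \<open>\<epsilon> > 0\<close> in simp)
    then show "\<exists>d>0. \<forall>x'. dist x' 0 < d \<longrightarrow> dist (\<psi> x') (\<psi> 0) < \<epsilon>"
      using k m(1) \<eta>(1) by (intro exI[of _ "min (root k m) (root k \<eta>)"]) auto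
  qed
  ultimately have cont: "continuous_on (ball 0 (root k m)) \<psi>"
    by (metis Diff_iff continuous_at_imp_continuous_on empty_iff insert_iff)
  have inj\<psi>: "inj_on \<psi> (ball 0 (root k m))"
  proof (rule inj_onI)
    fix z z' assume z: "z \<in> ball 0 (root k m)" "z' \<in> ball 0 (root k m)" "\<psi> z = \<psi> z'"
    have zero: "\<psi> u = 0 \<longleftrightarrow> u = 0" if "u \<in> ball 0 (root k m)" for u
    proof (cases "u = 0")
      case False
      then have "\<psi> u \<in> c" using \<psi>c[of u] that by simp
      then show ?thesis using False by (simp add: c_def)
    qed (simp add: \<psi>_def)
    show "z = z'"
    proof (cases "z = 0")
      case True then show ?thesis using z zero by metis
    next
      case False
      then have "z' \<noteq> 0" using z zero by metis
      then have "z \<in> ?D" "z' \<in> ?D" using z False by auto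
      then show ?thesis using inj_onD[OF \<psi>(2), of z z'] z(3) by (simp add: \<psi>_def)
    qed
  qed
  define \<rho> where "\<rho> = root k m"
  have \<rho>: "\<rho> > 0" "\<rho> ^ k = m" using k m(1) by (auto simp: \<rho>_def)
  define \<xi> where "\<xi> = (\<lambda>z. \<psi> (of_real \<rho> * z))"
  have mem: "of_real \<rho> * z \<in> ball 0 (root k m)" if "z \<in> ball 0 1" for z :: complex
    using that \<rho> by (simp add: norm_mult \<rho>_def[symmetric])
  have cont\<xi>: "continuous_on (ball 0 1) \<xi>" unfolding \<xi>_def
    by (intro continuous_on_compose2[OF cont] continuous_intros) (use mem in auto)
  have inj\<xi>: "inj_on \<xi> (ball 0 1)" unfolding \<xi>_def
    using inj_onD[OF inj\<psi>] mem \<rho>(1) by (intro inj_onI) (metis mult_cancel_left of_real_eq_0_iff less_irrefl)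
  obtain \<xi>' where \<xi>': "homeomorphism (ball 0 1) (\<xi> ` ball 0 1) \<xi> \<xi>'"
    using invariance_of_domain_homeomorphism[OF open_ball cont\<xi> _ inj\<xi>] by auto
  show thesis
  proof (rule that[OF k m(1,2) _ _ _ \<xi>'])
    show "open (\<xi> ` ball 0 1)" using invariance_of_domain[OF cont\<xi> open_ball inj\<xi>] .
    show "\<xi> ` ball 0 1 \<subseteq> ball 0 r"
    proof
      fix u assume "u \<in> \<xi> ` ball 0 1"
      then obtain z where z: "z \<in> ball 0 1" "u = \<psi> (of_real \<rho> * z)" by (auto simp: \<xi>_def)
      show "u \<in> ball 0 r"
        using \<psi>c[of "of_real \<rho> * z"] mem[OF z(1)] c_sub(1) z(2) r by (cases "of_real \<rho> * z = 0") (auto simp: \<psi>_def)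
    qed
    show "\<xi> 0 = 0" by (simp add: \<xi>_def \<psi>_def)
    show "F (\<xi> z) = of_real m * z ^ k" if "z \<in> ball 0 1" for z
      using F\<psi>[OF mem[OF that]] \<rho>(2) by (simp add: \<xi>_def power_mult_distrib flip: of_real_power)
  qed
qed

section \<open>Recognising the local degree\<close>

definition locally_injective_at :: "'a::topological_space set \<Rightarrow> ('a \<Rightarrow> 'b) \<Rightarrow> 'a \<Rightarrow> bool"
  where "locally_injective_at S f x \<longleftrightarrow> (\<exists>U. openin (top_of_set S) U \<and> x \<in> U \<and> inj_on f U)"

lemma homeomorphism_openin_preimage:
  assumes "homeomorphism U D \<phi> \<phi>'" "openin (top_of_set S) U" "open M" "M \<subseteq> D"
  shows "openin (top_of_set S) (\<phi>' ` M)"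
proof -
  have "openin (top_of_set D) M" using assms(3,4) by (simp add: open_subset)
  then have "openin (top_of_set U) (\<phi>' ` M)"
    using homeomorphism_imp_open_map[OF homeomorphism_symD[OF assms(1)]] by blast
  then show ?thesis using assms(2) openin_trans by blast
qed

lemma homeomorphism_open_image:
  assumes "homeomorphism U D \<phi> \<phi>'" "openin (top_of_set S) U" "open D"
    "openin (top_of_set S) W" "W \<subseteq> U"
  shows "open (\<phi> ` W)"
proof -
  have "openin (top_of_set U) W" 
    by (rule openin_subset_trans[OF assms(4,5)]) (use assms(2) openin_imp_subset in blast)
  then have "openin (top_of_set D) (\<phi> ` W)"
    using homeomorphism_imp_open_map[OF assms(1)] by blast
  then show ?thesis by (simp add: openin_open_eq assms(3))
qed

lemma homeomorphism_restrict:
  assumes "homeomorphism U D \<phi> \<phi>'" "M \<subseteq> D"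
  shows "homeomorphism (\<phi>' ` M) M \<phi> \<phi>'"
proof -
  have "\<phi>' ` M \<subseteq> U" using assms by (auto simp: homeomorphism_def)
  then show ?thesis
    by (rule homeomorphism_symD[OF homeomorphism_of_subsets[OF homeomorphism_symD[OF assms(1)] assms(2) _ refl]])
qed

text \<open>The plane result read through a chart at \<open>y\<close> and a chart at \<open>G y\<close>. Charts of the target are
  shrunk to the disk of radius \<open>m\<close> and rescaled.\<close>

proposition isolated_branch_point_has_local_degree:
  fixes S :: "'a::topological_space set" and G :: "'a \<Rightarrow> 'a"
  assumes charts: "\<And>x. x \<in> S \<Longrightarrow> \<exists>U \<phi> \<phi>'. openin (top_of_set S) U \<and> x \<in> U \<and>
      homeomorphism U (ball (0::complex) 1) \<phi> \<phi>' \<and> \<phi> x = 0"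
    and G: "continuous_on S G" "G ` S \<subseteq> S" and y: "y \<in> S"
    and W: "openin (top_of_set S) W" "y \<in> W"
    and fiber: "\<And>x. x \<in> W - {y} \<Longrightarrow> G x \<noteq> G y"
    and inj: "\<And>x. x \<in> W - {y} \<Longrightarrow> locally_injective_at S G x"
  shows "\<exists>k. has_local_degree S G y k"
proof -
  obtain U \<phi> \<phi>' where U: "openin (top_of_set S) U" "y \<in> U" "homeomorphism U (ball (0::complex) 1) \<phi> \<phi>'" "\<phi> y = 0"
    using charts[OF y] by blast
  have "G y \<in> S" using G y by blast
  from charts[OF this] obtain V \<psi> \<psi>' where V: "openin (top_of_set S) V" "G y \<in> V" "homeomorphism V (ball (0::complex) 1) \<psi> \<psi>'" "\<psi> (G y) = 0"
    by blast
  define W' where "W' = W \<inter> U \<inter> (S \<inter> G -` V)"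
  have "openin (top_of_set S) (S \<inter> G -` V)" using G V(1)
    by (metis continuous_on_open_gen image_subset_iff_funcset)
  then have W': "openin (top_of_set S) W'" "y \<in> W'" "W' \<subseteq> U" "W' \<subseteq> W" "W' \<subseteq> S" "G ` W' \<subseteq> V"
    using W U V y by (auto simp: W'_def)
  have "open (\<phi> ` W')" by (rule homeomorphism_open_image[OF U(3,1) open_ball W'(1,3)])
  moreover have "0 \<in> \<phi> ` W'" using W'(2) U(4) by force
  ultimately obtain r where r: "r > 0" "ball 0 r \<subseteq> \<phi> ` W'" using open_contains_ball by blast
  have \<phi>'W: "\<phi>' z \<in> W'" "\<phi> (\<phi>' z) = z" if "z \<in> ball 0 r" for z
  proof -
    obtain x where "x \<in> W'" "z = \<phi> x" using r(2) \<open>z \<in> ball 0 r\<close> by blast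
    then show "\<phi>' z \<in> W'" "\<phi> (\<phi>' z) = z" using U(3) W'(3) by (auto simp: homeomorphism_def)
  qed
  have r1: "ball 0 r \<subseteq> ball (0::complex) 1"
    using r(2) W'(3) homeomorphism_image1[OF U(3)] by blast
  have \<phi>'0: "\<phi>' 0 = y" using U by (metis homeomorphism_apply1)
  define F where "F = (\<lambda>z. \<psi> (G (\<phi>' z)))"
  have cont\<phi>': "continuous_on (ball 0 r) \<phi>'"
    using U(3) r1 by (meson continuous_on_subset homeomorphism_cont2)
  have contF: "continuous_on (ball 0 r) F"
  proof -
    have "continuous_on (ball 0 r) (\<lambda>z. G (\<phi>' z))"
      by (rule continuous_on_compose2[OF G(1) cont\<phi>']) (use \<phi>'W W' in auto)
    then show ?thesis unfolding F_def
      by (rule continuous_on_compose2[OF homeomorphism_cont1[OF V(3)]]) (use \<phi>'W W' in auto)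
  qed
  have F0: "F 0 = 0" by (simp add: F_def \<phi>'0 V)
  have Vinj: "inj_on \<psi> V" using V(3) by (metis homeomorphism_apply1 inj_on_inverseI)
  have \<phi>'y: "\<phi>' z \<in> W - {y}" if "z \<in> ball 0 r - {0}" for z
    using that \<phi>'W[of z] W' U(4) by auto
  have Fnz: "F z \<noteq> 0" if "z \<in> ball 0 r - {0}" for z
  proof -
    have "G (\<phi>' z) \<in> V" using \<phi>'W that W' by blast
    then show ?thesis using fiber[OF \<phi>'y[OF that]] inj_onD[OF Vinj, of "G (\<phi>' z)" "G y"] V by (auto simp: F_def)
  qed
  have Finj: "\<exists>N. open N \<and> z \<in> N \<and> inj_on F N" if z: "z \<in> ball 0 r - {0}" for z
  proof -
    obtain N where N: "openin (top_of_set S) N" "\<phi>' z \<in> N" "inj_on G N"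
      using inj[OF \<phi>'y[OF z]] unfolding locally_injective_at_def by blast
    have "openin (top_of_set S) (N \<inter> W')" using N W' by auto
    then have "open (\<phi> ` (N \<inter> W'))"
      by (rule homeomorphism_open_image[OF U(3,1) open_ball]) (use W' in auto)
    moreover have "z \<in> \<phi> ` (N \<inter> W')" using N(2) \<phi>'W z by (metis DiffD1 IntI imageI)
    moreover have "inj_on F (\<phi> ` (N \<inter> W'))"
    proof (rule inj_onI)
      fix a b assume "a \<in> \<phi> ` (N \<inter> W')" "b \<in> \<phi> ` (N \<inter> W')" "F a = F b"
      then obtain p q where pq: "p \<in> N \<inter> W'" "a = \<phi> p" "q \<in> N \<inter> W'" "b = \<phi> q" by blast
      then have "\<phi>' a = p" "\<phi>' b = q" using U(3) W'(3) by (auto simp: homeomorphism_def)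
      then have "G p = G q" using \<open>F a = F b\<close> inj_onD[OF Vinj] pq W'(6) by (auto simp: F_def)
      then show "a = b" using inj_onD[OF N(3)] pq by auto
    qed
    ultimately show ?thesis by blast
  qed
  obtain k m \<xi> \<xi>' M where k: "k > 0" and m: "0 < m" "m \<le> 1" and M: "open M" "M \<subseteq> ball 0 r"
    and \<xi>: "\<xi> 0 = 0" "homeomorphism (ball 0 1) M \<xi> \<xi>'" "\<And>z. z \<in> ball 0 1 \<Longrightarrow> F (\<xi> z) = of_real m * z ^ k"
    using isolated_branch_point_power_map[OF r(1) contF F0 Fnz Finj] by metis
  define U2 where "U2 = \<phi>' ` M"
  define V2 where "V2 = \<psi>' ` ball 0 m"
  have M1: "M \<subseteq> ball 0 1" using M r1 by blast
  have m1: "ball 0 m \<subseteq> ball (0::complex) 1" using m by auto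
  have scale: "homeomorphism (ball 0 m) (ball (0::complex) 1) (\<lambda>z. z / of_real m) (\<lambda>z. of_real m * z)"
    by (rule homeomorphismI) (use m in \<open>auto simp: norm_divide norm_mult intro!: continuous_intros\<close>)
  have hU: "homeomorphism U2 (ball 0 1) (\<xi>' \<circ> \<phi>) (\<phi>' \<circ> \<xi>)"
    unfolding U2_def by (rule homeomorphism_compose[OF homeomorphism_restrict[OF U(3) M1] homeomorphism_symD[OF \<xi>(2)]])
  have hV: "homeomorphism V2 (ball 0 1) ((\<lambda>z. z / of_real m) \<circ> \<psi>) (\<psi>' \<circ> (\<lambda>z. of_real m * z))"
    unfolding V2_def by (rule homeomorphism_compose[OF homeomorphism_restrict[OF V(3) m1] scale])
  have oU: "openin (top_of_set S) U2" unfolding U2_def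
    by (rule homeomorphism_openin_preimage[OF U(3,1) M(1) M1])
  have oV: "openin (top_of_set S) V2" unfolding V2_def
    by (rule homeomorphism_openin_preimage[OF V(3,1) open_ball m1])
  have "0 \<in> M" using \<xi>(1,2) unfolding homeomorphism_def by force
  then have yU: "y \<in> U2" unfolding U2_def using \<phi>'0 by force
  have \<psi>'0: "\<psi>' 0 = G y" using V by (metis homeomorphism_apply1)
  have yV: "G y \<in> V2" unfolding V2_def using m \<psi>'0 by (intro image_eqI[of _ _ 0]) auto
  have M\<xi>: "\<xi> z \<in> M" if "z \<in> ball 0 1" for z using \<xi>(2) that by (auto simp: homeomorphism_def)
  have Gz: "G (\<phi>' (\<xi> z)) \<in> V2 \<and> \<psi> (G (\<phi>' (\<xi> z))) = of_real m * z ^ k" if z: "z \<in> ball 0 1" for z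
  proof
    have \<xi>z: "\<xi> z \<in> ball 0 r" using M\<xi>[OF z] M by blast
    show eq: "\<psi> (G (\<phi>' (\<xi> z))) = of_real m * z ^ k" using \<xi>(3)[OF z] by (simp add: F_def)
    have "G (\<phi>' (\<xi> z)) \<in> V" using \<phi>'W[OF \<xi>z] W'(6) by blast
    then have "G (\<phi>' (\<xi> z)) = \<psi>' (of_real m * z ^ k)" using eq V(3) by (metis homeomorphism_apply1)
    moreover have "norm z ^ k < 1" using z k by (simp add: power_less_one_iff)
    then have "of_real m * z ^ k \<in> ball 0 m" using m by (simp add: norm_mult norm_power)
    ultimately show "G (\<phi>' (\<xi> z)) \<in> V2" by (auto simp: V2_def)
  qed
  have GU: "G ` U2 \<subseteq> V2"
  proof
    fix u assume "u \<in> G ` U2"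
    then obtain w where w: "w \<in> M" "u = G (\<phi>' w)" by (auto simp: U2_def)
    then obtain z where "z \<in> ball 0 1" "w = \<xi> z" using \<xi>(2) by (auto simp: homeomorphism_def)
    then show "u \<in> V2" using Gz w by blast
  qed
  have "(\<xi>' \<circ> \<phi>) y = 0" using U(4) \<xi>(1,2) by (metis comp_apply homeomorphism_apply1 centre_in_ball zero_less_one)
  moreover have "((\<lambda>z. z / of_real m) \<circ> \<psi>) (G ((\<phi>' \<circ> \<xi>) z)) = z ^ k" if "z \<in> ball 0 1" for z
    using Gz[OF that] m by simp
  ultimately show ?thesis unfolding has_local_degree_def
    using k oU yU oV yV GU hU hV by blast
qed

section \<open>The sphere cut along an arc\<close>

abbreviation exterior :: "complex set"
  where "exterior \<equiv> {z. 1 < norm z}"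

text \<open>The map \<open>H\<close> opens the sphere along the arc of \<open>\<alpha>\<close>: the exterior of the unit disk becomes a
  punctured neighbourhood of the arc, and the two sides of the arc become the upper and the lower
  half of the circle. The last clause says that every point near the arc is reached from the
  corresponding place of the circle. The point at infinity is left out, as only a neighbourhood of
  the arc matters.\<close>

definition slit :: "'a::metric_space set \<Rightarrow> (complex \<Rightarrow> 'a) \<Rightarrow> (complex \<Rightarrow> 'a) \<Rightarrow> bool"
  where "slit S \<alpha> H \<longleftrightarrow>
    continuous_on {z. 1 \<le> norm z} H \<and> (\<forall>t \<in> circle. H t = \<alpha> t) \<and>
    inj_on H exterior \<and> H ` exterior \<subseteq> S - \<alpha> ` circle \<and>
    (\<forall>U. open U \<longrightarrow> openin (top_of_set S) (H ` (U \<inter> exterior))) \<and>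
    (\<forall>t \<in> circle. \<forall>\<epsilon> > 0. \<exists>\<delta> > 0. \<forall>x \<in> S - \<alpha> ` circle. dist x (\<alpha> t) < \<delta> \<longrightarrow>
       (\<exists>z \<in> exterior \<inter> (ball t \<epsilon> \<union> ball (cnj t) \<epsilon>). x = H z))"

lemma topspace_plane_compactification: "topspace plane_compactification = UNIV"
  by (auto simp: plane_compactification_def image_iff)

lemma openin_plane_compactification_Some: "openin plane_compactification (Some ` U) \<longleftrightarrow> open U"
  by (simp add: plane_compactification_def)

lemma closed_Delta_inf_eq: "closed_Delta_inf = insert None (Some ` {z. 1 \<le> norm z})"
proof
  let ?C = "insert None (Some ` {z::complex. 1 \<le> norm z})"
  have eq: "UNIV - ?C = Some ` ball 0 1"
    by (rule set_eqI, case_tac x) (auto simp: image_iff)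
  then have "closedin plane_compactification ?C"
    unfolding closedin_def topspace_plane_compactification eq openin_plane_compactification_Some by simp
  moreover have "Delta_inf \<subseteq> ?C" by (auto simp: Delta_inf_def)
  ultimately show "closed_Delta_inf \<subseteq> ?C" unfolding closed_Delta_inf_def
    by (simp add: closure_of_minimal)
  have "Some ` (euclidean closure_of exterior) \<subseteq> plane_compactification closure_of (Some ` exterior)"
    unfolding plane_compactification_def
    by (rule continuous_map_image_closure_subset[OF continuous_map_Some])
  moreover have "closure exterior = - ball (0::complex) 1"
  proof -
    have "exterior = - cball (0::complex) 1" by auto
    then show ?thesis by (simp only: closure_complement interior_cball)
  qed
  ultimately have "Some ` {z. 1 \<le> norm z} \<subseteq> plane_compactification closure_of Delta_inf"
    using closure_of_mono[of "Some ` exterior" Delta_inf plane_compactification]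
    by (fastforce simp: Delta_inf_def)
  moreover have "Delta_inf \<subseteq> plane_compactification closure_of Delta_inf"
    by (rule closure_of_subset) (simp add: topspace_plane_compactification)
  ultimately show "?C \<subseteq> closed_Delta_inf" unfolding closed_Delta_inf_def by (auto simp: Delta_inf_def)
qed

lemma Delta_inf_subset: "Delta_inf \<subseteq> closed_Delta_inf"
  by (auto simp: Delta_inf_def closed_Delta_inf_eq)

text \<open>The last clause of \<open>slit\<close> is a compactness argument: outside small disks about \<open>t\<close> and
  \<open>cnj t\<close>, the closed exterior region including the point at infinity is compact, so its image is a
  closed set, and this set misses \<open>\<alpha> t\<close>.\<close>

lemma alpha_extension_slit:
  assumes \<alpha>: "alpha_path S \<alpha>" and h: "alpha_extension S \<O> \<alpha> h"
  shows "slit S \<alpha> (\<lambda>z. h (Some z))"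
proof -
  let ?H = "\<lambda>z. h (Some z)"
  have cm: "continuous_map (subtopology plane_compactification closed_Delta_inf) (top_of_set S) h"
    and circ: "\<forall>t \<in> circle. h (Some t) = \<alpha> t"
    and hm: "homeomorphic_map (subtopology plane_compactification Delta_inf) (top_of_set (S - \<alpha> ` circle)) h"
    using h by (auto simp: alpha_extension_def)
  have img: "h ` Delta_inf = S - \<alpha> ` circle"
    using homeomorphic_imp_surjective_map[OF hm] by (simp add: topspace_plane_compactification)
  have inj: "inj_on h Delta_inf"
    using homeomorphic_imp_injective_map[OF hm] by (simp add: topspace_plane_compactification)
  have cont: "continuous_on {z. 1 \<le> norm z} ?H"
  proof -
    have "continuous_map (top_of_set {z. 1 \<le> norm z}) (subtopology plane_compactification closed_Delta_inf) Some"
      unfolding plane_compactification_def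
      by (intro continuous_map_into_subtopology continuous_map_from_subtopology continuous_map_Some)
        (auto simp: closed_Delta_inf_eq)
    from continuous_map_compose[OF this cm] show ?thesis
      by (simp add: comp_def continuous_map_in_subtopology)
  qed
  have open_\<alpha>: "openin (top_of_set S) (S - \<alpha> ` circle)"
  proof -
    have "compact (\<alpha> ` circle)" using \<alpha>
      by (intro compact_continuous_image) (auto simp: alpha_path_def)
    then show ?thesis by (metis Diff_eq openin_open_Int open_Compl compact_imp_closed)
  qed
  have open_map: "openin (top_of_set S) (?H ` (U \<inter> exterior))" if "open U" for U
  proof -
    have "open (U \<inter> exterior)" using that by (intro open_Int open_Collect_less continuous_intros)
    then have "openin (subtopology plane_compactification Delta_inf) (Some ` (U \<inter> exterior))"
      by (subst openin_subtopology, intro exI[of _ "Some ` (U \<inter> exterior)"])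
        (auto simp: openin_plane_compactification_Some Delta_inf_def)
    then have "openin (top_of_set (S - \<alpha> ` circle)) (h ` Some ` (U \<inter> exterior))"
      using homeomorphic_imp_open_map[OF hm] open_map_def by blast
    then show ?thesis using open_\<alpha> openin_trans by (fastforce simp: image_image)
  qed
  have near: "\<exists>\<delta>>0. \<forall>x \<in> S - \<alpha> ` circle. dist x (\<alpha> t) < \<delta> \<longrightarrow>
       (\<exists>z \<in> exterior \<inter> (ball t \<epsilon> \<union> ball (cnj t) \<epsilon>). x = ?H z)"
    if t: "t \<in> circle" and \<epsilon>: "\<epsilon> > 0" for t \<epsilon>
  proof -
    let ?B = "ball t \<epsilon> \<union> ball (cnj t) \<epsilon>"
    define C where "C = closed_Delta_inf - Some ` ?B"
    have "compact_space plane_compactification" by (simp add: plane_compactification_def)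
    moreover have "closedin plane_compactification C"
      unfolding C_def closed_Delta_inf_def
      by (intro closedin_diff closedin_closure_of) (simp add: openin_plane_compactification_Some open_Un)
    ultimately have "compactin plane_compactification C" by (rule closedin_compact_space)
    then have "compactin (subtopology plane_compactification closed_Delta_inf) C"
      by (simp add: compactin_subtopology C_def)
    then have "compactin (top_of_set S) (h ` C)" by (rule image_compactin[OF _ cm])
    then have "closed (h ` C)" by (simp add: compactin_subtopology compact_imp_closed)
    moreover have "\<alpha> t \<notin> h ` C"
    proof
      assume "\<alpha> t \<in> h ` C"
      then obtain p where p: "p \<in> C" "\<alpha> t = h p" by auto
      show False
      proof (cases "p \<in> Delta_inf")
        case True then show False using img p t by blast
      next
        case False
        then obtain s where s': "p = Some s" "1 \<le> norm s"
          using p(1) by (auto simp: C_def closed_Delta_inf_eq Delta_inf_def)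
        then have "\<not> 1 < norm s" using False by (auto simp: Delta_inf_def)
        then have s: "p = Some s" "s \<in> circle" using s' by auto
        then have "\<alpha> t = \<alpha> s" using p circ by simp
        then have "s = t \<or> s = cnj t" using \<alpha> s t by (auto simp: alpha_path_def complex_eq_iff)
        then show False using p(1) s(1) \<epsilon> by (auto simp: C_def)
      qed
    qed
    ultimately obtain \<delta> where \<delta>: "\<delta> > 0" "ball (\<alpha> t) \<delta> \<subseteq> - h ` C"
      by (metis ComplI open_Compl open_contains_ball)
    have "\<exists>z \<in> exterior \<inter> ?B. x = ?H z" if x: "x \<in> S - \<alpha> ` circle" "dist x (\<alpha> t) < \<delta>" for x
    proof -
      obtain p where p: "p \<in> Delta_inf" "x = h p" using img x(1) by blast
      have "x \<in> ball (\<alpha> t) \<delta>" using x(2) by (simp add: dist_commute)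
      then have "p \<notin> C" using \<delta>(2) p(2) by blast
      then have "p \<in> Some ` ?B" using p(1) Delta_inf_subset unfolding C_def by blast
      then obtain z where "p = Some z" "z \<in> ?B" by blast
      then show ?thesis using p by (auto simp: Delta_inf_def)
    qed
    then show ?thesis using \<delta>(1) by blast
  qed
  have "inj_on ?H exterior" using inj by (auto simp: inj_on_def Delta_inf_def)
  moreover have "?H ` exterior \<subseteq> S - \<alpha> ` circle" using img by (auto simp: Delta_inf_def)
  ultimately show ?thesis unfolding slit_def using cont circ open_map near by blast
qed

lemma boundary_limit:
  assumes E: "topcontinuous_at (subtopology plane_compactification closed_Delta_inf) (top_of_set S) E (Some t)"
    and t: "t \<in> circle" "(\<epsilon>::real) > 0" and "E (Some t) \<in> (S::'a::metric_space set)"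
  shows "\<exists>\<delta>>0. \<forall>z \<in> exterior \<inter> ball t \<delta>. dist (E (Some z)) (E (Some t)) < \<epsilon>"
proof -
  have "openin (top_of_set S) (S \<inter> ball (E (Some t)) \<epsilon>)" by blast
  moreover have "E (Some t) \<in> S \<inter> ball (E (Some t)) \<epsilon>" using assms by simp
  ultimately obtain U where U: "openin (subtopology plane_compactification closed_Delta_inf) U" "Some t \<in> U"
    "\<forall>y\<in>U. E y \<in> S \<inter> ball (E (Some t)) \<epsilon>"
    using E unfolding topcontinuous_at_def by meson
  then obtain T where T: "openin plane_compactification T" "U = T \<inter> closed_Delta_inf"
    by (auto simp: openin_subtopology)
  have "openin euclidean {z \<in> topspace euclidean. Some z \<in> T}"
    using T(1) continuous_map_Some[of euclidean] unfolding plane_compactification_def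
    by (rule openin_continuous_map_preimage[rotated])
  then have "open {z. Some z \<in> T}" by simp
  moreover have "t \<in> {z. Some z \<in> T}" using U T by simp
  ultimately obtain \<delta> where "\<delta> > 0" "ball t \<delta> \<subseteq> {z. Some z \<in> T}"
    using open_contains_ball by blast
  moreover have "Some z \<in> closed_Delta_inf" if "z \<in> exterior" for z
    using that by (simp add: closed_Delta_inf_eq)
  ultimately show ?thesis using U(3) T(2) by (intro exI[of _ \<delta>]) (auto simp: dist_commute)
qed

section \<open>Elementary topology of the circle and its exterior\<close>

text \<open>Points of the circle with the same \<open>\<alpha>\<close>-image are exchanged by \<open>cnj\<close>, those with the same
  \<open>\<beta>\<close>-image by \<open>flip\<close>, the reflection in the imaginary axis.\<close>

abbreviation flip :: "complex \<Rightarrow> complex"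
  where "flip t \<equiv> - cnj t"

lemma exterior_near:
  assumes "t \<in> circle" "\<epsilon> > 0"
  obtains z where "z \<in> exterior" "dist z t < \<epsilon>"
proof
  have t: "norm t = 1" using assms by simp
  have eq: "norm (of_real (1 + \<epsilon>/2) * t) = 1 + \<epsilon>/2"
    using assms(2) by (subst norm_mult, subst norm_of_real) (simp add: t)
  then show "of_real (1 + \<epsilon>/2) * t \<in> exterior" using assms(2) by (simp del: of_real_add)
  have "of_real (1 + \<epsilon>/2) * t - t = of_real (\<epsilon>/2) * t" by (simp add: algebra_simps)
  then show "dist (of_real (1 + \<epsilon>/2) * t) t < \<epsilon>"
    unfolding dist_norm by (simp only: norm_mult norm_of_real t) (use assms in simp)
qed

lemma compact_near_fiber:
  fixes b :: "'a::metric_space \<Rightarrow> 'b::metric_space"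
  assumes K: "compact K" "continuous_on K b" and \<epsilon>: "\<epsilon> > 0"
  obtains \<delta> where "\<delta> > 0" "\<And>t. t \<in> K \<Longrightarrow> dist (b t) y < \<delta> \<Longrightarrow> \<exists>s\<in>K. b s = y \<and> dist t s < \<epsilon>"
proof -
  define M where "M = K - (\<Union>s\<in>{s\<in>K. b s = y}. ball s \<epsilon>)"
  have "compact M" unfolding M_def by (intro compact_diff K open_UN) auto
  moreover have "continuous_on M b" using K(2) by (rule continuous_on_subset) (auto simp: M_def)
  ultimately have "closed (b ` M)" by (intro compact_imp_closed compact_continuous_image)
  moreover have "y \<notin> b ` M" using \<epsilon> by (auto simp: M_def)
  ultimately obtain \<delta> where \<delta>: "\<delta> > 0" "ball y \<delta> \<subseteq> - b ` M"
    by (metis ComplI open_Compl open_contains_ball)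
  show thesis
  proof (rule that[OF \<delta>(1)])
    fix t assume t: "t \<in> K" "dist (b t) y < \<delta>"
    then have "b t \<in> ball y \<delta>" by (simp add: dist_commute)
    then have "t \<notin> M" using \<delta>(2) by blast
    then show "\<exists>s\<in>K. b s = y \<and> dist t s < \<epsilon>" using t(1) by (auto simp: M_def dist_commute)
  qed
qed

lemma connected_subset_of_two_open:
  assumes C: "connected C" "C \<subseteq> A \<union> B" and "openin (top_of_set S) A" "openin (top_of_set S) B"
    and disj: "A \<inter> B = {}"
  shows "C \<subseteq> A \<or> C \<subseteq> B"
proof -
  obtain A' B' where "open A'" "A = S \<inter> A'" "open B'" "B = S \<inter> B'"
    using assms(3,4) by (auto simp: openin_open)
  moreover then have "C \<subseteq> A' \<union> B'" "A' \<inter> B' \<inter> C = {}" using C(2) disj by blast+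
  ultimately have "A' \<inter> C = {} \<or> B' \<inter> C = {}" using connectedD[OF C(1)] by metis
  then show ?thesis using C(2) \<open>A = S \<inter> A'\<close> \<open>B = S \<inter> B'\<close> by blast
qed

lemma conjugate_balls_disjoint:
  assumes "\<epsilon> \<le> \<bar>Im t\<bar>"
  shows "ball t \<epsilon> \<inter> ball (cnj t) \<epsilon> = {}"
proof (rule disjoint_ballI)
  have "dist t (cnj t) \<ge> \<bar>Im (t - cnj t)\<bar>" unfolding dist_norm by (rule abs_Im_le_cmod)
  then show "\<epsilon> + \<epsilon> \<le> dist t (cnj t)" using assms by simp
qed

text \<open>Images of small half disks under \<open>w \<mapsto> t * exp w\<close> form a basis of connected one-sided
  neighbourhoods of a boundary point.\<close>

lemma exterior_half_ball:
  assumes t: "t \<in> circle" and \<epsilon>: "\<epsilon> > 0"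
  obtains B \<delta> where "path_connected B" "B \<subseteq> exterior \<inter> ball t \<epsilon>" "\<delta> > 0" "exterior \<inter> ball t \<delta> \<subseteq> B"
proof -
  have t1: "norm t = 1" "t \<noteq> 0" using t by auto
  have "continuous (at 0) (\<lambda>w. t * exp w)" by (intro continuous_intros)
  then obtain \<eta> where \<eta>: "\<eta> > 0" "\<And>w. dist w 0 < \<eta> \<Longrightarrow> dist (t * exp w) (t * exp 0) < \<epsilon>"
    unfolding continuous_at_eps_delta using \<epsilon> by metis
  define R where "R = {w. Re w > 0} \<inter> ball 0 \<eta>"
  have "continuous (at t) (\<lambda>z. Ln (z / t))"
    by (intro continuous_intros) (use t1 in \<open>auto simp: complex_nonpos_Reals_iff\<close>)
  then obtain \<delta> where \<delta>: "\<delta> > 0" "\<And>z. dist z t < \<delta> \<Longrightarrow> dist (Ln (z / t)) (Ln (t / t)) < \<eta>"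
    unfolding continuous_at_eps_delta using \<eta>(1) by metis
  show thesis
  proof (rule that[of "(\<lambda>w. t * exp w) ` R", OF _ _ \<delta>(1)])
    have "convex R" unfolding R_def by (intro convex_Int convex_halfspace_Re_gt convex_ball)
    then show "path_connected ((\<lambda>w. t * exp w) ` R)"
      by (intro path_connected_continuous_image convex_imp_path_connected continuous_intros)
    show "(\<lambda>w. t * exp w) ` R \<subseteq> exterior \<inter> ball t \<epsilon>"
      using \<eta>(2) by (auto simp: R_def norm_mult t1 dist_commute)
    show "exterior \<inter> ball t \<delta> \<subseteq> (\<lambda>w. t * exp w) ` R"
    proof
      fix z assume z: "z \<in> exterior \<inter> ball t \<delta>"
      then have z0: "z / t \<noteq> 0" "norm (z / t) > 1" using t1 by (auto simp: norm_divide)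
      then have "Re (Ln (z / t)) > 0" by simp
      moreover have "norm (Ln (z / t)) < \<eta>" using \<delta>(2)[of z] z t1 by (simp add: dist_commute)
      ultimately have "Ln (z / t) \<in> R" by (simp add: R_def)
      moreover have "z = t * exp (Ln (z / t))" using z0 t1 by (simp add: exp_Ln)
      ultimately show "z \<in> (\<lambda>w. t * exp w) ` R" by blast
    qed
  qed
qed

abbreviation half_circle :: "real \<Rightarrow> complex set"
  where "half_circle \<sigma> \<equiv> {t \<in> circle. 0 < \<sigma> * Im t}"

text \<open>An open half circle is one side of an \<open>\<alpha>\<close>-arc without its tips. Its connectedness is what
  propagates a local choice of side along the arc.\<close>

lemma connected_half_circle:
  assumes "\<sigma> = 1 \<or> \<sigma> = -1"
  shows "connected (half_circle \<sigma>)"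
proof -
  let ?p = "\<lambda>x. of_real x + \<i> * of_real (\<sigma> * sqrt (1 - x\<^sup>2))"
  have "half_circle \<sigma> = ?p ` {-1<..<1}"
  proof (intro equalityI subsetI)
    fix t assume t: "t \<in> half_circle \<sigma>"
    then have 1: "(Re t)\<^sup>2 + (Im t)\<^sup>2 = 1" by (simp add: cmod_def)
    moreover have "Im t \<noteq> 0" using t by auto
    ultimately have "(Re t)\<^sup>2 < 1" by (metis less_add_same_cancel1 zero_less_power2)
    then have "Re t \<in> {-1<..<1}" by (simp add: abs_square_less_1 abs_less_iff)
    moreover have "sqrt (1 - (Re t)\<^sup>2) = \<bar>Im t\<bar>" using 1 by (metis add_diff_cancel_left' real_sqrt_abs)
    then have "\<sigma> * sqrt (1 - (Re t)\<^sup>2) = Im t" using assms t by auto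
    then have "t = ?p (Re t)" by (simp add: complex_eq_iff)
    ultimately show "t \<in> ?p ` {-1<..<1}" by blast
  next
    fix t assume "t \<in> ?p ` {-1<..<1}"
    then obtain x where x: "-1 < x" "x < 1" "t = ?p x" by auto
    then have "x\<^sup>2 < 1" by (simp add: abs_square_less_1)
    then show "t \<in> half_circle \<sigma>" using assms x(3) by (auto simp: cmod_def power_mult_distrib)
  qed
  moreover have "connected (?p ` {-1<..<1})"
    by (intro connected_continuous_image continuous_intros) auto
  ultimately show ?thesis by simp
qed

lemma ball_same_side:
  assumes "w \<in> ball t \<epsilon>" "\<epsilon> \<le> \<bar>Im t\<bar>"
  shows "0 < Im w * Im t"
proof -
  have "\<bar>Im (t - w)\<bar> < \<bar>Im t\<bar>" using assms abs_Im_le_cmod[of "t - w"] by (simp add: dist_norm)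
  then show ?thesis by (cases "Im t > 0") (auto simp: zero_less_mult_iff)
qed

lemma ball_opposite_side:
  assumes "w \<in> ball (cnj t) \<epsilon>" "\<epsilon> \<le> \<bar>Im t\<bar>"
  shows "Im w * Im t < 0"
  using ball_same_side[of w "cnj t" \<epsilon>] assms by simp

text \<open>If \<open>\<Gamma>\<close> leads from a point to its antipode, the loop \<open>\<Gamma>\<^sup>2\<close> winds an odd number of times about
  \<open>0\<close>, so it separates \<open>0\<close> from the exterior of a disk containing it. A connected set that joins \<open>0\<close>
  to the exterior must therefore meet \<open>\<Gamma>\<close> or \<open>- \<Gamma>\<close>.\<close>

lemma path_to_antipode_separates:
  fixes \<Gamma> :: "real \<Rightarrow> complex"
  assumes \<Gamma>: "path \<Gamma>" "pathfinish \<Gamma> = - pathstart \<Gamma>" "path_image \<Gamma> \<subseteq> ball 0 r"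
    and A: "connected A" "0 \<in> A" "a \<in> A" "r \<le> norm a"
    and avoid: "\<And>w. w \<in> A \<Longrightarrow> w \<notin> path_image \<Gamma> \<and> - w \<notin> path_image \<Gamma>"
  shows False
proof -
  define P where "P = (\<lambda>u. (\<Gamma> u)\<^sup>2)"
  have cont\<Gamma>: "continuous_on {0..1} \<Gamma>" using \<Gamma>(1) by (simp add: path_def)
  have P: "path P" unfolding path_def P_def by (intro continuous_intros cont\<Gamma>)
  have loop: "pathfinish P = pathstart P" using \<Gamma>(2) by (simp add: P_def pathfinish_def pathstart_def)
  have \<Gamma>r: "norm (\<Gamma> u) < r" if "u \<in> {0..1}" for u
    using \<Gamma>(3) that unfolding path_image_def by (metis imageI mem_ball_0 subsetD)
  have imP: "path_image P \<subseteq> ball 0 (r\<^sup>2)"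
    using \<Gamma>r by (auto simp: path_image_def P_def norm_power intro!: power_strict_mono)
  let ?A2 = "(\<lambda>w. w\<^sup>2) ` A"
  have disj: "?A2 \<inter> path_image P = {}"
  proof -
    have "w\<^sup>2 \<noteq> (\<Gamma> u)\<^sup>2" if "w \<in> A" "u \<in> {0..1}" for w u
    proof
      assume "w\<^sup>2 = (\<Gamma> u)\<^sup>2"
      then have "\<Gamma> u = w \<or> \<Gamma> u = - w" by (auto simp: power2_eq_iff)
      then show False using avoid[OF that(1)] that(2) unfolding path_image_def by (metis imageI)
    qed
    then show ?thesis by (auto simp: path_image_def P_def)
  qed
  have A2: "0\<^sup>2 \<in> ?A2" "a\<^sup>2 \<in> ?A2" by (rule imageI, rule A)+
  then have zero: "0 \<in> ?A2" by simp
  have connA2: "connected ?A2" by (intro connected_continuous_image continuous_intros A(1))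
  have "norm (\<Gamma> 0) < r" by (rule \<Gamma>r) simp
  then have "0 \<le> r" using norm_ge_zero[of "\<Gamma> 0"] by linarith
  then have "r\<^sup>2 \<le> norm (a\<^sup>2)" using A(4) by (simp add: norm_power power_mono)
  then have "a\<^sup>2 \<notin> ball 0 (r\<^sup>2)" by (simp only: mem_ball_0 not_less)
  then have "winding_number P (a\<^sup>2) = 0"
    by (rule winding_number_zero_outside[OF P convex_ball loop _ imP])
  moreover have "winding_number P 0 = winding_number P (a\<^sup>2)"
    using winding_number_constant[OF P loop connA2 disj] zero A2(2) by (metis constant_on_def)
  ultimately have wn: "winding_number P 0 = 0" by simp
  have P0: "0 \<notin> path_image P" using disj zero by blast
  obtain q where q: "path q" "pathfinish q - pathstart q = 2 * of_real pi * \<i> * winding_number P 0"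
    "\<And>t. t \<in> {0..1} \<Longrightarrow> P t = 0 + exp (q t)"
    using winding_number_as_continuous_log[OF P P0] by metis
  \<comment> \<open>with winding number \<open>0\<close>, \<open>\<Gamma>\<^sup>2\<close> has a periodic logarithm, and \<open>\<Gamma>\<close> differs from a loop by a constant sign\<close>
  define g where "g = (\<lambda>u. \<Gamma> u / exp (q u / 2))"
  have "continuous_on {0..1} g" unfolding g_def
    by (intro continuous_intros cont\<Gamma>) (use q(1) path_def in auto)
  then have conn: "connected (g ` {0..1})" by (intro connected_continuous_image) auto
  have "g u = 1 \<or> g u = -1" if "u \<in> {0..1}" for u
  proof -
    have "(exp (q u / 2))\<^sup>2 = exp (q u)" using exp_double[of "q u / 2"] by simp
    then have "(g u)\<^sup>2 = P u / exp (q u)" by (simp add: g_def P_def power_divide)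
    then have "(g u)\<^sup>2 = 1" using q(3)[OF that] by simp
    then show ?thesis by (simp add: power2_eq_1_iff)
  qed
  then have "g ` {0..1} \<subseteq> {1, -1}" by blast
  then have "finite (g ` {0..1})" by (rule finite_subset) simp
  then have sing: "g ` {0..1} = {} \<or> (\<exists>x. g ` {0..1} = {x})"
    using connected_finite_iff_sing[OF conn] by blast
  have "g 0 \<in> g ` {0..1}" "g 1 \<in> g ` {0..1}" by (rule imageI, simp)+
  then have "g 0 = g 1" using sing by (metis empty_iff singletonD)
  moreover have "q 1 = q 0" using q(2) wn by (simp add: pathfinish_def pathstart_def)
  ultimately have "\<Gamma> 1 = \<Gamma> 0" by (simp add: g_def)
  moreover have "\<Gamma> 1 = - \<Gamma> 0" using \<Gamma>(2) by (simp add: pathfinish_def pathstart_def)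
  ultimately have "\<Gamma> 0 = 0" by (simp add: complex_eq_iff)
  moreover have "\<Gamma> 0 \<in> path_image \<Gamma>" by (simp add: path_image_def)
  ultimately show False using avoid[OF A(2)] by simp
qed

lemma dist_flip: "dist (flip s) (flip t) = dist s t"
  by (metis complex_cnj_diff complex_mod_cnj dist_minus dist_norm)

text \<open>The extension principle: limits along a dense set exist and equal the given values.\<close>

lemma continuous_on_from_dense:
  fixes G :: "'a::metric_space \<Rightarrow> 'b::metric_space"
  assumes dense: "\<And>y \<epsilon>. y \<in> S \<Longrightarrow> \<epsilon> > 0 \<Longrightarrow> \<exists>d\<in>D. dist d y < \<epsilon>"
    and lim: "\<And>y \<epsilon>. y \<in> S \<Longrightarrow> \<epsilon> > 0 \<Longrightarrow> \<exists>\<delta>>0. \<forall>d\<in>D. dist d y < \<delta> \<longrightarrow> dist (G d) (G y) < \<epsilon>"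
  shows "continuous_on S G"
  unfolding continuous_on_iff
proof (intro ballI allI impI)
  fix y and \<epsilon> :: real assume y: "y \<in> S" and \<epsilon>: "\<epsilon> > 0"
  then have "\<epsilon> / 2 > 0" by simp
  then obtain \<delta> where \<delta>: "\<delta> > 0" "\<And>d. d \<in> D \<Longrightarrow> dist d y < \<delta> \<Longrightarrow> dist (G d) (G y) < \<epsilon> / 2"
    using lim[OF y] by meson
  have "dist (G y') (G y) < \<epsilon>" if y': "y' \<in> S" "dist y' y < \<delta> / 2" for y'
  proof -
    obtain \<delta>' where \<delta>': "\<delta>' > 0" "\<And>d. d \<in> D \<Longrightarrow> dist d y' < \<delta>' \<Longrightarrow> dist (G d) (G y') < \<epsilon> / 2"
      using lim[OF y'(1) \<open>\<epsilon> / 2 > 0\<close>] by meson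
    have "min \<delta>' (\<delta> / 2) > 0" using \<delta>(1) \<delta>'(1) by simp
    then obtain d where d: "d \<in> D" "dist d y' < min \<delta>' (\<delta> / 2)" using dense[OF y'(1)] by meson
    have "dist d y < \<delta>" using d(2) y'(2) dist_triangle[of d y y'] by simp
    then have "dist (G d) (G y) < \<epsilon> / 2" using \<delta>(2) d(1) by blast
    moreover have "dist (G d) (G y') < \<epsilon> / 2" using \<delta>'(2) d by simp
    ultimately show ?thesis using dist_triangle3[of "G y'" "G y" "G d"] by simp
  qed
  then show "\<exists>d>0. \<forall>x'\<in>S. dist x' y < d \<longrightarrow> dist (G x') (G y) < \<epsilon>"
    using \<delta>(1) by (intro exI[of _ "\<delta> / 2"]) auto
qed

section \<open>The data of a regluing\<close>

text \<open>The consequences of the hypotheses that the proof rests on, with one slit map \<open>H \<alpha>\<close> chosen for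
  every arc. The last assumption is the boundary condition of the regluing in slit coordinates.\<close>

locale regluing_setup =
  fixes S :: "'a::metric_space set" and f \<Phi> :: "'a \<Rightarrow> 'a"
    and \<A> :: "(complex \<Rightarrow> 'a) set" and c H :: "(complex \<Rightarrow> 'a) \<Rightarrow> complex \<Rightarrow> 'a"
  assumes compact_S: "compact S"
    and f_ramified: "ramified_covering S f"
    and \<A>_stable: "strongly_f_stable S f \<A>"
    and \<B>_paths: "disjoint_beta_paths S (c ` \<A>)"
    and c_inj: "inj_on c \<A>"
    and \<Phi>_cont: "continuous_on (S - Im_paths \<A>) \<Phi>"
    and \<Phi>_bij: "bij_betw \<Phi> (S - Im_paths \<A>) (S - Im_paths (c ` \<A>))"
    and H_slit: "\<And>\<alpha>. \<alpha> \<in> \<A> \<Longrightarrow> slit S \<alpha> (H \<alpha>)"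
    and \<Phi>_boundary: "\<And>\<alpha> t \<epsilon>. \<alpha> \<in> \<A> \<Longrightarrow> t \<in> circle \<Longrightarrow> \<epsilon> > 0 \<Longrightarrow>
      \<exists>\<delta>>0. \<forall>z \<in> exterior \<inter> ball t \<delta>. H \<alpha> z \<notin> Im_paths \<A> \<longrightarrow> dist (\<Phi> (H \<alpha> z)) (c \<alpha> t) < \<epsilon>"
begin

abbreviation "X \<equiv> S - Im_paths \<A>"
abbreviation "Y \<equiv> S - Im_paths (c ` \<A>)"

lemma alpha: "\<alpha> \<in> \<A> \<Longrightarrow> alpha_path S \<alpha>"
  using \<A>_stable by (auto simp: strongly_f_stable_def f_stable_def disjoint_alpha_paths_def)

lemma beta: "\<alpha> \<in> \<A> \<Longrightarrow> beta_path S (c \<alpha>)"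
  using \<B>_paths by (auto simp: disjoint_beta_paths_def)

lemma alpha_in_S: "\<alpha> \<in> \<A> \<Longrightarrow> t \<in> circle \<Longrightarrow> \<alpha> t \<in> S"
  using alpha unfolding alpha_path_def PiE_iff by blast

lemma beta_in_S: "\<alpha> \<in> \<A> \<Longrightarrow> t \<in> circle \<Longrightarrow> c \<alpha> t \<in> S"
  using beta unfolding beta_path_def PiE_iff by blast

lemma alpha_eq_iff: "\<alpha> \<in> \<A> \<Longrightarrow> t \<in> circle \<Longrightarrow> t' \<in> circle \<Longrightarrow> \<alpha> t = \<alpha> t' \<longleftrightarrow> t' = t \<or> t' = cnj t"
  using alpha[of \<alpha>] unfolding alpha_path_def by (simp add: complex_eq_iff) blast

lemma beta_eq_iff: "\<alpha> \<in> \<A> \<Longrightarrow> t \<in> circle \<Longrightarrow> t' \<in> circle \<Longrightarrow> c \<alpha> t = c \<alpha> t' \<longleftrightarrow> t' = t \<or> t' = flip t"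
  using beta[of \<alpha>] unfolding beta_path_def by (simp add: complex_eq_iff) blast

lemma alpha_disjoint:
  assumes "\<alpha> \<in> \<A>" "\<alpha>' \<in> \<A>" "t \<in> circle" "t' \<in> circle" "\<alpha> t = \<alpha>' t'"
  shows "\<alpha> = \<alpha>'"
proof (rule ccontr)
  assume "\<alpha> \<noteq> \<alpha>'"
  then have "\<alpha> ` circle \<inter> \<alpha>' ` circle = {}"
    using \<A>_stable assms(1,2)
    unfolding strongly_f_stable_def f_stable_def disjoint_alpha_paths_def disjoint_family_on_def by blast
  then show False using assms(3,4,5) by blast
qed

lemma beta_disjoint:
  assumes "\<alpha> \<in> \<A>" "\<alpha>' \<in> \<A>" "t \<in> circle" "t' \<in> circle" "c \<alpha> t = c \<alpha>' t'"
  shows "\<alpha> = \<alpha>'"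
proof (rule ccontr)
  assume "\<alpha> \<noteq> \<alpha>'"
  then have "c \<alpha> \<noteq> c \<alpha>'" using c_inj assms by (auto dest: inj_onD)
  then have "c \<alpha> ` circle \<inter> c \<alpha>' ` circle = {}"
    using \<B>_paths assms(1,2) unfolding disjoint_beta_paths_def disjoint_family_on_def by blast
  then show False using assms by blast
qed

lemma alpha_cont: "\<alpha> \<in> \<A> \<Longrightarrow> continuous_on circle \<alpha>"
  using alpha by (auto simp: alpha_path_def)

lemma beta_cont: "\<alpha> \<in> \<A> \<Longrightarrow> continuous_on circle (c \<alpha>)"
  using beta by (auto simp: beta_path_def)

lemma alpha_compact: "\<alpha> \<in> \<A> \<Longrightarrow> compact (\<alpha> ` circle)"
  using alpha_cont by (intro compact_continuous_image) auto

lemma beta_compact: "\<alpha> \<in> \<A> \<Longrightarrow> compact (c \<alpha> ` circle)"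
  using beta_cont by (intro compact_continuous_image) auto

lemma alpha_notin_X: "\<alpha> \<in> \<A> \<Longrightarrow> t \<in> circle \<Longrightarrow> \<alpha> t \<notin> X"
  unfolding Im_paths_def by blast

lemma beta_notin_Y: "\<alpha> \<in> \<A> \<Longrightarrow> t \<in> circle \<Longrightarrow> c \<alpha> t \<notin> Y"
  unfolding Im_paths_def by blast

lemma S_cases_source:
  assumes "x \<in> S" obtains "x \<in> X" | \<alpha> t where "\<alpha> \<in> \<A>" "t \<in> circle" "x = \<alpha> t"
  using assms unfolding Im_paths_def by blast

lemma S_cases_target:
  assumes "y \<in> S" obtains x where "x \<in> X" "y = \<Phi> x" | \<alpha> t where "\<alpha> \<in> \<A>" "t \<in> circle" "y = c \<alpha> t"
proof (cases "y \<in> Y")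
  case True
  then show ?thesis using \<Phi>_bij that(1) unfolding bij_betw_def by blast
next
  case False
  then show ?thesis using assms that(2) unfolding Im_paths_def by blast
qed

lemma \<Phi>_in_Y: "x \<in> X \<Longrightarrow> \<Phi> x \<in> Y"
  using \<Phi>_bij by (auto simp: bij_betw_def)

lemma \<Phi>_inj: "x \<in> X \<Longrightarrow> x' \<in> X \<Longrightarrow> \<Phi> x = \<Phi> x' \<Longrightarrow> x = x'"
  using \<Phi>_bij by (auto simp: bij_betw_def inj_on_def)

lemma f_in_S: "x \<in> S \<Longrightarrow> f x \<in> S"
  using f_ramified by (auto simp: ramified_covering_def)

lemma f_cont: "continuous_on S f"
  using f_ramified by (auto simp: ramified_covering_def)

lemma f_in_X: "x \<in> X \<Longrightarrow> f x \<in> X"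
  using \<A>_stable f_in_S by (auto simp: strongly_f_stable_def f_stable_def)

lemma H_cont: "\<alpha> \<in> \<A> \<Longrightarrow> continuous_on {z. 1 \<le> norm z} (H \<alpha>)"
  using H_slit by (simp add: slit_def)

lemma H_circle: "\<alpha> \<in> \<A> \<Longrightarrow> t \<in> circle \<Longrightarrow> H \<alpha> t = \<alpha> t"
  using H_slit by (simp add: slit_def)

lemma H_inj: "\<alpha> \<in> \<A> \<Longrightarrow> z \<in> exterior \<Longrightarrow> z' \<in> exterior \<Longrightarrow> H \<alpha> z = H \<alpha> z' \<longleftrightarrow> z = z'"
  using H_slit[of \<alpha>] unfolding slit_def by (metis inj_on_eq_iff)

lemma H_in: "\<alpha> \<in> \<A> \<Longrightarrow> z \<in> exterior \<Longrightarrow> H \<alpha> z \<in> S - \<alpha> ` circle"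
  using H_slit unfolding slit_def by blast

lemma H_open: "\<alpha> \<in> \<A> \<Longrightarrow> open U \<Longrightarrow> openin (top_of_set S) (H \<alpha> ` (U \<inter> exterior))"
  using H_slit unfolding slit_def by blast

lemma H_closed_in_S:
  assumes \<alpha>: "\<alpha> \<in> \<A>" and z: "1 \<le> norm z"
  shows "H \<alpha> z \<in> S"
proof (cases "norm z = 1")
  case True
  then have "z \<in> circle" by simp
  then show ?thesis using H_circle[OF \<alpha>] alpha_in_S[OF \<alpha>] by simp
next
  case False then show ?thesis using H_in[OF \<alpha>, of z] z by simp
qed

lemma H_near:
  assumes "\<alpha> \<in> \<A>" "t \<in> circle" "\<epsilon> > 0"
  obtains \<delta> where "\<delta> > 0" "\<And>x. x \<in> S - \<alpha> ` circle \<Longrightarrow> dist x (\<alpha> t) < \<delta> \<Longrightarrow>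
       \<exists>z \<in> exterior \<inter> (ball t \<epsilon> \<union> ball (cnj t) \<epsilon>). x = H \<alpha> z"
  using H_slit[OF assms(1)] assms(2,3) unfolding slit_def by metis

lemma H_limit:
  assumes "\<alpha> \<in> \<A>" "t \<in> circle" "\<epsilon> > 0"
  obtains \<delta> where "\<delta> > 0" "\<And>z. 1 \<le> norm z \<Longrightarrow> dist z t < \<delta> \<Longrightarrow> dist (H \<alpha> z) (\<alpha> t) < \<epsilon>"
proof -
  have "1 \<le> norm t" using assms by simp
  then show thesis using H_cont[OF assms(1)] assms(3) H_circle[OF assms(1,2)] that
    unfolding continuous_on_iff by (metis mem_Collect_eq)
qed

text \<open>Baire: every arc is nowhere dense, since it is approached by its slit map from outside.\<close>

lemma X_dense:
  assumes U: "openin (top_of_set S) U" "U \<noteq> {}"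
  shows "U \<inter> X \<noteq> {}"
proof -
  have "top_of_set S interior_of \<Union>((\<lambda>\<alpha>. \<alpha> ` circle) ` \<A>) = {}"
  proof (rule Baire_category_alt)
    have "locally_compact_space (top_of_set S)"
      using compact_S by (simp add: compact_imp_locally_compact_space compact_space_subtopology)
    moreover have "regular_space (top_of_set S)"
      by (simp add: regular_space_subtopology regular_space_euclidean)
    ultimately show "completely_metrizable_space (top_of_set S) \<or>
        locally_compact_space (top_of_set S) \<and> regular_space (top_of_set S)" by blast
    show "countable ((\<lambda>\<alpha>. \<alpha> ` circle) ` \<A>)"
      using \<A>_stable by (simp add: strongly_f_stable_def f_stable_def)
    fix T assume "T \<in> (\<lambda>\<alpha>. \<alpha> ` circle) ` \<A>"
    then obtain \<alpha> where \<alpha>: "\<alpha> \<in> \<A>" "T = \<alpha> ` circle" by blast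
    have "closedin (top_of_set S) T"
      using alpha_compact[OF \<alpha>(1)] alpha_in_S[OF \<alpha>(1)] \<alpha>(2)
      by (metis closed_subset compact_imp_closed image_subsetI)
    moreover have "W = {}" if W: "openin (top_of_set S) W" "W \<subseteq> T" for W
    proof (rule ccontr)
      assume "W \<noteq> {}"
      then obtain t where t: "t \<in> circle" "\<alpha> t \<in> W" using W \<alpha> by blast
      obtain \<epsilon> where \<epsilon>: "\<epsilon> > 0" "S \<inter> ball (\<alpha> t) \<epsilon> \<subseteq> W"
        using W(1) t(2) openin_contains_ball by (metis Int_commute)
      obtain \<delta> where \<delta>: "\<delta> > 0" "\<And>z. 1 \<le> norm z \<Longrightarrow> dist z t < \<delta> \<Longrightarrow> dist (H \<alpha> z) (\<alpha> t) < \<epsilon>"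
        using H_limit[OF \<alpha>(1) t(1) \<epsilon>(1)] by metis
      obtain z where z: "z \<in> exterior" "dist z t < \<delta>" using exterior_near[OF t(1) \<delta>(1)] by metis
      then have "H \<alpha> z \<in> W" using \<delta>(2)[of z] \<epsilon>(2) H_in[OF \<alpha>(1) z(1)] by (auto simp: dist_commute)
      then show False using H_in[OF \<alpha>(1) z(1)] W(2) \<alpha>(2) by blast
    qed
    ultimately show "closedin (top_of_set S) T \<and> top_of_set S interior_of T = {}"
      using interior_of_subset openin_interior_of by metis
  qed
  then have "\<not> U \<subseteq> Im_paths \<A>"
    using U interior_of_maximal by (metis Im_paths_def subset_empty)
  then show ?thesis using openin_imp_subset[OF U(1)] by blast
qed

lemma exterior_point_in_X:
  assumes "\<alpha> \<in> \<A>" "t \<in> circle" "\<epsilon> > 0"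
  obtains z where "z \<in> exterior" "dist z t < \<epsilon>" "H \<alpha> z \<in> X"
proof -
  have "ball t \<epsilon> \<inter> exterior \<noteq> {}" using exterior_near[OF assms(2,3)]
    by (metis IntI dist_commute empty_iff mem_ball)
  then obtain x where "x \<in> H \<alpha> ` (ball t \<epsilon> \<inter> exterior)" "x \<in> X"
    using X_dense[OF H_open[OF assms(1), of "ball t \<epsilon>"]] by blast
  then show thesis using that by (auto simp: dist_commute)
qed

text \<open>Points of \<open>X\<close> in slit coordinates close to \<open>t\<close> are close to the \<open>\<alpha>\<close>-arc while their images are
  close to the \<open>\<beta>\<close>-arc. This transfers information between an arc and its reglued counterpart.\<close>

lemma approximate_alpha_and_beta:
  assumes "\<alpha> \<in> \<A>" "t \<in> circle" "\<epsilon> > 0" "\<epsilon>' > 0"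
  obtains x where "x \<in> X" "dist x (\<alpha> t) < \<epsilon>" "dist (\<Phi> x) (c \<alpha> t) < \<epsilon>'"
proof -
  obtain \<delta>1 where 1: "\<delta>1 > 0" "\<And>z. 1 \<le> norm z \<Longrightarrow> dist z t < \<delta>1 \<Longrightarrow> dist (H \<alpha> z) (\<alpha> t) < \<epsilon>"
    using H_limit[OF assms(1,2,3)] by metis
  obtain \<delta>2 where 2: "\<delta>2 > 0" "\<forall>z \<in> exterior \<inter> ball t \<delta>2. H \<alpha> z \<notin> Im_paths \<A> \<longrightarrow> dist (\<Phi> (H \<alpha> z)) (c \<alpha> t) < \<epsilon>'"
    using \<Phi>_boundary[OF assms(1,2,4)] by blast
  obtain z where z: "z \<in> exterior" "dist z t < min \<delta>1 \<delta>2" "H \<alpha> z \<in> X"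
    using exterior_point_in_X[OF assms(1,2), of "min \<delta>1 \<delta>2"] 1(1) 2(1) by (metis min_less_iff_conj)
  show thesis
    by (rule that[of "H \<alpha> z"]) (use z 1(2)[of z] 2(2) in \<open>auto simp: dist_commute\<close>)
qed

lemma Y_dense:
  assumes "y \<in> S" "\<epsilon> > 0"
  obtains x where "x \<in> X" "dist (\<Phi> x) y < \<epsilon>"
  using assms(1)
proof (cases rule: S_cases_target)
  case (1 x) then show ?thesis using that assms(2) by simp
next
  case (2 \<alpha> t)
  then show ?thesis using approximate_alpha_and_beta[OF 2(1,2) zero_less_one assms(2)] that by metis
qed

section \<open>Inverting the regluing up to the arcs\<close>

lemma beta_near:
  assumes "\<alpha> \<in> \<A>" "t0 \<in> circle" "\<epsilon> > 0"
  obtains \<delta> where "\<delta> > 0"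
    "\<And>t. t \<in> circle \<Longrightarrow> dist (c \<alpha> t) (c \<alpha> t0) < \<delta> \<Longrightarrow> dist t t0 < \<epsilon> \<or> dist t (flip t0) < \<epsilon>"
proof -
  obtain \<delta> where \<delta>: "\<delta> > 0" "\<And>t. t \<in> circle \<Longrightarrow> dist (c \<alpha> t) (c \<alpha> t0) < \<delta> \<Longrightarrow>
      \<exists>s\<in>circle. c \<alpha> s = c \<alpha> t0 \<and> dist t s < \<epsilon>"
    using compact_near_fiber[OF compact_sphere beta_cont[OF assms(1)] assms(3)] by metis
  show thesis
    by (rule that[OF \<delta>(1)]) (use \<delta>(2) beta_eq_iff[OF assms(1,2)] in metis)
qed

lemma alpha_near:
  assumes "\<alpha> \<in> \<A>" "t0 \<in> circle" "\<epsilon> > 0"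
  obtains \<delta> where "\<delta> > 0"
    "\<And>t. t \<in> circle \<Longrightarrow> dist (\<alpha> t) (\<alpha> t0) < \<delta> \<Longrightarrow> dist t t0 < \<epsilon> \<or> dist t (cnj t0) < \<epsilon>"
proof -
  obtain \<delta> where \<delta>: "\<delta> > 0" "\<And>t. t \<in> circle \<Longrightarrow> dist (\<alpha> t) (\<alpha> t0) < \<delta> \<Longrightarrow>
      \<exists>s\<in>circle. \<alpha> s = \<alpha> t0 \<and> dist t s < \<epsilon>"
    using compact_near_fiber[OF compact_sphere alpha_cont[OF assms(1)] assms(3)] by metis
  show thesis
    by (rule that[OF \<delta>(1)]) (use \<delta>(2) alpha_eq_iff[OF assms(1,2)] in metis)
qed

lemma slit_side:
  assumes \<alpha>: "\<alpha> \<in> \<A>" and C: "connected C" "C \<subseteq> H \<alpha> ` (exterior \<inter> (U \<union> V))"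
    and UV: "open U" "open V" "U \<inter> V = {}"
  shows "C \<subseteq> H \<alpha> ` (exterior \<inter> U) \<or> C \<subseteq> H \<alpha> ` (exterior \<inter> V)"
proof (rule connected_subset_of_two_open[OF C(1)])
  show "C \<subseteq> H \<alpha> ` (exterior \<inter> U) \<union> H \<alpha> ` (exterior \<inter> V)" using C(2) by blast
  show "openin (top_of_set S) (H \<alpha> ` (exterior \<inter> U))" "openin (top_of_set S) (H \<alpha> ` (exterior \<inter> V))"
    using H_open[OF \<alpha>] UV by (simp_all add: Int_commute)
  show "H \<alpha> ` (exterior \<inter> U) \<inter> H \<alpha> ` (exterior \<inter> V) = {}"
    using H_inj[OF \<alpha>] UV(3) by blast
qed

text \<open>Compactness of the sphere: to control \<open>\<Phi>\<inverse>\<close> near \<open>y\<close>, it suffices that every point of the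
  sphere has a neighbourhood whose part outside \<open>P\<close> is mapped away from \<open>y\<close>.\<close>

lemma uniform_escape:
  assumes "\<And>x1. x1 \<in> S \<Longrightarrow> \<exists>r>0. \<exists>\<eta>>0. \<forall>x\<in>X. dist x x1 < r \<longrightarrow> P x \<or> \<eta> \<le> dist (\<Phi> x) y"
  obtains \<delta> where "\<delta> > 0" "\<And>x. x \<in> X \<Longrightarrow> dist (\<Phi> x) y < \<delta> \<Longrightarrow> P x"
proof -
  obtain r \<eta> where r: "\<And>x1. x1 \<in> S \<Longrightarrow> r x1 > 0 \<and> \<eta> x1 > 0 \<and>
      (\<forall>x\<in>X. dist x x1 < r x1 \<longrightarrow> P x \<or> \<eta> x1 \<le> dist (\<Phi> x) y)"
    using assms by metis
  have cover: "S \<subseteq> (\<Union>x\<in>S. ball x (r x))" using r by auto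
  have opn: "\<And>x. x \<in> S \<Longrightarrow> open (ball x (r x))" by simp
  obtain Q where Q: "Q \<subseteq> S" "finite Q" "S \<subseteq> (\<Union>x\<in>Q. ball x (r x))"
    by (rule compactE_image[OF compact_S opn cover])
  define \<delta> where "\<delta> = Min (insert 1 (\<eta> ` Q))"
  have \<delta>Q: "\<delta> \<le> \<eta> q" if "q \<in> Q" for q using Q(2) that by (simp add: \<delta>_def)
  have "\<delta> > 0" using Q r by (auto simp: \<delta>_def)
  moreover have "P x" if x: "x \<in> X" "dist (\<Phi> x) y < \<delta>" for x
  proof -
    obtain q where q: "q \<in> Q" "dist q x < r q" using Q(3) x(1) by auto
    then have "P x \<or> \<eta> q \<le> dist (\<Phi> x) y" using r Q(1) x(1) by (metis dist_commute subsetD)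
    then show ?thesis using \<delta>Q[OF q(1)] x(2) by linarith
  qed
  ultimately show thesis using that by blast
qed

text \<open>At a point of an arc the condition of \<open>uniform_escape\<close> is checked on its two sides separately.\<close>

lemma escape_at_arc:
  assumes \<alpha>: "\<alpha> \<in> \<A>" "t \<in> circle"
    and s: "\<And>s. s \<in> {t, cnj t} \<Longrightarrow> \<exists>r>0. \<exists>\<eta>>0. \<forall>z \<in> exterior \<inter> ball s r. H \<alpha> z \<in> X \<longrightarrow>
        P (H \<alpha> z) \<or> \<eta> \<le> dist (\<Phi> (H \<alpha> z)) y"
  shows "\<exists>r>0. \<exists>\<eta>>0. \<forall>x\<in>X. dist x (\<alpha> t) < r \<longrightarrow> P x \<or> \<eta> \<le> dist (\<Phi> x) y"
proof -
  obtain r1 \<eta>1 where 1: "r1 > 0" "\<eta>1 > 0" "\<forall>z \<in> exterior \<inter> ball t r1. H \<alpha> z \<in> X \<longrightarrow>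
      P (H \<alpha> z) \<or> \<eta>1 \<le> dist (\<Phi> (H \<alpha> z)) y" using s[of t] by blast
  obtain r2 \<eta>2 where 2: "r2 > 0" "\<eta>2 > 0" "\<forall>z \<in> exterior \<inter> ball (cnj t) r2. H \<alpha> z \<in> X \<longrightarrow>
      P (H \<alpha> z) \<or> \<eta>2 \<le> dist (\<Phi> (H \<alpha> z)) y" using s[of "cnj t"] by blast
  obtain \<delta> where \<delta>: "\<delta> > 0" "\<And>x. x \<in> S - \<alpha> ` circle \<Longrightarrow> dist x (\<alpha> t) < \<delta> \<Longrightarrow>
       \<exists>z \<in> exterior \<inter> (ball t (min r1 r2) \<union> ball (cnj t) (min r1 r2)). x = H \<alpha> z"
    using H_near[OF \<alpha>, of "min r1 r2"] 1 2 by (metis min_less_iff_conj)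
  have "P x \<or> min \<eta>1 \<eta>2 \<le> dist (\<Phi> x) y" if x: "x \<in> X" "dist x (\<alpha> t) < \<delta>" for x
  proof -
    have "x \<in> S - \<alpha> ` circle" using x(1) \<alpha>(1) by (auto simp: Im_paths_def)
    then obtain z where z: "z \<in> exterior" "z \<in> ball t (min r1 r2) \<union> ball (cnj t) (min r1 r2)" "x = H \<alpha> z"
      using \<delta>(2) x(2) by blast
    from z(2) have "z \<in> ball t r1 \<or> z \<in> ball (cnj t) r2" by auto
    then have "P x \<or> \<eta>1 \<le> dist (\<Phi> x) y \<or> \<eta>2 \<le> dist (\<Phi> x) y" using 1(3) 2(3) z(1,3) x(1) by blast
    then show ?thesis by linarith
  qed
  then show ?thesis using \<delta>(1) 1(2) 2(2) by (intro exI[of _ \<delta>] conjI exI[of _ "min \<eta>1 \<eta>2"]) auto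
qed

lemma boundary_avoids:
  assumes \<alpha>: "\<alpha> \<in> \<A>" "s \<in> circle" and ne: "c \<alpha> s \<noteq> y"
  shows "\<exists>r>0. \<exists>\<eta>>0. \<forall>z \<in> exterior \<inter> ball s r. H \<alpha> z \<in> X \<longrightarrow> P (H \<alpha> z) \<or> \<eta> \<le> dist (\<Phi> (H \<alpha> z)) y"
proof -
  let ?d = "dist (c \<alpha> s) y"
  have d: "?d / 2 > 0" using ne by simp
  obtain r where r: "r > 0" "\<forall>z \<in> exterior \<inter> ball s r. H \<alpha> z \<notin> Im_paths \<A> \<longrightarrow> dist (\<Phi> (H \<alpha> z)) (c \<alpha> s) < ?d / 2"
    using \<Phi>_boundary[OF \<alpha> d] by blast
  have "?d / 2 \<le> dist (\<Phi> (H \<alpha> z)) y" if "z \<in> exterior \<inter> ball s r" "H \<alpha> z \<in> X" for z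
    using r(2) that dist_triangle2[of "c \<alpha> s" y "\<Phi> (H \<alpha> z)"] by (fastforce simp: dist_commute)
  then show ?thesis using r(1) d by blast
qed

lemma escape_regular:
  assumes "x1 \<in> X" "\<Phi> x1 \<noteq> y"
  shows "\<exists>r>0. \<exists>\<eta>>0. \<forall>x\<in>X. dist x x1 < r \<longrightarrow> P x \<or> \<eta> \<le> dist (\<Phi> x) y"
proof -
  let ?d = "dist (\<Phi> x1) y"
  have d: "?d / 2 > 0" using assms by simp
  obtain r where r: "r > 0" "\<forall>x\<in>X. dist x x1 < r \<longrightarrow> dist (\<Phi> x) (\<Phi> x1) < ?d / 2"
    using \<Phi>_cont assms(1) d unfolding continuous_on_iff by blast
  have "?d / 2 \<le> dist (\<Phi> x) y" if "x \<in> X" "dist x x1 < r" for x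
    using r(2) that dist_triangle2[of "\<Phi> x1" y "\<Phi> x"] by (fastforce simp: dist_commute)
  then show ?thesis using r(1) d by blast
qed

lemma \<Phi>_inverse_limit_regular:
  assumes x0: "x0 \<in> X" and \<epsilon>: "\<epsilon> > 0"
  obtains \<delta> where "\<delta> > 0" "\<And>x. x \<in> X \<Longrightarrow> dist (\<Phi> x) (\<Phi> x0) < \<delta> \<Longrightarrow> dist x x0 < \<epsilon>"
proof (rule uniform_escape[of "\<lambda>x. dist x x0 < \<epsilon>" "\<Phi> x0"])
  fix x1 assume "x1 \<in> S"
  then show "\<exists>r>0. \<exists>\<eta>>0. \<forall>x\<in>X. dist x x1 < r \<longrightarrow> dist x x0 < \<epsilon> \<or> \<eta> \<le> dist (\<Phi> x) (\<Phi> x0)"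
  proof (cases rule: S_cases_source)
    case 1
    show ?thesis
    proof (cases "x1 = x0")
      case True then show ?thesis using \<epsilon> by (intro exI[of _ \<epsilon>] conjI exI[of _ 1]) auto
    next
      case False
      then have "\<Phi> x1 \<noteq> \<Phi> x0" using \<Phi>_inj 1 x0 by blast
      then show ?thesis by (rule escape_regular[OF 1])
    qed
  next
    case (2 \<alpha> t)
    have "c \<alpha> s \<noteq> \<Phi> x0" if "s \<in> circle" for s
      using beta_notin_Y[OF 2(1) that] \<Phi>_in_Y[OF x0] by metis
    then show ?thesis unfolding 2(3) using 2
      by (intro escape_at_arc boundary_avoids) auto
  qed
qed (rule that, assumption, blast)

lemma \<Phi>_inverse_limit_arc:
  assumes \<alpha>0: "\<alpha>0 \<in> \<A>" and t0: "t0 \<in> circle" and \<epsilon>: "\<epsilon> > 0"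
  obtains \<delta> where "\<delta> > 0" "\<And>x. x \<in> X \<Longrightarrow> dist (\<Phi> x) (c \<alpha>0 t0) < \<delta> \<Longrightarrow>
     x \<in> H \<alpha>0 ` (exterior \<inter> (ball t0 \<epsilon> \<union> ball (flip t0) \<epsilon>))"
proof (rule uniform_escape[of "\<lambda>x. x \<in> H \<alpha>0 ` (exterior \<inter> (ball t0 \<epsilon> \<union> ball (flip t0) \<epsilon>))" "c \<alpha>0 t0"])
  let ?P = "\<lambda>x. x \<in> H \<alpha>0 ` (exterior \<inter> (ball t0 \<epsilon> \<union> ball (flip t0) \<epsilon>))"
  fix x1 assume "x1 \<in> S"
  then show "\<exists>r>0. \<exists>\<eta>>0. \<forall>x\<in>X. dist x x1 < r \<longrightarrow> ?P x \<or> \<eta> \<le> dist (\<Phi> x) (c \<alpha>0 t0)"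
  proof (cases rule: S_cases_source)
    case 1
    then have "\<Phi> x1 \<noteq> c \<alpha>0 t0" using beta_notin_Y[OF \<alpha>0 t0] \<Phi>_in_Y[OF 1] by metis
    then show ?thesis by (rule escape_regular[OF 1])
  next
    case (2 \<alpha> t)
    show ?thesis unfolding 2(3)
    proof (rule escape_at_arc[OF 2(1,2)])
      fix s assume "s \<in> {t, cnj t}"
      then have s: "s \<in> circle" using 2(2) by auto
      show "\<exists>r>0. \<exists>\<eta>>0. \<forall>z \<in> exterior \<inter> ball s r. H \<alpha> z \<in> X \<longrightarrow>
          ?P (H \<alpha> z) \<or> \<eta> \<le> dist (\<Phi> (H \<alpha> z)) (c \<alpha>0 t0)"
      proof (cases "c \<alpha> s = c \<alpha>0 t0")
        case True
        then have "\<alpha> = \<alpha>0" using beta_disjoint 2(1) \<alpha>0 s t0 by blast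
        moreover then have "s = t0 \<or> s = flip t0" using True beta_eq_iff[OF \<alpha>0 t0 s] by metis
        ultimately show ?thesis using \<epsilon> by (intro exI[of _ \<epsilon>] conjI exI[of _ 1]) auto
      next
        case False
        then show ?thesis by (rule boundary_avoids[OF 2(1) s])
      qed
    qed
  qed
qed (rule that, assumption, blast)

lemma nearby_arcs_small:
  assumes y: "y \<in> S" and \<epsilon>: "\<epsilon> > 0"
  obtains \<delta> where "\<delta> > 0" "\<And>\<alpha> t. \<alpha> \<in> \<A> \<Longrightarrow> t \<in> circle \<Longrightarrow> dist (c \<alpha> t) y < \<delta> \<Longrightarrow>
     y \<notin> c \<alpha> ` circle \<Longrightarrow> diameter (\<alpha> ` circle) \<le> \<epsilon>"
proof -
  define Q where "Q = {\<alpha> \<in> \<A>. diameter (\<alpha> ` circle) > \<epsilon> \<and> y \<notin> c \<alpha> ` circle}"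
  have "finite {\<alpha> \<in> \<A>. diameter (\<alpha> ` circle) > \<epsilon>}"
    using \<A>_stable \<epsilon> by (simp add: strongly_f_stable_def contracted_def)
  then have "finite Q" by (rule finite_subset[rotated]) (auto simp: Q_def)
  moreover have "closed (c \<alpha> ` circle)" if "\<alpha> \<in> Q" for \<alpha>
    using that by (intro compact_imp_closed beta_compact) (simp add: Q_def)
  ultimately have "closed (\<Union>\<alpha>\<in>Q. c \<alpha> ` circle)" by (intro closed_UN) auto
  moreover have "y \<notin> (\<Union>\<alpha>\<in>Q. c \<alpha> ` circle)" by (auto simp: Q_def)
  ultimately obtain \<delta> where \<delta>: "\<delta> > 0" "ball y \<delta> \<subseteq> - (\<Union>\<alpha>\<in>Q. c \<alpha> ` circle)"
    by (metis ComplI open_Compl open_contains_ball)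
  show thesis
  proof (rule that[OF \<delta>(1)], rule ccontr)
    fix \<alpha> t assume *: "\<alpha> \<in> \<A>" "t \<in> circle" "dist (c \<alpha> t) y < \<delta>" "y \<notin> c \<alpha> ` circle"
      "\<not> diameter (\<alpha> ` circle) \<le> \<epsilon>"
    then have "\<alpha> \<in> Q" by (auto simp: Q_def)
    moreover have "c \<alpha> t \<in> ball y \<delta>" using *(3) by (simp add: dist_commute)
    ultimately show False using \<delta>(2) *(2) by blast
  qed
qed

lemma alpha_dist_le_diameter:
  assumes "\<alpha> \<in> \<A>" "s \<in> circle" "t \<in> circle"
  shows "dist (\<alpha> s) (\<alpha> t) \<le> diameter (\<alpha> ` circle)"
  using diameter_bounded_bound[OF compact_imp_bounded[OF alpha_compact]] assms by blast

text \<open>A small arc \<open>\<alpha>\<close> with \<open>c \<alpha> t\<close> near \<open>\<Phi> x0\<close> is close to \<open>x0\<close>, because a point of \<open>X\<close> approximating both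
  \<open>\<alpha> t\<close> and \<open>c \<alpha> t\<close> is. The finitely many large arcs stay away from \<open>\<Phi> x0\<close> on the target side.\<close>

lemma arcs_near_regular:
  assumes x0: "x0 \<in> X" and \<epsilon>: "\<epsilon> > 0"
  obtains \<delta> where "\<delta> > 0" "\<And>\<alpha> t. \<alpha> \<in> \<A> \<Longrightarrow> t \<in> circle \<Longrightarrow> dist (c \<alpha> t) (\<Phi> x0) < \<delta> \<Longrightarrow>
     \<alpha> ` circle \<subseteq> ball x0 \<epsilon>"
proof -
  have "\<epsilon> / 3 > 0" using \<epsilon> by simp
  obtain \<delta>1 where 1: "\<delta>1 > 0" "\<And>x. x \<in> X \<Longrightarrow> dist (\<Phi> x) (\<Phi> x0) < \<delta>1 \<Longrightarrow> dist x x0 < \<epsilon> / 3"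
    using \<Phi>_inverse_limit_regular[OF x0 \<open>\<epsilon> / 3 > 0\<close>] by metis
  have "\<Phi> x0 \<in> S" using \<Phi>_in_Y[OF x0] by blast
  obtain \<delta>2 where 2: "\<delta>2 > 0" "\<And>\<alpha> t. \<alpha> \<in> \<A> \<Longrightarrow> t \<in> circle \<Longrightarrow> dist (c \<alpha> t) (\<Phi> x0) < \<delta>2 \<Longrightarrow>
     \<Phi> x0 \<notin> c \<alpha> ` circle \<Longrightarrow> diameter (\<alpha> ` circle) \<le> \<epsilon> / 3"
    using nearby_arcs_small[OF \<open>\<Phi> x0 \<in> S\<close> \<open>\<epsilon> / 3 > 0\<close>] by metis
  show thesis
  proof (rule that[of "min (\<delta>1 / 2) \<delta>2"])
    show "0 < min (\<delta>1 / 2) \<delta>2" using 1 2 by simp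
    fix \<alpha> t assume \<alpha>: "\<alpha> \<in> \<A>" "t \<in> circle" "dist (c \<alpha> t) (\<Phi> x0) < min (\<delta>1 / 2) \<delta>2"
    have "\<Phi> x0 \<notin> c \<alpha> ` circle" using \<Phi>_in_Y[OF x0] beta_notin_Y[OF \<alpha>(1)] by (metis imageE)
    then have diam: "diameter (\<alpha> ` circle) \<le> \<epsilon> / 3" using 2(2)[OF \<alpha>(1,2)] \<alpha>(3) by simp
    obtain x where x: "x \<in> X" "dist x (\<alpha> t) < \<epsilon> / 3" "dist (\<Phi> x) (c \<alpha> t) < \<delta>1 / 2"
      using approximate_alpha_and_beta[OF \<alpha>(1,2) \<open>\<epsilon> / 3 > 0\<close>, of "\<delta>1 / 2"] 1(1) by auto
    have "dist (\<Phi> x) (\<Phi> x0) < \<delta>1"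
      using x(3) \<alpha>(3) dist_triangle[of "\<Phi> x" "\<Phi> x0" "c \<alpha> t"] by simp
    then have "dist x x0 < \<epsilon> / 3" using 1(2) x(1) by blast
    then have "dist (\<alpha> s) x0 < \<epsilon>" if "s \<in> circle" for s
      using alpha_dist_le_diameter[OF \<alpha>(1) that \<alpha>(2)] diam x(2) dist_triangle[of "\<alpha> s" x0 "\<alpha> t"]
        dist_triangle2[of "\<alpha> t" x0 x] by (simp add: dist_commute)
    then show "\<alpha> ` circle \<subseteq> ball x0 \<epsilon>" by (auto simp: dist_commute)
  qed
qed

text \<open>An approximating point of \<open>X\<close> shows that a small arc \<open>\<alpha>\<close> with \<open>c \<alpha> t\<close> near \<open>c \<alpha>0 t0\<close> is close to
  \<open>\<alpha>0 t0\<close> or \<open>\<alpha>0 (flip t0)\<close> and has a point near it on the correct side of \<open>\<alpha>0\<close>. Being connected and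
  disjoint from \<open>\<alpha>0\<close>, the whole arc lies on that side.\<close>

lemma arcs_near_arc:
  assumes \<alpha>0: "\<alpha>0 \<in> \<A>" and t0: "t0 \<in> circle" and \<epsilon>: "\<epsilon> > 0"
  obtains \<delta> where "\<delta> > 0" "\<And>\<alpha> t. \<alpha> \<in> \<A> \<Longrightarrow> \<alpha> \<noteq> \<alpha>0 \<Longrightarrow> t \<in> circle \<Longrightarrow> dist (c \<alpha> t) (c \<alpha>0 t0) < \<delta> \<Longrightarrow>
     \<alpha> ` circle \<subseteq> H \<alpha>0 ` (exterior \<inter> (ball t0 \<epsilon> \<union> ball (flip t0) \<epsilon>))"
proof -
  \<comment> \<open>at a tip the two sides are not separated; elsewhere \<open>\<bar>Im t0\<bar>\<close> keeps the disks in their half planes\<close>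
  define \<epsilon>1 where "\<epsilon>1 = (if Im t0 = 0 then \<epsilon> else min \<epsilon> \<bar>Im t0\<bar>)"
  have \<epsilon>1: "\<epsilon>1 > 0" "\<epsilon>1 \<le> \<epsilon>" using \<epsilon> by (auto simp: \<epsilon>1_def)
  define U where "U = ball t0 \<epsilon>1 \<union> ball (flip t0) \<epsilon>1"
  define V where "V = ball (cnj t0) \<epsilon>1 \<union> ball (- t0) \<epsilon>1"
  have opn: "open U" "open V" by (auto simp: U_def V_def)
  have flip_t0: "flip t0 \<in> circle" using t0 by simp
  have sides: "U = V \<or> U \<inter> V = {}"
  proof (cases "Im t0 = 0")
    case True
    then have "cnj t0 = t0" by (simp add: complex_eq_iff)
    then show ?thesis by (simp add: U_def V_def)
  next
    case False
    have pos: "0 < Im t0 * Im z" if "z \<in> U" for z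
    proof -
      have "\<bar>Im z - Im t0\<bar> < \<bar>Im t0\<bar>"
        using that abs_Im_le_cmod[of "t0 - z"] abs_Im_le_cmod[of "flip t0 - z"] False
        by (auto simp: U_def \<epsilon>1_def dist_norm abs_minus_commute)
      then show ?thesis by (cases "Im t0 > 0") (auto simp: zero_less_mult_iff)
    qed
    have neg: "Im t0 * Im z < 0" if "z \<in> V" for z
    proof -
      have "\<bar>Im z + Im t0\<bar> < \<bar>Im t0\<bar>"
        using that abs_Im_le_cmod[of "cnj t0 - z"] abs_Im_le_cmod[of "- t0 - z"] False
        by (auto simp: V_def \<epsilon>1_def dist_norm abs_if split: if_splits)
      then show ?thesis by (cases "Im t0 > 0") (auto simp: mult_less_0_iff)
    qed
    show ?thesis using pos neg by fastforce
  qed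
  have cnj_flip: "cnj (flip t0) = - t0" by simp
  obtain \<delta>1 where 1: "\<delta>1 > 0" "\<And>x. x \<in> S - \<alpha>0 ` circle \<Longrightarrow> dist x (\<alpha>0 t0) < \<delta>1 \<Longrightarrow>
       \<exists>z \<in> exterior \<inter> (ball t0 \<epsilon>1 \<union> ball (cnj t0) \<epsilon>1). x = H \<alpha>0 z"
    using H_near[OF \<alpha>0 t0 \<epsilon>1(1)] by metis
  obtain \<delta>1' where 11: "\<delta>1' > 0" "\<And>x. x \<in> S - \<alpha>0 ` circle \<Longrightarrow> dist x (\<alpha>0 (flip t0)) < \<delta>1' \<Longrightarrow>
       \<exists>z \<in> exterior \<inter> (ball (flip t0) \<epsilon>1 \<union> ball (- t0) \<epsilon>1). x = H \<alpha>0 z"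
    using H_near[OF \<alpha>0 flip_t0 \<epsilon>1(1), unfolded cnj_flip] by metis
  define \<eta> where "\<eta> = min \<delta>1 \<delta>1'"
  have \<eta>: "\<eta> / 3 > 0" using 1 11 by (simp add: \<eta>_def)
  have UV: "x \<in> H \<alpha>0 ` (exterior \<inter> (U \<union> V))"
    if "x \<in> S - \<alpha>0 ` circle" "s \<in> {t0, flip t0}" "dist x (\<alpha>0 s) < \<eta>" for x s
    using that 1(2)[of x] 11(2)[of x] unfolding U_def V_def \<eta>_def by fastforce
  obtain r1 where r1: "r1 > 0" "\<And>z. 1 \<le> norm z \<Longrightarrow> dist z t0 < r1 \<Longrightarrow> dist (H \<alpha>0 z) (\<alpha>0 t0) < \<eta> / 3"
    using H_limit[OF \<alpha>0 t0 \<eta>] by metis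
  obtain r2 where r2: "r2 > 0" "\<And>z. 1 \<le> norm z \<Longrightarrow> dist z (flip t0) < r2 \<Longrightarrow> dist (H \<alpha>0 z) (\<alpha>0 (flip t0)) < \<eta> / 3"
    using H_limit[OF \<alpha>0 flip_t0 \<eta>] by metis
  define \<epsilon>2 where "\<epsilon>2 = Min {\<epsilon>1, r1, r2}"
  have \<epsilon>2: "\<epsilon>2 > 0" "\<epsilon>2 \<le> \<epsilon>1" "\<epsilon>2 \<le> r1" "\<epsilon>2 \<le> r2" using \<epsilon>1 r1 r2 by (auto simp: \<epsilon>2_def)
  obtain \<delta>2 where 2: "\<delta>2 > 0" "\<And>x. x \<in> X \<Longrightarrow> dist (\<Phi> x) (c \<alpha>0 t0) < \<delta>2 \<Longrightarrow>
     x \<in> H \<alpha>0 ` (exterior \<inter> (ball t0 \<epsilon>2 \<union> ball (flip t0) \<epsilon>2))"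
    using \<Phi>_inverse_limit_arc[OF \<alpha>0 t0 \<epsilon>2(1)] by metis
  obtain \<delta>3 where 3: "\<delta>3 > 0" "\<And>\<alpha> t. \<alpha> \<in> \<A> \<Longrightarrow> t \<in> circle \<Longrightarrow> dist (c \<alpha> t) (c \<alpha>0 t0) < \<delta>3 \<Longrightarrow>
     c \<alpha>0 t0 \<notin> c \<alpha> ` circle \<Longrightarrow> diameter (\<alpha> ` circle) \<le> \<eta> / 3"
    using nearby_arcs_small[OF beta_in_S[OF \<alpha>0 t0] \<eta>] by metis
  show thesis
  proof (rule that[of "min (\<delta>2 / 2) \<delta>3"])
    show "0 < min (\<delta>2 / 2) \<delta>3" using 2 3 by simp
    fix \<alpha> t assume \<alpha>: "\<alpha> \<in> \<A>" "\<alpha> \<noteq> \<alpha>0" "t \<in> circle" "dist (c \<alpha> t) (c \<alpha>0 t0) < min (\<delta>2 / 2) \<delta>3"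
    have "c \<alpha>0 t0 \<notin> c \<alpha> ` circle" using beta_disjoint[OF \<alpha>0 \<alpha>(1) t0] \<alpha>(2) by blast
    then have diam: "diameter (\<alpha> ` circle) \<le> \<eta> / 3" using 3(2)[OF \<alpha>(1,3)] \<alpha>(4) by simp
    have \<alpha>S: "\<alpha> s \<in> S - \<alpha>0 ` circle" if "s \<in> circle" for s
      using alpha_in_S[OF \<alpha>(1) that] alpha_disjoint[OF \<alpha>(1) \<alpha>0 that] \<alpha>(2) by blast
    have "openin (top_of_set S) (H \<alpha>0 ` (V \<inter> exterior))" using H_open[OF \<alpha>0 opn(2)] .
    then obtain \<eta>' where \<eta>': "\<eta>' > 0"
      "\<alpha> t \<in> H \<alpha>0 ` (V \<inter> exterior) \<Longrightarrow> ball (\<alpha> t) \<eta>' \<inter> S \<subseteq> H \<alpha>0 ` (V \<inter> exterior)"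
      using openin_contains_ball by (metis zero_less_one)
    obtain x where x: "x \<in> X" "dist x (\<alpha> t) < min (\<eta> / 3) \<eta>'" "dist (\<Phi> x) (c \<alpha> t) < \<delta>2 / 2"
      using approximate_alpha_and_beta[OF \<alpha>(1,3), of "min (\<eta> / 3) \<eta>'" "\<delta>2 / 2"] 2(1) \<eta>'(1) \<eta> by auto
    have "dist (\<Phi> x) (c \<alpha>0 t0) < \<delta>2"
      using x(3) \<alpha>(4) dist_triangle[of "\<Phi> x" "c \<alpha>0 t0" "c \<alpha> t"] by simp
    then obtain z where z: "x = H \<alpha>0 z" "z \<in> exterior" "z \<in> ball t0 \<epsilon>2 \<union> ball (flip t0) \<epsilon>2"
      using 2(2) x(1) by blast
    then have zU: "z \<in> U" using \<epsilon>2 by (auto simp: U_def)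
    obtain s0 where s0: "s0 \<in> {t0, flip t0}" "dist x (\<alpha>0 s0) < \<eta> / 3"
    proof -
      have "1 \<le> norm z" using z(2) by simp
      moreover have "dist z t0 < r1 \<or> dist z (flip t0) < r2" using z(3) \<epsilon>2 by (auto simp: dist_commute)
      ultimately show thesis using r1(2) r2(2) z(1) that by blast
    qed
    have "\<alpha> s \<in> H \<alpha>0 ` (exterior \<inter> (U \<union> V))" if "s \<in> circle" for s
    proof (rule UV[OF \<alpha>S[OF that] s0(1)])
      show "dist (\<alpha> s) (\<alpha>0 s0) < \<eta>"
        using alpha_dist_le_diameter[OF \<alpha>(1) that \<alpha>(3)] diam x(2) s0(2)
          dist_triangle[of "\<alpha> s" "\<alpha>0 s0" "\<alpha> t"] dist_triangle2[of "\<alpha> t" "\<alpha>0 s0" x]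
        by (simp add: dist_commute)
    qed
    then have sub: "\<alpha> ` circle \<subseteq> H \<alpha>0 ` (exterior \<inter> (U \<union> V))" by blast
    have conn: "connected (\<alpha> ` circle)"
      by (intro connected_continuous_image alpha_cont \<alpha>(1) connected_sphere) simp
    have "\<alpha> ` circle \<subseteq> H \<alpha>0 ` (exterior \<inter> U)"
      using sides
    proof
      assume "U \<inter> V = {}"
      moreover have False if "\<alpha> ` circle \<subseteq> H \<alpha>0 ` (exterior \<inter> V)"
      proof -
        have "\<alpha> t \<in> H \<alpha>0 ` (V \<inter> exterior)" using that \<alpha>(3) by blast
        moreover have "x \<in> ball (\<alpha> t) \<eta>' \<inter> S" using x by (simp add: dist_commute)
        ultimately obtain z' where "z' \<in> V" "z' \<in> exterior" "x = H \<alpha>0 z'" using \<eta>'(2) by blast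
        then show False using z(1,2) zU H_inj[OF \<alpha>0] \<open>U \<inter> V = {}\<close> by blast
      qed
      ultimately show ?thesis using slit_side[OF \<alpha>0 conn sub opn] by blast
    qed (use sub in simp)
    moreover have "U \<subseteq> ball t0 \<epsilon> \<union> ball (flip t0) \<epsilon>" using \<epsilon>1 by (auto simp: U_def)
    ultimately show "\<alpha> ` circle \<subseteq> H \<alpha>0 ` (exterior \<inter> (ball t0 \<epsilon> \<union> ball (flip t0) \<epsilon>))" by blast
  qed
qed

section \<open>Folded and unfolded arcs\<close>

abbreviation "critical x \<equiv> critical_point S f x"

lemma local_degree_exists: "x \<in> S \<Longrightarrow> \<exists>k. has_local_degree S f x k"
  using f_ramified by (simp add: ramified_covering_def)

lemma regular_chart:
  assumes "x \<in> S" "\<not> critical x"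
  obtains U V g where "openin (top_of_set S) U" "x \<in> U" "openin (top_of_set S) V" "homeomorphism U V f g"
proof -
  obtain k where k: "has_local_degree S f x k" using local_degree_exists assms(1) by blast
  then have "k = 1" using assms unfolding critical_point_def has_local_degree_def
    by (metis One_nat_def Suc_lessI)
  then obtain U V \<phi> \<phi>' \<psi> \<psi>' where *: "openin (top_of_set S) U" "x \<in> U" "openin (top_of_set S) V"
      "f ` U \<subseteq> V" "homeomorphism U (ball (0::complex) 1) \<phi> \<phi>'" "homeomorphism V (ball (0::complex) 1) \<psi> \<psi>'"
      and eq: "\<forall>z \<in> ball 0 1. \<psi> (f (\<phi>' z)) = z ^ k"
    using k unfolding has_local_degree_def by blast
  have hom: "homeomorphism U V (\<psi>' \<circ> \<phi>) (\<phi>' \<circ> \<psi>)"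
    by (rule homeomorphism_compose[OF *(5) homeomorphism_symD[OF *(6)]])
  have "f u = (\<psi>' \<circ> \<phi>) u" if u: "u \<in> U" for u
  proof -
    have "\<phi> u \<in> ball 0 1" "\<phi>' (\<phi> u) = u" using *(5) u by (auto simp: homeomorphism_def)
    then have "\<psi> (f u) = \<phi> u" using eq \<open>k = 1\<close> by (metis power_one_right)
    then show ?thesis using *(4,6) u by (metis comp_apply homeomorphism_apply1 image_subset_iff)
  qed
  then have "homeomorphism U V f (\<phi>' \<circ> \<psi>)"
    by (intro homeomorphism_cong[OF hom]) auto
  then show thesis using that * by blast
qed

lemma regular_locally_injective:
  assumes "x \<in> S" "\<not> critical x"
  shows "locally_injective_at S f x"
proof -
  obtain U V g where U: "openin (top_of_set S) U" "x \<in> U" "homeomorphism U V f g"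
    using regular_chart[OF assms] by metis
  then have "inj_on f U" by (metis homeomorphism_apply1 inj_on_inverseI)
  then show ?thesis unfolding locally_injective_at_def using U by blast
qed

text \<open>Read off from the power map, whose derivative vanishes at most at the centre.\<close>

lemma branch_point_isolated:
  assumes x: "x \<in> S"
  obtains U where "openin (top_of_set S) U" "x \<in> U"
    "\<And>x'. x' \<in> U - {x} \<Longrightarrow> f x' \<noteq> f x \<and> locally_injective_at S f x'"
proof -
  obtain k where "has_local_degree S f x k" using local_degree_exists x by blast
  then obtain U V \<phi> \<phi>' \<psi> \<psi>' where *: "k > 0" "openin (top_of_set S) U" "x \<in> U" "openin (top_of_set S) V"
      "f ` U \<subseteq> V" "homeomorphism U (ball (0::complex) 1) \<phi> \<phi>'" "homeomorphism V (ball (0::complex) 1) \<psi> \<psi>'"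
      "\<phi> x = 0" and eq: "\<forall>z \<in> ball 0 1. \<psi> (f (\<phi>' z)) = z ^ k"
    unfolding has_local_degree_def by blast
  have \<phi>: "\<phi> u \<in> ball 0 1" "\<phi>' (\<phi> u) = u" if "u \<in> U" for u
    using *(6) that by (auto simp: homeomorphism_def)
  have eqU: "\<psi> (f u) = \<phi> u ^ k" if "u \<in> U" for u using eq \<phi>[OF that] by metis
  have \<phi>inj: "u = v" if "u \<in> U" "v \<in> U" "\<phi> u = \<phi> v" for u v using \<phi> that by metis
  show thesis
  proof (rule that[OF *(2,3)])
    fix x' assume x': "x' \<in> U - {x}"
    then have nz: "\<phi> x' \<noteq> 0" using \<phi>inj[of x' x] *(3,8) by auto
    then have "\<psi> (f x') \<noteq> \<psi> (f x)" using eqU x' *(1,3,8) by (simp add: power_0_left)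
    moreover have "locally_injective_at S f x'"
    proof -
      have "((\<lambda>z. z ^ k) has_field_derivative of_nat k * \<phi> x' ^ (k - 1)) (at (\<phi> x'))"
        by (auto intro!: derivative_eq_intros)
      then have "deriv (\<lambda>z. z ^ k) (\<phi> x') \<noteq> 0" using nz *(1) by (simp add: DERIV_imp_deriv)
      then obtain r where r: "r > 0" "inj_on (\<lambda>z. z ^ k) (ball (\<phi> x') r)"
        by (rule has_complex_derivative_locally_injective[of "\<lambda>z. z ^ k" UNIV "\<phi> x'", rotated 3])
          (auto intro!: holomorphic_intros)
      define M where "M = ball (\<phi> x') r \<inter> ball 0 1"
      have "openin (top_of_set S) (\<phi>' ` M)"
        by (rule homeomorphism_openin_preimage[OF *(6,2)]) (auto simp: M_def)
      moreover have "x' \<in> \<phi>' ` M" using \<phi>[of x'] x' r(1)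
        by (intro image_eqI[of _ _ "\<phi> x'"]) (auto simp: M_def)
      moreover have "inj_on f (\<phi>' ` M)"
      proof (rule inj_onI)
        fix u v assume "u \<in> \<phi>' ` M" "v \<in> \<phi>' ` M" and fuv: "f u = f v"
        then obtain a b where ab: "a \<in> M" "b \<in> M" "u = \<phi>' a" "v = \<phi>' b" by blast
        have "a ^ k = b ^ k" using eq ab fuv by (metis IntD2 M_def)
        then have "a = b" using r(2) ab(1,2) by (auto simp: M_def dest: inj_onD)
        then show "u = v" using ab by simp
      qed
      ultimately show ?thesis unfolding locally_injective_at_def by blast
    qed
    ultimately show "f x' \<noteq> f x \<and> locally_injective_at S f x'" by metis
  qed
qed

text \<open>An unfolded arc is carried by \<open>f\<close> onto another arc of \<open>\<A>\<close>; the others are folded by \<open>f\<close> and have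
  their image in \<open>X\<close>.\<close>

abbreviation "unfolded \<alpha> \<equiv> compose circle f \<alpha> \<in> \<A>"

lemma not_unfolded:
  assumes "\<alpha> \<in> \<A>" "\<not> unfolded \<alpha>"
  shows "folded_by f \<alpha>" "\<And>t. t \<in> circle \<Longrightarrow> f (\<alpha> t) \<in> X"
proof -
  have *: "folded_by f \<alpha> \<and> f ` \<alpha> ` circle \<inter> Im_paths \<A> = {}"
    using \<A>_stable assms by (auto simp: strongly_f_stable_def f_stable_def)
  then show "folded_by f \<alpha>" by blast
  show "f (\<alpha> t) \<in> X" if "t \<in> circle" for t
    using * that f_in_S[OF alpha_in_S[OF assms(1) that]] by blast
qed

lemma folded_eq: "folded_by f \<alpha> \<Longrightarrow> t \<in> circle \<Longrightarrow> f (\<alpha> (flip t)) = f (\<alpha> t)"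
proof -
  have "Complex (- Re t) (Im t) = flip t" by (simp add: complex_eq_iff)
  then show "folded_by f \<alpha> \<Longrightarrow> t \<in> circle \<Longrightarrow> f (\<alpha> (flip t)) = f (\<alpha> t)"
    unfolding folded_by_def by metis
qed

lemma unfolded_not_folded:
  assumes "\<alpha> \<in> \<A>" "unfolded \<alpha>"
  shows "\<not> folded_by f \<alpha>"
proof
  assume "folded_by f \<alpha>"
  then have "compose circle f \<alpha> (flip 1) = compose circle f \<alpha> 1"
    using folded_eq[of \<alpha> 1] by (simp add: compose_def)
  then show False using alpha_eq_iff[OF assms(2), of 1 "flip 1"] by simp
qed

lemma critical_on_arc:
  assumes \<alpha>: "\<alpha> \<in> \<A>" "t \<in> circle" and "critical (\<alpha> t)"
  shows "folded_by f \<alpha>" "Re t = 0" "has_local_degree S f (\<alpha> t) 2"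
proof -
  have "\<alpha> t \<in> Im_paths \<A>" using \<alpha> unfolding Im_paths_def by blast
  then have *: "simple_critical_point S f (\<alpha> t)" "\<exists>\<alpha>'\<in>\<A>. folded_by f \<alpha>' \<and> \<alpha> t = \<alpha>' (Complex 0 1)"
    using \<A>_stable assms(3) unfolding strongly_f_stable_def by blast+
  then show "has_local_degree S f (\<alpha> t) 2" by (simp add: simple_critical_point_def)
  obtain \<alpha>' where \<alpha>': "\<alpha>' \<in> \<A>" "folded_by f \<alpha>'" "\<alpha> t = \<alpha>' (Complex 0 1)" using *(2) by blast
  have i: "Complex 0 1 \<in> circle" by (simp add: complex_norm)
  have "\<alpha>' = \<alpha>" using alpha_disjoint[OF \<alpha>(1) \<alpha>'(1) \<alpha>(2) i \<alpha>'(3)] by simp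
  then show "folded_by f \<alpha>" using \<alpha>'(2) by simp
  have "Complex 0 1 = t \<or> Complex 0 1 = cnj t"
    using alpha_eq_iff[OF \<alpha> i] \<alpha>'(3) \<open>\<alpha>' = \<alpha>\<close> by simp
  then show "Re t = 0" by (auto simp: complex_eq_iff)
qed

lemma unfolded_regular:
  assumes "\<alpha> \<in> \<A>" "unfolded \<alpha>" "t \<in> circle"
  shows "\<not> critical (\<alpha> t)"
  using critical_on_arc(1) unfolded_not_folded assms by blast

lemma folded_regular:
  assumes "\<alpha> \<in> \<A>" "t \<in> circle" "Re t \<noteq> 0"
  shows "\<not> critical (\<alpha> t)"
  using critical_on_arc(2) assms by blast

text \<open>Pairs \<open>s\<close>, \<open>flip s\<close> tending to the midpoint have equal images under \<open>f\<close>.\<close>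

lemma folded_midpoint:
  assumes \<alpha>: "\<alpha> \<in> \<A>" and fold: "folded_by f \<alpha>" and t: "t \<in> circle" "Re t = 0"
  shows "\<not> locally_injective_at S f (\<alpha> t)"
proof
  assume "locally_injective_at S f (\<alpha> t)"
  then obtain U where U: "openin (top_of_set S) U" "\<alpha> t \<in> U" "inj_on f U"
    by (auto simp: locally_injective_at_def)
  obtain r where r: "r > 0" "ball (\<alpha> t) r \<inter> S \<subseteq> U" using openin_contains_ball U by metis
  obtain d where d: "d > 0" "\<And>s. s \<in> circle \<Longrightarrow> dist s t < d \<Longrightarrow> dist (\<alpha> s) (\<alpha> t) < r"
    using alpha_cont[OF \<alpha>] t(1) r(1) unfolding continuous_on_iff by metis
  have "continuous (at 0) (\<lambda>a. t * cis a)" unfolding cis_conv_exp by (intro continuous_intros)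
  then obtain e where e: "e > 0" "\<And>a. dist a 0 < e \<Longrightarrow> dist (t * cis a) (t * cis 0) < d"
    unfolding continuous_at_eps_delta using d(1) by metis
  define a where "a = min e 1 / 2"
  define s where "s = t * cis a"
  have a: "0 < a" "a < e" "a < 1" using e(1) by (auto simp: a_def)
  have "dist s t < d" using e(2)[of a] a by (simp add: s_def)
  have s: "s \<in> circle" using t(1) by (simp add: s_def norm_mult)
  have "flip t = t" using t(2) by (simp add: complex_eq_iff)
  then have "dist (flip s) t = dist s t"
    by (metis (no_types, opaque_lifting) complex_cnj_diff complex_mod_cnj dist_norm minus_diff_eq
        minus_diff_minus norm_minus_cancel)
  moreover have inU: "\<alpha> u \<in> U" if "u \<in> circle" "dist u t < d" for u
    using d(2)[OF that] r(2) alpha_in_S[OF \<alpha> that(1)] by (auto simp: dist_commute)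
  ultimately have "\<alpha> s \<in> U" "\<alpha> (flip s) \<in> U"
    using inU[of s] inU[of "flip s"] s \<open>dist s t < d\<close> by auto
  then have "\<alpha> (flip s) = \<alpha> s" using U(3) folded_eq[OF fold s] by (auto dest: inj_onD)
  then have "flip s = s \<or> flip s = cnj s" using alpha_eq_iff[OF \<alpha> s, of "flip s"] s by simp
  then have "Re s = 0 \<or> s = 0" by (auto simp: complex_eq_iff)
  moreover have "Re s = - Im t * sin a" using t(2) by (simp add: s_def)
  moreover have "sin a \<noteq> 0" using a sin_gt_zero[of a] pi_gt3 by simp
  moreover have "Im t \<noteq> 0" using t by (auto simp: norm_complex_def cmod_def)
  ultimately show False using s by auto
qed

section \<open>Unfolded arcs: the two sides are kept or exchanged together\<close>

lemma f_limit:
  assumes "x \<in> S" "\<epsilon> > 0"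
  obtains \<delta> where "\<delta> > 0" "\<And>x'. x' \<in> S \<Longrightarrow> dist x' x < \<delta> \<Longrightarrow> dist (f x') (f x) < \<epsilon>"
  using f_cont assms unfolding continuous_on_iff by metis

lemma alpha_limit:
  assumes "\<alpha> \<in> \<A>" "t \<in> circle" "\<epsilon> > 0"
  obtains \<delta> where "\<delta> > 0" "\<And>s. s \<in> circle \<Longrightarrow> dist s t < \<delta> \<Longrightarrow> dist (\<alpha> s) (\<alpha> t) < \<epsilon>"
  using alpha_cont assms unfolding continuous_on_iff by metis

lemma f_H_limit_closed:
  assumes \<alpha>: "\<alpha> \<in> \<A>" and t: "t \<in> circle" and \<epsilon>: "\<epsilon> > 0"
  obtains \<delta> where "\<delta> > 0" "\<And>z. 1 \<le> norm z \<Longrightarrow> dist z t < \<delta> \<Longrightarrow> dist (f (H \<alpha> z)) (f (\<alpha> t)) < \<epsilon>"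
proof -
  obtain \<delta>1 where 1: "\<delta>1 > 0" "\<And>x'. x' \<in> S \<Longrightarrow> dist x' (\<alpha> t) < \<delta>1 \<Longrightarrow> dist (f x') (f (\<alpha> t)) < \<epsilon>"
    using f_limit[OF alpha_in_S[OF \<alpha> t] \<epsilon>] by metis
  obtain \<delta> where 2: "\<delta> > 0" "\<And>z. 1 \<le> norm z \<Longrightarrow> dist z t < \<delta> \<Longrightarrow> dist (H \<alpha> z) (\<alpha> t) < \<delta>1"
    using H_limit[OF \<alpha> t 1(1)] by metis
  show thesis
    by (rule that[OF 2(1)]) (use 1(2) 2(2) H_closed_in_S[OF \<alpha>] in blast)
qed

lemma f_H_limit:
  assumes "\<alpha> \<in> \<A>" "t \<in> circle" "\<epsilon> > 0"
  obtains \<delta> where "\<delta> > 0" "\<And>z. z \<in> exterior \<Longrightarrow> dist z t < \<delta> \<Longrightarrow> dist (f (H \<alpha> z)) (f (\<alpha> t)) < \<epsilon>"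
proof -
  obtain \<delta> where "\<delta> > 0" "\<And>z. 1 \<le> norm z \<Longrightarrow> dist z t < \<delta> \<Longrightarrow> dist (f (H \<alpha> z)) (f (\<alpha> t)) < \<epsilon>"
    using f_H_limit_closed[OF assms] by metis
  then show thesis by (intro that) auto
qed

lemma f_H_cont:
  assumes "\<alpha> \<in> \<A>" "B \<subseteq> exterior"
  shows "continuous_on B (\<lambda>z. f (H \<alpha> z))"
proof (rule continuous_on_compose2[OF f_cont])
  show "continuous_on B (H \<alpha>)" using H_cont[OF assms(1)]
    by (rule continuous_on_subset) (use assms(2) in auto)
  show "H \<alpha> ` B \<subseteq> S" using H_in[OF assms(1)] assms(2) by blast
qed

lemma locally_injective_atE:
  assumes "x \<in> S" "locally_injective_at S f x"
  obtains r where "r > 0" "inj_on f (ball x r \<inter> S)"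
proof -
  obtain U where U: "openin (top_of_set S) U" "x \<in> U" "inj_on f U"
    using assms(2) by (auto simp: locally_injective_at_def)
  then obtain r where r: "r > 0" "ball x r \<inter> S \<subseteq> U" using openin_contains_ball by metis
  then show thesis using that[OF r(1)] inj_on_subset[OF U(3)] by blast
qed

lemma alpha_near_ball:
  assumes "\<alpha> \<in> \<A>" "t \<in> circle" "r > 0"
  obtains d where "d > 0"
    "\<And>s. s \<in> circle \<Longrightarrow> dist s t < d \<or> dist s (cnj t) < d \<Longrightarrow> dist (\<alpha> s) (\<alpha> t) < r"
proof -
  obtain d where d: "d > 0" "\<And>s. s \<in> circle \<Longrightarrow> dist s t < d \<Longrightarrow> dist (\<alpha> s) (\<alpha> t) < r"
    using alpha_limit[OF assms] by metis
  show thesis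
  proof (rule that[OF d(1)])
    fix s assume s: "s \<in> circle" "dist s t < d \<or> dist s (cnj t) < d"
    have eq: "\<alpha> (cnj s) = \<alpha> s" using alpha_eq_iff[OF assms(1), of "cnj s" s] s by auto
    have "dist (cnj s) t = dist s (cnj t)" by (metis complex_cnj_cnj complex_cnj_diff complex_mod_cnj dist_norm)
    then show "dist (\<alpha> s) (\<alpha> t) < r" using d(2)[of s] d(2)[of "cnj s"] s eq by auto
  qed
qed

text \<open>The image of a point close to \<open>\<alpha> t\<close> but off the arc is close to the image arc and off it: \<open>f\<close> is
  injective near \<open>\<alpha> t\<close>, and the part of the image arc near \<open>f (\<alpha> t)\<close> is the image of the part of \<open>\<alpha>\<close>
  near \<open>\<alpha> t\<close>.\<close>

lemma unfolded_image_near: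
  assumes \<alpha>: "\<alpha> \<in> \<A>" "unfolded \<alpha>" and t: "t \<in> circle" and \<epsilon>: "\<epsilon> > 0"
  obtains \<delta> where "\<delta> > 0" "\<And>z. z \<in> exterior \<Longrightarrow> dist z t < \<delta> \<Longrightarrow>
     f (H \<alpha> z) \<in> H (compose circle f \<alpha>) ` (exterior \<inter> (ball t \<epsilon> \<union> ball (cnj t) \<epsilon>))"
proof -
  define \<alpha>' where "\<alpha>' = compose circle f \<alpha>"
  have \<alpha>': "\<alpha>' \<in> \<A>" using \<alpha> by (simp add: \<alpha>'_def)
  have \<alpha>'_eq: "\<alpha>' s = f (\<alpha> s)" if "s \<in> circle" for s using that by (simp add: \<alpha>'_def compose_def)
  have at: "\<alpha> t \<in> S" using alpha_in_S \<alpha>(1) t by blast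
  obtain r where r: "r > 0" "inj_on f (ball (\<alpha> t) r \<inter> S)"
    using locally_injective_atE[OF at regular_locally_injective[OF at unfolded_regular[OF \<alpha> t]]] by metis
  obtain d where d: "d > 0" "\<And>s. s \<in> circle \<Longrightarrow> dist s t < d \<or> dist s (cnj t) < d \<Longrightarrow> dist (\<alpha> s) (\<alpha> t) < r"
    using alpha_near_ball[OF \<alpha>(1) t r(1)] by metis
  obtain \<delta>1 where 1: "\<delta>1 > 0"
    "\<And>s. s \<in> circle \<Longrightarrow> dist (\<alpha>' s) (\<alpha>' t) < \<delta>1 \<Longrightarrow> dist s t < d \<or> dist s (cnj t) < d"
    using alpha_near[OF \<alpha>' t d(1)] by metis
  obtain \<delta>2 where 2: "\<delta>2 > 0" "\<And>x. x \<in> S - \<alpha>' ` circle \<Longrightarrow> dist x (\<alpha>' t) < \<delta>2 \<Longrightarrow>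
       \<exists>z \<in> exterior \<inter> (ball t \<epsilon> \<union> ball (cnj t) \<epsilon>). x = H \<alpha>' z"
    using H_near[OF \<alpha>' t \<epsilon>] by metis
  obtain \<delta>3 where 3: "\<delta>3 > 0" "\<And>z. 1 \<le> norm z \<Longrightarrow> dist z t < \<delta>3 \<Longrightarrow> dist (H \<alpha> z) (\<alpha> t) < r"
    using H_limit[OF \<alpha>(1) t r(1)] by metis
  obtain \<delta>4 where 4: "\<delta>4 > 0" "\<And>z. z \<in> exterior \<Longrightarrow> dist z t < \<delta>4 \<Longrightarrow> dist (f (H \<alpha> z)) (f (\<alpha> t)) < min \<delta>1 \<delta>2"
    using f_H_limit[OF \<alpha>(1) t, of "min \<delta>1 \<delta>2"] 1(1) 2(1) by (metis min_less_iff_conj)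
  show thesis
  proof (rule that[of "min \<delta>3 \<delta>4"])
    show "0 < min \<delta>3 \<delta>4" using 3 4 by simp
    fix z assume z: "z \<in> exterior" "dist z t < min \<delta>3 \<delta>4"
    have near: "dist (f (H \<alpha> z)) (\<alpha>' t) < min \<delta>1 \<delta>2" using 4(2)[of z] z \<alpha>'_eq[OF t] by simp
    have Hz: "H \<alpha> z \<in> S - \<alpha> ` circle" using H_in \<alpha>(1) z(1) by blast
    have "f (H \<alpha> z) \<noteq> \<alpha>' s" if s: "s \<in> circle" for s
    proof
      assume eq: "f (H \<alpha> z) = \<alpha>' s"
      then have "dist (\<alpha> s) (\<alpha> t) < r" using 1(2)[OF s] d(2)[OF s] near by simp
      moreover have "dist (H \<alpha> z) (\<alpha> t) < r" using 3(2)[of z] z by simp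
      ultimately have "H \<alpha> z = \<alpha> s"
        using r(2) eq \<alpha>'_eq[OF s] Hz alpha_in_S[OF \<alpha>(1) s] by (auto simp: inj_on_def dist_commute)
      then show False using Hz s by blast
    qed
    then have "f (H \<alpha> z) \<in> S - \<alpha>' ` circle" using f_in_S Hz by blast
    then show "f (H \<alpha> z) \<in> H (compose circle f \<alpha>) ` (exterior \<inter> (ball t \<epsilon> \<union> ball (cnj t) \<epsilon>))"
      using 2(2) near unfolding \<alpha>'_def[symmetric] by (auto simp: image_iff)
  qed
qed

text \<open>For \<open>\<sigma> = 1\<close>, the slit coordinate of \<open>f (H \<alpha> z)\<close> lies in the same half plane as \<open>t\<close> when \<open>z\<close> is
  near \<open>t\<close>, so that \<open>f\<close> keeps this side of the arc at \<open>t\<close>; for \<open>\<sigma> = - 1\<close> it exchanges the sides.\<close>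

definition maps_side :: "(complex \<Rightarrow> 'a) \<Rightarrow> real \<Rightarrow> complex \<Rightarrow> bool"
  where "maps_side \<alpha> \<sigma> t \<longleftrightarrow> (\<exists>\<delta>>0. \<forall>z \<in> exterior \<inter> ball t \<delta>. \<exists>w \<in> exterior.
    0 < \<sigma> * (Im w * Im t) \<and> f (H \<alpha> z) = H (compose circle f \<alpha>) w)"

lemma maps_side_exists:
  assumes \<alpha>: "\<alpha> \<in> \<A>" "unfolded \<alpha>" and t: "t \<in> circle" "Im t \<noteq> 0"
  shows "maps_side \<alpha> 1 t \<or> maps_side \<alpha> (-1) t"
proof -
  let ?H = "H (compose circle f \<alpha>)" and ?\<epsilon> = "\<bar>Im t\<bar>"
  obtain \<delta> where \<delta>: "\<delta> > 0" "\<And>z. z \<in> exterior \<Longrightarrow> dist z t < \<delta> \<Longrightarrow>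
     f (H \<alpha> z) \<in> ?H ` (exterior \<inter> (ball t ?\<epsilon> \<union> ball (cnj t) ?\<epsilon>))"
    using unfolded_image_near[OF \<alpha> t(1), of ?\<epsilon>] t(2) by auto
  obtain B \<delta>' where B: "path_connected B" "B \<subseteq> exterior \<inter> ball t \<delta>" "\<delta>' > 0" "exterior \<inter> ball t \<delta>' \<subseteq> B"
    using exterior_half_ball[OF t(1) \<delta>(1)] by metis
  let ?C = "(\<lambda>z. f (H \<alpha> z)) ` B"
  have "connected ?C"
    by (intro connected_continuous_image f_H_cont \<alpha> path_connected_imp_connected B) (use B in auto)
  moreover have "?C \<subseteq> ?H ` (exterior \<inter> (ball t ?\<epsilon> \<union> ball (cnj t) ?\<epsilon>))"
  proof (rule image_subsetI)
    fix z assume "z \<in> B"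
    then have "z \<in> exterior" "dist z t < \<delta>" using B(2) by (auto simp: dist_commute)
    then show "f (H \<alpha> z) \<in> ?H ` (exterior \<inter> (ball t ?\<epsilon> \<union> ball (cnj t) ?\<epsilon>))" by (rule \<delta>(2))
  qed
  ultimately have "?C \<subseteq> ?H ` (exterior \<inter> ball t ?\<epsilon>) \<or> ?C \<subseteq> ?H ` (exterior \<inter> ball (cnj t) ?\<epsilon>)"
    by (rule slit_side[OF \<alpha>(2)]) (simp_all add: conjugate_balls_disjoint)
  then show ?thesis
  proof
    assume *: "?C \<subseteq> ?H ` (exterior \<inter> ball t ?\<epsilon>)"
    have "\<exists>w \<in> exterior. 0 < 1 * (Im w * Im t) \<and> f (H \<alpha> z) = ?H w" if z: "z \<in> exterior \<inter> ball t \<delta>'" for z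
    proof -
      have "f (H \<alpha> z) \<in> ?C" using z B(4) by blast
      then obtain w where "w \<in> exterior" "w \<in> ball t ?\<epsilon>" "f (H \<alpha> z) = ?H w" using * by blast
      then show ?thesis using ball_same_side[of w t ?\<epsilon>] by (intro bexI[of _ w]) auto
    qed
    then show ?thesis unfolding maps_side_def using B(3) by blast
  next
    assume *: "?C \<subseteq> ?H ` (exterior \<inter> ball (cnj t) ?\<epsilon>)"
    have "\<exists>w \<in> exterior. 0 < (-1) * (Im w * Im t) \<and> f (H \<alpha> z) = ?H w" if z: "z \<in> exterior \<inter> ball t \<delta>'" for z
    proof -
      have "f (H \<alpha> z) \<in> ?C" using z B(4) by blast
      then obtain w where "w \<in> exterior" "w \<in> ball (cnj t) ?\<epsilon>" "f (H \<alpha> z) = ?H w" using * by blast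
      then show ?thesis using ball_opposite_side[of w t ?\<epsilon>] by (intro bexI[of _ w]) auto
    qed
    then show ?thesis unfolding maps_side_def using B(3) by blast
  qed
qed

lemma maps_side_unique:
  assumes \<alpha>: "\<alpha> \<in> \<A>" "unfolded \<alpha>" and t: "t \<in> circle"
    and "maps_side \<alpha> 1 t" "maps_side \<alpha> (-1) t"
  shows False
proof -
  obtain \<delta>1 where 1: "\<delta>1 > 0" "\<forall>z \<in> exterior \<inter> ball t \<delta>1. \<exists>w \<in> exterior.
    0 < 1 * (Im w * Im t) \<and> f (H \<alpha> z) = H (compose circle f \<alpha>) w" using assms(4) maps_side_def by blast
  obtain \<delta>2 where 2: "\<delta>2 > 0" "\<forall>z \<in> exterior \<inter> ball t \<delta>2. \<exists>w \<in> exterior.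
    0 < (-1) * (Im w * Im t) \<and> f (H \<alpha> z) = H (compose circle f \<alpha>) w" using assms(5) maps_side_def by blast
  obtain z where z: "z \<in> exterior" "dist z t < min \<delta>1 \<delta>2"
    using exterior_near[OF t, of "min \<delta>1 \<delta>2"] 1 2 by (metis min_less_iff_conj)
  have zz: "z \<in> exterior \<inter> ball t \<delta>1" "z \<in> exterior \<inter> ball t \<delta>2" using z by (auto simp: dist_commute)
  obtain w1 where w1: "w1 \<in> exterior" "0 < 1 * (Im w1 * Im t)" "f (H \<alpha> z) = H (compose circle f \<alpha>) w1"
    using 1(2) zz(1) by blast
  obtain w2 where w2: "w2 \<in> exterior" "0 < (-1) * (Im w2 * Im t)" "f (H \<alpha> z) = H (compose circle f \<alpha>) w2"
    using 2(2) zz(2) by blast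
  have "w1 = w2" using H_inj[OF \<alpha>(2) w1(1) w2(1)] w1(3) w2(3) by simp
  then show False using w1(2) w2(2) by simp
qed

lemma maps_side_open:
  assumes "maps_side \<alpha> \<sigma> t" and t: "t \<in> half_circle \<tau>"
  shows "\<forall>\<^sub>F s in at t within half_circle \<tau>. maps_side \<alpha> \<sigma> s"
proof -
  obtain \<delta> where \<delta>: "\<delta> > 0" "\<forall>z \<in> exterior \<inter> ball t \<delta>. \<exists>w \<in> exterior.
    0 < \<sigma> * (Im w * Im t) \<and> f (H \<alpha> z) = H (compose circle f \<alpha>) w" using assms(1) maps_side_def by blast
  have "maps_side \<alpha> \<sigma> s" if s: "s \<in> half_circle \<tau>" "dist s t < \<delta>" for s
    unfolding maps_side_def
  proof (intro exI[of _ "\<delta> - dist s t"] conjI ballI)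
    show "0 < \<delta> - dist s t" using s by simp
    fix z assume z: "z \<in> exterior \<inter> ball s (\<delta> - dist s t)"
    then have "z \<in> exterior \<inter> ball t \<delta>" using dist_triangle[of t z s] by (auto simp: dist_commute)
    then obtain w where w: "w \<in> exterior" "0 < \<sigma> * (Im w * Im t)" "f (H \<alpha> z) = H (compose circle f \<alpha>) w"
      using \<delta>(2) by blast
    have "0 < \<tau> * Im s" "0 < \<tau> * Im t" using s t by auto
    then have "0 < Im s \<longleftrightarrow> 0 < Im t" "Im s < 0 \<longleftrightarrow> Im t < 0" by (auto simp: zero_less_mult_iff)
    then have "0 < \<sigma> * (Im w * Im s)" using w(2) by (auto simp: zero_less_mult_iff mult_less_0_iff)
    then show "\<exists>w \<in> exterior. 0 < \<sigma> * (Im w * Im s) \<and> f (H \<alpha> z) = H (compose circle f \<alpha>) w"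
      using w by blast
  qed
  then show ?thesis unfolding eventually_at using \<delta>(1) by blast
qed

lemma maps_side_constant:
  assumes \<alpha>: "\<alpha> \<in> \<A>" "unfolded \<alpha>" and \<tau>: "\<tau> = 1 \<or> \<tau> = -1"
    and "s \<in> half_circle \<tau>" "t \<in> half_circle \<tau>"
  shows "maps_side \<alpha> 1 s = maps_side \<alpha> 1 t"
proof (rule connected_local_const[OF connected_half_circle[OF \<tau>] assms(4,5)], intro ballI)
  fix t assume t: "t \<in> half_circle \<tau>"
  have side: "maps_side \<alpha> 1 s \<longleftrightarrow> \<not> maps_side \<alpha> (-1) s" if "s \<in> half_circle \<tau>" for s
  proof -
    have "s \<in> circle" "Im s \<noteq> 0" using that by auto
    then show ?thesis using maps_side_exists[OF \<alpha>] maps_side_unique[OF \<alpha>] by blast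
  qed
  show "\<forall>\<^sub>F s in at t within half_circle \<tau>. maps_side \<alpha> 1 t = maps_side \<alpha> 1 s"
  proof (cases "maps_side \<alpha> 1 t")
    case True
    then show ?thesis using maps_side_open[OF True t] by simp
  next
    case False
    then have "\<forall>\<^sub>F s in at t within half_circle \<tau>. maps_side \<alpha> (-1) s"
      using maps_side_open[OF _ t] side[OF t] by simp
    then show ?thesis unfolding eventually_at using side False by blast
  qed
qed

text \<open>If both sides went to the same side of the image arc, the points near \<open>\<alpha> \<i> = \<alpha> (- \<i>)\<close> would miss
  the other side, contradicting that \<open>f\<close> is open there.\<close>

lemma maps_side_both_halves:
  assumes \<alpha>: "\<alpha> \<in> \<A>" "unfolded \<alpha>"
  shows "maps_side \<alpha> 1 \<i> = maps_side \<alpha> 1 (- \<i>)"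
proof (rule ccontr)
  define \<alpha>' where "\<alpha>' = compose circle f \<alpha>"
  have \<alpha>': "\<alpha>' \<in> \<A>" using \<alpha> by (simp add: \<alpha>'_def)
  have \<alpha>'_eq: "\<alpha>' s = f (\<alpha> s)" if "s \<in> circle" for s using that by (simp add: \<alpha>'_def compose_def)
  have ic: "\<i> \<in> circle" "- \<i> \<in> circle" by auto
  assume "maps_side \<alpha> 1 \<i> \<noteq> maps_side \<alpha> 1 (- \<i>)"
  then obtain \<sigma> :: real where \<sigma>: "\<sigma> = 1 \<or> \<sigma> = -1" "maps_side \<alpha> \<sigma> \<i>" "maps_side \<alpha> (- \<sigma>) (- \<i>)"
    using maps_side_exists[OF \<alpha>, of \<i>] maps_side_exists[OF \<alpha>, of "- \<i>"] by fastforce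
  obtain \<delta>1 where 1: "\<delta>1 > 0" "\<forall>z \<in> exterior \<inter> ball \<i> \<delta>1. \<exists>w \<in> exterior.
    0 < \<sigma> * (Im w * Im \<i>) \<and> f (H \<alpha> z) = H \<alpha>' w" using \<sigma>(2) unfolding maps_side_def \<alpha>'_def by blast
  obtain \<delta>2 where 2: "\<delta>2 > 0" "\<forall>z \<in> exterior \<inter> ball (- \<i>) \<delta>2. \<exists>w \<in> exterior.
    0 < (- \<sigma>) * (Im w * Im (- \<i>)) \<and> f (H \<alpha> z) = H \<alpha>' w" using \<sigma>(3) unfolding maps_side_def \<alpha>'_def by blast
  have side: "\<exists>w \<in> exterior. 0 < \<sigma> * Im w \<and> f (H \<alpha> z) = H \<alpha>' w"
    if "z \<in> exterior \<inter> (ball \<i> (min \<delta>1 \<delta>2) \<union> ball (cnj \<i>) (min \<delta>1 \<delta>2))" for z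
    using that 1(2) 2(2) by fastforce
  obtain \<rho> where \<rho>: "\<rho> > 0" "\<And>x. x \<in> S - \<alpha> ` circle \<Longrightarrow> dist x (\<alpha> \<i>) < \<rho> \<Longrightarrow>
       \<exists>z \<in> exterior \<inter> (ball \<i> (min \<delta>1 \<delta>2) \<union> ball (cnj \<i>) (min \<delta>1 \<delta>2)). x = H \<alpha> z"
    using H_near[OF \<alpha>(1) ic(1), of "min \<delta>1 \<delta>2"] 1 2 by (metis min_less_iff_conj)
  have ai: "\<alpha> \<i> \<in> S" using alpha_in_S \<alpha>(1) ic by blast
  obtain U V g where U: "openin (top_of_set S) U" "\<alpha> \<i> \<in> U" "openin (top_of_set S) V" "homeomorphism U V f g"
    using regular_chart[OF ai unfolded_regular[OF \<alpha> ic(1)]] by metis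
  have fiV: "f (\<alpha> \<i>) \<in> V" using U by (auto simp: homeomorphism_def)
  have "g (f (\<alpha> \<i>)) = \<alpha> \<i>" using U by (auto simp: homeomorphism_def)
  then obtain \<rho>1 where \<rho>1: "\<rho>1 > 0" "\<And>v. v \<in> V \<Longrightarrow> dist v (f (\<alpha> \<i>)) < \<rho>1 \<Longrightarrow> dist (g v) (\<alpha> \<i>) < \<rho>"
    using homeomorphism_cont2[OF U(4)] fiV \<rho>(1) unfolding continuous_on_iff by metis
  obtain \<rho>2 where \<rho>2: "\<rho>2 > 0" "ball (f (\<alpha> \<i>)) \<rho>2 \<inter> S \<subseteq> V" using openin_contains_ball U(3) fiV by metis
  \<comment> \<open>the midpoint of the side of the image arc that would be missed\<close>
  define s where "s = - of_real \<sigma> * \<i>"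
  have s: "s \<in> circle" "Im s = - \<sigma>" using \<sigma>(1) by (auto simp: s_def)
  have "s = \<i> \<or> s = cnj \<i>" using \<sigma>(1) by (auto simp: s_def)
  then have \<alpha>s: "\<alpha>' s = f (\<alpha> \<i>)" using alpha_eq_iff[OF \<alpha>' ic(1) s(1)] \<alpha>'_eq[OF ic(1)] by simp
  obtain d where d: "d > 0" "\<And>z. 1 \<le> norm z \<Longrightarrow> dist z s < d \<Longrightarrow> dist (H \<alpha>' z) (\<alpha>' s) < min \<rho>1 \<rho>2"
    using H_limit[OF \<alpha>' s(1), of "min \<rho>1 \<rho>2"] \<rho>1(1) \<rho>2(1) by (metis min_less_iff_conj)
  obtain w where w: "w \<in> exterior" "dist w s < min d 1"
    using exterior_near[OF s(1), of "min d 1"] d(1) by (metis min_less_iff_conj zero_less_one)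
  have near: "dist (H \<alpha>' w) (f (\<alpha> \<i>)) < min \<rho>1 \<rho>2" using d(2)[of w] w \<alpha>s by simp
  have HwS: "H \<alpha>' w \<in> S - \<alpha>' ` circle" using H_in[OF \<alpha>' w(1)] .
  then have HwV: "H \<alpha>' w \<in> V" using near \<rho>2(2) by (auto simp: dist_commute)
  define x where "x = g (H \<alpha>' w)"
  have x: "x \<in> U" "f x = H \<alpha>' w" using U(4) HwV by (auto simp: x_def homeomorphism_def)
  have xS: "x \<in> S" using x(1) openin_imp_subset[OF U(1)] by blast
  have "x \<noteq> \<alpha> u" if "u \<in> circle" for u
    using x(2) HwS \<alpha>'_eq[OF that] that by (metis DiffD2 imageI)
  then have "x \<in> S - \<alpha> ` circle" using xS by blast
  moreover have "dist x (\<alpha> \<i>) < \<rho>" using \<rho>1(2)[OF HwV] near by (simp add: x_def)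
  ultimately obtain z where z: "z \<in> exterior \<inter> (ball \<i> (min \<delta>1 \<delta>2) \<union> ball (cnj \<i>) (min \<delta>1 \<delta>2))" "x = H \<alpha> z"
    using \<rho>(2) by blast
  obtain w' where w': "w' \<in> exterior" "0 < \<sigma> * Im w'" "f (H \<alpha> z) = H \<alpha>' w'" using side[OF z(1)] by blast
  have "w' = w" using H_inj[OF \<alpha>' w'(1) w(1)] w'(3) x(2) z(2) by simp
  moreover have "0 < Im w * Im s"
    by (rule ball_same_side[of _ _ 1]) (use w(2) s \<sigma>(1) in \<open>auto simp: dist_commute\<close>)
  ultimately show False using w'(2) s(2) by (simp add: mult.commute)
qed

proposition unfolded_boundary_map:
  assumes \<alpha>: "\<alpha> \<in> \<A>" "unfolded \<alpha>"
  obtains \<sigma> where "\<sigma> = id \<or> \<sigma> = cnj"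
    "\<And>t \<epsilon>. t \<in> circle \<Longrightarrow> \<epsilon> > 0 \<Longrightarrow> \<exists>\<delta>>0. \<forall>z \<in> exterior \<inter> ball t \<delta>.
       f (H \<alpha> z) \<in> H (compose circle f \<alpha>) ` (exterior \<inter> ball (\<sigma> t) \<epsilon>)"
proof -
  let ?H = "H (compose circle f \<alpha>)"
  have i: "\<i> \<in> half_circle 1" "- \<i> \<in> half_circle (-1)" by auto
  have all: "maps_side \<alpha> 1 t = maps_side \<alpha> 1 \<i>" if "t \<in> circle" "Im t \<noteq> 0" for t
  proof (cases "Im t > 0")
    case True
    then have "t \<in> half_circle 1" using that by simp
    then show ?thesis using maps_side_constant[OF \<alpha> _ _ i(1), of t] by simp
  next
    case False
    then have "t \<in> half_circle (-1)" using that by simp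
    then show ?thesis using maps_side_constant[OF \<alpha> _ _ i(2), of t] maps_side_both_halves[OF \<alpha>] by simp
  qed
  define \<tau> :: real where "\<tau> = (if maps_side \<alpha> 1 \<i> then 1 else -1)"
  define \<sigma> where "\<sigma> = (if maps_side \<alpha> 1 \<i> then id else cnj)"
  have side: "maps_side \<alpha> \<tau> t" if "t \<in> circle" "Im t \<noteq> 0" for t
    using all[OF that] maps_side_exists[OF \<alpha> that] by (auto simp: \<tau>_def)
  show thesis
  proof (rule that)
    show "\<sigma> = id \<or> \<sigma> = cnj" by (simp add: \<sigma>_def)
    fix t :: complex and \<epsilon> :: real assume t: "t \<in> circle" and \<epsilon>: "\<epsilon> > 0"
    show "\<exists>\<delta>>0. \<forall>z \<in> exterior \<inter> ball t \<delta>. f (H \<alpha> z) \<in> ?H ` (exterior \<inter> ball (\<sigma> t) \<epsilon>)"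
    proof (cases "Im t = 0")
      case True
      then have "cnj t = t" by (simp add: complex_eq_iff)
      then have "ball t \<epsilon> \<union> ball (cnj t) \<epsilon> = ball (\<sigma> t) \<epsilon>" by (simp add: \<sigma>_def)
      then show ?thesis using unfolded_image_near[OF \<alpha> t \<epsilon>] by (metis IntD1 IntD2 dist_commute mem_ball)
    next
      case False
      define \<epsilon>' where "\<epsilon>' = min \<epsilon> \<bar>Im t\<bar>"
      have \<epsilon>': "\<epsilon>' > 0" "\<epsilon>' \<le> \<epsilon>" "\<epsilon>' \<le> \<bar>Im t\<bar>" using \<epsilon> False by (auto simp: \<epsilon>'_def)
      obtain \<delta>1 where 1: "\<delta>1 > 0" "\<And>z. z \<in> exterior \<Longrightarrow> dist z t < \<delta>1 \<Longrightarrow>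
          f (H \<alpha> z) \<in> ?H ` (exterior \<inter> (ball t \<epsilon>' \<union> ball (cnj t) \<epsilon>'))"
        using unfolded_image_near[OF \<alpha> t \<epsilon>'(1)] by metis
      obtain \<delta>2 where 2: "\<delta>2 > 0" "\<forall>z \<in> exterior \<inter> ball t \<delta>2. \<exists>w \<in> exterior. 0 < \<tau> * (Im w * Im t) \<and> f (H \<alpha> z) = ?H w"
        using side[OF t False] unfolding maps_side_def by blast
      have "f (H \<alpha> z) \<in> ?H ` (exterior \<inter> ball (\<sigma> t) \<epsilon>)" if z: "z \<in> exterior \<inter> ball t (min \<delta>1 \<delta>2)" for z
      proof -
        obtain w where w: "w \<in> exterior" "w \<in> ball t \<epsilon>' \<union> ball (cnj t) \<epsilon>'" "f (H \<alpha> z) = ?H w"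
          using 1(2)[of z] z by (auto simp: dist_commute)
        obtain w' where w': "w' \<in> exterior" "0 < \<tau> * (Im w' * Im t)" "f (H \<alpha> z) = ?H w'" using 2(2) z by force
        have "w = w'" using H_inj[OF \<alpha>(2) w(1) w'(1)] w(3) w'(3) by simp
        then have sgn: "0 < \<tau> * (Im w * Im t)" using w'(2) by simp
        have "w \<in> ball (\<sigma> t) \<epsilon>'"
          using w(2) sgn ball_same_side[of w t \<epsilon>'] ball_opposite_side[of w t \<epsilon>'] \<epsilon>'(3)
          by (auto simp: \<tau>_def \<sigma>_def split: if_splits)
        then show ?thesis using w \<epsilon>'(2) by auto
      qed
      then show ?thesis using 1(1) 2(1) by (intro exI[of _ "min \<delta>1 \<delta>2"]) auto
    qed
  qed
qed

section \<open>Folded arcs: the two halves of one side have disjoint images\<close>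

lemma H_inj_closed:
  assumes \<alpha>: "\<alpha> \<in> \<A>" and z: "1 \<le> norm z1" "1 \<le> norm z2" and side: "0 < Im z1 * Im z2"
    and eq: "H \<alpha> z1 = H \<alpha> z2"
  shows "z1 = z2"
proof -
  have dich: "z \<in> exterior \<or> z \<in> circle" if "1 \<le> norm z" for z :: complex using that by auto
  have mixed: "H \<alpha> a \<noteq> H \<alpha> b" if "a \<in> exterior" "b \<in> circle" for a b
    using H_in[OF \<alpha> that(1)] H_circle[OF \<alpha> that(2)] that(2) by (metis DiffD2 imageI)
  consider "z1 \<in> exterior" "z2 \<in> exterior" | "z1 \<in> circle" "z2 \<in> circle"
    using dich[OF z(1)] dich[OF z(2)] mixed[of z1 z2] mixed[of z2 z1] eq by metis
  then show ?thesis
  proof cases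
    case 1 then show ?thesis using H_inj[OF \<alpha>] eq by blast
  next
    case 2
    then have "\<alpha> z1 = \<alpha> z2" using H_circle[OF \<alpha>] eq by metis
    then have "z2 = z1 \<or> z2 = cnj z1" using alpha_eq_iff[OF \<alpha> 2] by simp
    moreover have "z2 \<noteq> cnj z1" using side by (auto simp: mult_less_0_iff zero_less_mult_iff)
    ultimately show ?thesis by simp
  qed
qed

text \<open>A chart in which \<open>f\<close> is the squaring map, so that the points with equal images are antipodes.\<close>

lemma folded_midpoint_chart:
  assumes \<alpha>: "\<alpha> \<in> \<A>" and fold: "folded_by f \<alpha>" and t: "t \<in> circle" "Re t = 0"
  obtains U \<phi> where "openin (top_of_set S) U" "\<alpha> t \<in> U" "continuous_on U \<phi>"
    "(\<phi> :: 'a \<Rightarrow> complex) (\<alpha> t) = 0" "inj_on \<phi> U"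
    "\<And>u v. u \<in> U \<Longrightarrow> v \<in> U \<Longrightarrow> f u = f v \<longleftrightarrow> \<phi> u = \<phi> v \<or> \<phi> u = - \<phi> v"
proof -
  have "critical (\<alpha> t)"
    using folded_midpoint[OF \<alpha> fold t] regular_locally_injective alpha_in_S[OF \<alpha> t(1)] by blast
  then have "has_local_degree S f (\<alpha> t) 2" by (rule critical_on_arc(3)[OF \<alpha> t(1)])
  then obtain U V \<phi> \<phi>' \<psi> \<psi>' where *: "openin (top_of_set S) U" "\<alpha> t \<in> U" "openin (top_of_set S) V"
      "f ` U \<subseteq> V" "homeomorphism U (ball (0::complex) 1) \<phi> \<phi>'" "homeomorphism V (ball (0::complex) 1) \<psi> \<psi>'"
      "\<phi> (\<alpha> t) = 0" and eq: "\<forall>z \<in> ball 0 1. \<psi> (f (\<phi>' z)) = z\<^sup>2"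
    unfolding has_local_degree_def by blast
  have \<phi>: "\<phi> u \<in> ball 0 1" "\<phi>' (\<phi> u) = u" if "u \<in> U" for u
    using *(5) that by (auto simp: homeomorphism_def)
  have \<psi>f: "\<psi> (f u) = (\<phi> u)\<^sup>2" if "u \<in> U" for u using eq \<phi>[OF that] by metis
  have "f u = f v \<longleftrightarrow> \<phi> u = \<phi> v \<or> \<phi> u = - \<phi> v" if uv: "u \<in> U" "v \<in> U" for u v
  proof -
    have "f u \<in> V" "f v \<in> V" using uv *(4) by auto
    then have "f u = f v \<longleftrightarrow> \<psi> (f u) = \<psi> (f v)" using *(6) by (metis homeomorphism_apply1)
    then show ?thesis using \<psi>f uv by (simp add: power2_eq_iff)
  qed
  moreover have "inj_on \<phi> U" using \<phi>(2) by (metis inj_on_inverseI)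
  ultimately show thesis using that *(1,2,7) homeomorphism_cont1[OF *(5)] by blast
qed

text \<open>Equal images of distinct points arbitrarily close to \<open>t\<close> and \<open>flip t\<close> on one side of a folded arc:
  the obstruction to local injectivity of the extension at \<open>c \<alpha> t\<close>.\<close>

definition pinched :: "(complex \<Rightarrow> 'a) \<Rightarrow> complex \<Rightarrow> bool"
  where "pinched \<alpha> t \<longleftrightarrow> (\<forall>\<epsilon>>0. \<exists>p \<in> exterior. \<exists>q \<in> exterior. p \<noteq> q \<and>
    dist p t < \<epsilon> \<and> dist q (flip t) < \<epsilon> \<and> f (H \<alpha> p) = f (H \<alpha> q))"

text \<open>In the square root chart at the midpoint, pinched points are antipodes \<open>\<plusminus> v\<close>. A path joining
  them on one side of the arc, together with its antipode, surrounds the midpoint, whereas the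
  arc connects the midpoint to the outside and meets neither of them, as it is symmetric under
  the antipodal map. This is impossible by \<open>path_to_antipode_separates\<close>.\<close>

lemma not_pinched_midpoint:
  assumes \<alpha>: "\<alpha> \<in> \<A>" and fold: "folded_by f \<alpha>" and t: "t \<in> circle" "Re t = 0"
  shows "\<not> pinched \<alpha> t"
proof
  assume pinched: "pinched \<alpha> t"
  obtain U \<phi> where U: "openin (top_of_set S) U" "\<alpha> t \<in> U" and \<phi>: "continuous_on U \<phi>"
    "(\<phi> :: 'a \<Rightarrow> complex) (\<alpha> t) = 0" "inj_on \<phi> U"
    and \<phi>f: "\<And>u v. u \<in> U \<Longrightarrow> v \<in> U \<Longrightarrow> f u = f v \<longleftrightarrow> \<phi> u = \<phi> v \<or> \<phi> u = - \<phi> v"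
    using folded_midpoint_chart[OF assms] by metis
  obtain r0 where r0: "r0 > 0" "ball (\<alpha> t) r0 \<inter> S \<subseteq> U" using openin_contains_ball U by metis
  have flip_t: "flip t = t" using t(2) by (simp add: complex_eq_iff)
  define s where "s = (\<lambda>x. of_real x + \<i> * of_real (Im t * sqrt (1 - x\<^sup>2)))"
  have "\<bar>Im t\<bar> = 1" using t by (simp add: cmod_def)
  then have Imt: "(Im t)\<^sup>2 = 1" by (metis power2_abs one_power2)
  have s_circle: "s x \<in> circle" if "x \<in> {-1..1}" for x
  proof -
    have "x\<^sup>2 \<le> 1" using that by (simp add: abs_square_le_1 abs_le_iff)
    then show ?thesis by (simp add: s_def cmod_def power_mult_distrib Imt)
  qed
  have s_minus: "s (- x) = flip (s x)" for x by (simp add: s_def complex_eq_iff)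
  have s0: "s 0 = t" using t by (simp add: s_def complex_eq_iff)
  have s_cont: "continuous_on {-1..1} s" unfolding s_def by (intro continuous_intros)
  \<comment> \<open>the arc parametrised by the real part, with the midpoint at \<open>0\<close>\<close>
  define a where "a = (\<lambda>x. \<alpha> (s x))"
  have a_cont: "continuous_on {-1..1} a" unfolding a_def
    by (rule continuous_on_compose2[OF alpha_cont[OF \<alpha>] s_cont]) (use s_circle in blast)
  have a0: "a 0 = \<alpha> t" by (simp add: a_def s0)
  have aS: "a x \<in> \<alpha> ` circle" if "x \<in> {-1..1}" for x using s_circle[OF that] by (simp add: a_def)
  have a_inj: "x = y" if "a x = a y" "x \<in> {-1..1}" "y \<in> {-1..1}" for x y
  proof -
    have "s y = s x \<or> s y = cnj (s x)"
      using alpha_eq_iff[OF \<alpha> s_circle[OF that(2)] s_circle[OF that(3)]] that(1) by (simp add: a_def)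
    then have "Re (s y) = Re (s x)" by auto
    then show ?thesis by (simp add: s_def)
  qed
  have "(0::real) \<in> {-1..1}" by simp
  then obtain \<eta>0 where \<eta>0: "\<eta>0 > 0" "\<And>x. x \<in> {-1..1} \<Longrightarrow> dist x 0 < \<eta>0 \<Longrightarrow> dist (a x) (a 0) < r0"
    using a_cont r0(1) unfolding continuous_on_iff by metis
  define \<eta> where "\<eta> = min \<eta>0 1 / 2"
  have \<eta>: "0 < \<eta>" "\<eta> < 1" "\<eta> < \<eta>0" using \<eta>0 by (auto simp: \<eta>_def)
  have aU: "a x \<in> U" if "\<bar>x\<bar> \<le> \<eta>" for x
  proof -
    have x: "x \<in> {-1..1}" using that \<eta> by auto
    have "dist (a x) (\<alpha> t) < r0" using \<eta>0(2)[OF x] that \<eta> a0 by simp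
    moreover have "a x \<in> S" using alpha_in_S[OF \<alpha> s_circle[OF x]] by (simp add: a_def)
    ultimately show ?thesis using r0(2) by (auto simp: dist_commute)
  qed
  have a_neg: "\<phi> (a (- x)) = - \<phi> (a x)" if x: "\<bar>x\<bar> \<le> \<eta>" for x
  proof -
    have x1: "x \<in> {-1..1}" "-x \<in> {-1..1}" using x \<eta> by auto
    have xx: "a x \<in> U" "a (- x) \<in> U" using aU x by auto
    have "f (a (- x)) = f (a x)" using folded_eq[OF fold s_circle[OF x1(1)]] by (simp add: a_def s_minus)
    then consider "\<phi> (a (- x)) = \<phi> (a x)" | "\<phi> (a (- x)) = - \<phi> (a x)" using \<phi>f[OF xx(2,1)] by blast
    then show ?thesis
    proof cases
      case 1
      then have "a (- x) = a x" using \<phi>(3) xx by (auto dest: inj_onD)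
      then have "x = 0" using a_inj[OF _ x1(2,1)] by simp
      then show ?thesis using \<phi>(2) a0 by simp
    qed
  qed
  let ?A = "(\<lambda>x. \<phi> (a x)) ` {0..\<eta>}"
  have connA: "connected ?A"
  proof (intro connected_continuous_image connected_Icc)
    show "continuous_on {0..\<eta>} (\<lambda>x. \<phi> (a x))"
      by (rule continuous_on_compose2[OF \<phi>(1) continuous_on_subset[OF a_cont]]) (use \<eta> aU in auto)
  qed
  have A0: "0 \<in> ?A" using \<phi>(2) a0 \<eta> by (intro image_eqI[of _ _ 0]) auto
  define r where "r = norm (\<phi> (a \<eta>))"
  have Ar: "\<phi> (a \<eta>) \<in> ?A" using \<eta> by auto
  have "r > 0"
  proof -
    have "\<phi> (a \<eta>) \<noteq> \<phi> (\<alpha> t)"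
    proof
      assume "\<phi> (a \<eta>) = \<phi> (\<alpha> t)"
      then have "a \<eta> = a 0" using inj_onD[OF \<phi>(3)] aU[of \<eta>] U(2) \<eta> a0 by simp
      then have "\<eta> = 0" by (rule a_inj) (use \<eta> in auto)
      then show False using \<eta> by simp
    qed
    then show ?thesis using \<phi>(2) by (simp add: r_def)
  qed
  obtain r1 where r1: "r1 > 0" "\<And>u. u \<in> U \<Longrightarrow> dist u (\<alpha> t) < r1 \<Longrightarrow> dist (\<phi> u) (\<phi> (\<alpha> t)) < r"
    using \<phi>(1) U(2) \<open>r > 0\<close> unfolding continuous_on_iff by metis
  obtain d where d: "d > 0" "\<And>z. 1 \<le> norm z \<Longrightarrow> dist z t < d \<Longrightarrow> dist (H \<alpha> z) (\<alpha> t) < min r0 r1"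
    using H_limit[OF \<alpha> t(1), of "min r0 r1"] r0(1) r1(1) by (metis min_less_iff_conj)
  obtain B \<delta> where B: "path_connected B" "B \<subseteq> exterior \<inter> ball t d" "\<delta> > 0" "exterior \<inter> ball t \<delta> \<subseteq> B"
    using exterior_half_ball[OF t(1) d(1)] by metis
  have HB: "H \<alpha> z \<in> U" "norm (\<phi> (H \<alpha> z)) < r" if "z \<in> B" for z
  proof -
    have z: "z \<in> exterior" "dist z t < d" using B(2) that by (auto simp: dist_commute)
    then have near: "dist (H \<alpha> z) (\<alpha> t) < min r0 r1" using d(2)[of z] by simp
    moreover have "H \<alpha> z \<in> S" using H_in[OF \<alpha> z(1)] by blast
    ultimately show "H \<alpha> z \<in> U" using r0(2) by (auto simp: dist_commute)
    then show "norm (\<phi> (H \<alpha> z)) < r" using r1(2)[of "H \<alpha> z"] near \<phi>(2) by simp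
  qed
  obtain p q where pq: "p \<in> exterior" "q \<in> exterior" "p \<noteq> q" "dist p t < \<delta>" "dist q t < \<delta>"
      "f (H \<alpha> p) = f (H \<alpha> q)"
    using pinched B(3) unfolding pinched_def flip_t by metis
  have pqB: "p \<in> B" "q \<in> B" using pq B(4) by (auto simp: dist_commute)
  obtain \<gamma> where \<gamma>: "path \<gamma>" "path_image \<gamma> \<subseteq> B" "pathstart \<gamma> = p" "pathfinish \<gamma> = q"
    using B(1) pqB unfolding path_connected_def by metis
  define \<Gamma> where "\<Gamma> = (\<lambda>z. \<phi> (H \<alpha> z)) \<circ> \<gamma>"
  have "continuous_on (path_image \<gamma>) (\<lambda>z. \<phi> (H \<alpha> z))"
    by (rule continuous_on_compose2[OF \<phi>(1) continuous_on_subset[OF H_cont[OF \<alpha>]]])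
      (use \<gamma>(2) B(2) HB(1) in \<open>auto simp: subset_iff less_imp_le\<close>)
  then have \<Gamma>: "path \<Gamma>" unfolding \<Gamma>_def using \<gamma>(1) by (intro path_continuous_image)
  have \<Gamma>_im: "path_image \<Gamma> = (\<lambda>z. \<phi> (H \<alpha> z)) ` path_image \<gamma>" by (simp add: \<Gamma>_def path_image_compose)
  have off_arc: "\<phi> (a x) \<noteq> \<phi> (H \<alpha> z)" if "\<bar>x\<bar> \<le> \<eta>" "z \<in> B" for x z
  proof
    assume "\<phi> (a x) = \<phi> (H \<alpha> z)"
    then have "a x = H \<alpha> z" using inj_onD[OF \<phi>(3)] aU[OF that(1)] HB(1)[OF that(2)] by blast
    moreover have "a x \<in> \<alpha> ` circle" by (rule aS) (use that \<eta> in auto)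
    moreover have "z \<in> exterior" using B(2) that(2) by blast
    ultimately show False using H_in[OF \<alpha>] by (metis DiffD2)
  qed
  show False
  proof (rule path_to_antipode_separates[OF \<Gamma> _ _ connA A0 Ar])
    have "H \<alpha> p \<noteq> H \<alpha> q" using H_inj[OF \<alpha> pq(1,2)] pq(3) by simp
    then have "\<phi> (H \<alpha> p) \<noteq> \<phi> (H \<alpha> q)" using inj_onD[OF \<phi>(3)] HB(1) pqB by blast
    then show "pathfinish \<Gamma> = - pathstart \<Gamma>"
      using \<phi>f[OF HB(1)[OF pqB(1)] HB(1)[OF pqB(2)]] pq(6) \<gamma>(3,4)
      by (simp add: \<Gamma>_def pathfinish_compose pathstart_compose)
    show "path_image \<Gamma> \<subseteq> ball 0 r" using HB(2) \<gamma>(2) by (auto simp: \<Gamma>_im)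
    show "r \<le> norm (\<phi> (a \<eta>))" by (simp add: r_def)
    fix w assume "w \<in> ?A"
    then obtain x where x: "0 \<le> x" "x \<le> \<eta>" "w = \<phi> (a x)" by auto
    have "\<phi> (a x) \<notin> path_image \<Gamma>" "\<phi> (a (- x)) \<notin> path_image \<Gamma>"
      using off_arc[of x] off_arc[of "- x"] \<gamma>(2) x by (auto simp: \<Gamma>_im)
    then show "w \<notin> path_image \<Gamma> \<and> - w \<notin> path_image \<Gamma>" using a_neg[of x] x by simp
  qed
qed

text \<open>Where \<open>t\<close> is not over the midpoint, the local deck transformation \<open>g \<circ> f\<close> carries a neighbourhood
  of \<open>\<alpha> t\<close> to one of \<open>\<alpha> (flip t)\<close> and points off the arc to points off the arc.\<close>

lemma folded_partner:
  assumes \<alpha>: "\<alpha> \<in> \<A>" and fold: "folded_by f \<alpha>" and t: "t \<in> circle" "Re t \<noteq> 0"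
    and V: "openin (top_of_set S) V" "homeomorphism U V f g" "\<alpha> (flip t) \<in> U" "U \<subseteq> S" and \<epsilon>: "\<epsilon> > 0"
  obtains \<delta> where "\<delta> > 0" "\<And>z. z \<in> exterior \<Longrightarrow> dist z t < \<delta> \<Longrightarrow> f (H \<alpha> z) \<in> V \<and>
     g (f (H \<alpha> z)) \<in> H \<alpha> ` (exterior \<inter> (ball (flip t) \<epsilon> \<union> ball (- t) \<epsilon>))"
proof -
  have ft: "flip t \<in> circle" using t(1) by simp
  have aS: "\<alpha> t \<in> S" using alpha_in_S \<alpha> t(1) by blast
  have fV: "f (\<alpha> t) \<in> V" using V(2,3) folded_eq[OF fold t(1)] by (metis homeomorphism_def imageI)
  have gf: "g (f (\<alpha> t)) = \<alpha> (flip t)" using V(2,3) folded_eq[OF fold t(1)] by (metis homeomorphism_apply1)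
  obtain r where r: "r > 0" "inj_on f (ball (\<alpha> t) r \<inter> S)"
    using locally_injective_atE[OF aS regular_locally_injective[OF aS folded_regular[OF \<alpha> t]]] by metis
  obtain d where d: "d > 0" "\<And>s. s \<in> circle \<Longrightarrow> dist s t < d \<or> dist s (cnj t) < d \<Longrightarrow> dist (\<alpha> s) (\<alpha> t) < r"
    using alpha_near_ball[OF \<alpha> t(1) r(1)] by metis
  obtain \<delta>1 where 1: "\<delta>1 > 0" "\<And>s. s \<in> circle \<Longrightarrow> dist (\<alpha> s) (\<alpha> (flip t)) < \<delta>1 \<Longrightarrow>
      dist s (flip t) < d \<or> dist s (cnj (flip t)) < d"
    using alpha_near[OF \<alpha> ft d(1)] by metis
  obtain \<delta>2 where 2: "\<delta>2 > 0" "\<And>x. x \<in> S - \<alpha> ` circle \<Longrightarrow> dist x (\<alpha> (flip t)) < \<delta>2 \<Longrightarrow>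
       \<exists>z \<in> exterior \<inter> (ball (flip t) \<epsilon> \<union> ball (cnj (flip t)) \<epsilon>). x = H \<alpha> z"
    using H_near[OF \<alpha> ft \<epsilon>] by metis
  obtain \<rho>1 where \<rho>1: "\<rho>1 > 0" "\<And>v. v \<in> V \<Longrightarrow> dist v (f (\<alpha> t)) < \<rho>1 \<Longrightarrow> dist (g v) (\<alpha> (flip t)) < min \<delta>1 \<delta>2"
    using homeomorphism_cont2[OF V(2)] fV 1(1) 2(1) unfolding continuous_on_iff
    by (metis gf min_less_iff_conj)
  obtain \<rho>2 where \<rho>2: "\<rho>2 > 0" "ball (f (\<alpha> t)) \<rho>2 \<inter> S \<subseteq> V" using openin_contains_ball V(1) fV by metis
  obtain \<delta>3 where 3: "\<delta>3 > 0" "\<And>z. z \<in> exterior \<Longrightarrow> dist z t < \<delta>3 \<Longrightarrow> dist (f (H \<alpha> z)) (f (\<alpha> t)) < min \<rho>1 \<rho>2"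
    using f_H_limit[OF \<alpha> t(1), of "min \<rho>1 \<rho>2"] \<rho>1(1) \<rho>2(1) by (metis min_less_iff_conj)
  obtain \<delta>4 where 4: "\<delta>4 > 0" "\<And>z. 1 \<le> norm z \<Longrightarrow> dist z t < \<delta>4 \<Longrightarrow> dist (H \<alpha> z) (\<alpha> t) < r"
    using H_limit[OF \<alpha> t(1) r(1)] by metis
  show thesis
  proof (rule that[of "min \<delta>3 \<delta>4"])
    show "0 < min \<delta>3 \<delta>4" using 3 4 by simp
    fix z assume z: "z \<in> exterior" "dist z t < min \<delta>3 \<delta>4"
    have Hz: "H \<alpha> z \<in> S - \<alpha> ` circle" using H_in \<alpha> z(1) by blast
    then have fS: "f (H \<alpha> z) \<in> S" using f_in_S by blast
    have near: "dist (f (H \<alpha> z)) (f (\<alpha> t)) < min \<rho>1 \<rho>2" using 3(2)[of z] z by simp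
    then have inV: "f (H \<alpha> z) \<in> V" using fS \<rho>2(2) by (auto simp: dist_commute)
    define u where "u = g (f (H \<alpha> z))"
    have u_near: "dist u (\<alpha> (flip t)) < min \<delta>1 \<delta>2" using \<rho>1(2)[OF inV] near by (simp add: u_def)
    have uU: "u \<in> U" "f u = f (H \<alpha> z)" using V(2) inV by (auto simp: u_def homeomorphism_def)
    have uS: "u \<in> S" using uU(1) V(4) by blast
    have "u \<noteq> \<alpha> s" if s: "s \<in> circle" for s
    proof
      assume eq: "u = \<alpha> s"
      then have "dist s (flip t) < d \<or> dist s (cnj (flip t)) < d" using 1(2)[OF s] u_near by simp
      then have "dist (flip s) t < d \<or> dist (flip s) (cnj t) < d"
        using dist_flip[of s "flip t"] dist_flip[of s "cnj (flip t)"] by simp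
      moreover have fs: "flip s \<in> circle" using s by simp
      ultimately have "dist (\<alpha> (flip s)) (\<alpha> t) < r" using d(2) by blast
      moreover have "f (\<alpha> (flip s)) = f (H \<alpha> z)" using folded_eq[OF fold s] eq uU(2) by simp
      moreover have "dist (H \<alpha> z) (\<alpha> t) < r" using 4(2)[of z] z by simp
      ultimately have "\<alpha> (flip s) = H \<alpha> z"
        using r(2) Hz alpha_in_S[OF \<alpha> fs] by (auto simp: inj_on_def dist_commute)
      then show False using Hz fs by (metis DiffD2 imageI)
    qed
    then have "u \<in> S - \<alpha> ` circle" using uS by blast
    then have "u \<in> H \<alpha> ` (exterior \<inter> (ball (flip t) \<epsilon> \<union> ball (- t) \<epsilon>))"
      using 2(2)[of u] u_near by (auto simp: image_iff)
    then show "f (H \<alpha> z) \<in> V \<and> g (f (H \<alpha> z)) \<in> H \<alpha> ` (exterior \<inter> (ball (flip t) \<epsilon> \<union> ball (- t) \<epsilon>))"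
      using inV by (simp add: u_def)
  qed
qed

text \<open>The deck transformation maps a connected one-sided neighbourhood of \<open>t\<close> to one side of the arc
  near \<open>\<alpha> (flip t)\<close>. One pinched pair shows which side this is, and then all nearby boundary points
  are pinched as well.\<close>

lemma pinched_open:
  assumes \<alpha>: "\<alpha> \<in> \<A>" and fold: "folded_by f \<alpha>" and t: "t \<in> half_circle \<tau>" "Re t \<noteq> 0"
    and pinched: "pinched \<alpha> t"
  shows "\<forall>\<^sub>F s in at t within half_circle \<tau>. pinched \<alpha> s"
proof -
  have tc: "t \<in> circle" and Imt: "Im t \<noteq> 0" using t by auto
  have ft: "flip t \<in> circle" "Re (flip t) \<noteq> 0" using tc t(2) by auto
  have aS: "\<alpha> (flip t) \<in> S" using alpha_in_S \<alpha> ft(1) by blast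
  obtain U V g where U: "openin (top_of_set S) U" "\<alpha> (flip t) \<in> U" "openin (top_of_set S) V" "homeomorphism U V f g"
    using regular_chart[OF aS folded_regular[OF \<alpha> ft]] by metis
  have US: "U \<subseteq> S" using U(1) openin_imp_subset by blast
  obtain r where r: "r > 0" "ball (\<alpha> (flip t)) r \<inter> S \<subseteq> U" using openin_contains_ball U(1,2) by metis
  let ?\<epsilon> = "\<bar>Im t\<bar>"
  have \<epsilon>: "?\<epsilon> > 0" using Imt by simp
  obtain \<delta> where \<delta>: "\<delta> > 0" "\<And>z. z \<in> exterior \<Longrightarrow> dist z t < \<delta> \<Longrightarrow> f (H \<alpha> z) \<in> V \<and>
     g (f (H \<alpha> z)) \<in> H \<alpha> ` (exterior \<inter> (ball (flip t) ?\<epsilon> \<union> ball (- t) ?\<epsilon>))"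
    using folded_partner[OF \<alpha> fold tc t(2) U(3,4,2) US \<epsilon>] by metis
  obtain B \<delta>' where B: "path_connected B" "B \<subseteq> exterior \<inter> ball t \<delta>" "\<delta>' > 0" "exterior \<inter> ball t \<delta>' \<subseteq> B"
    using exterior_half_ball[OF tc \<delta>(1)] by metis
  have B\<delta>: "z \<in> exterior" "dist z t < \<delta>" if "z \<in> B" for z using B(2) that by (auto simp: dist_commute)
  let ?C = "(\<lambda>z. g (f (H \<alpha> z))) ` B"
  have "continuous_on B (\<lambda>z. g (f (H \<alpha> z)))"
    by (rule continuous_on_compose2[OF homeomorphism_cont2[OF U(4)] f_H_cont[OF \<alpha>]]) (use B\<delta> \<delta>(2) in auto)
  then have connC: "connected ?C"
    by (intro connected_continuous_image path_connected_imp_connected B)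
  have C: "?C \<subseteq> H \<alpha> ` (exterior \<inter> (ball (flip t) ?\<epsilon> \<union> ball (- t) ?\<epsilon>))"
    by (rule image_subsetI) (use B\<delta> \<delta>(2) in blast)
  have disj: "ball (flip t) ?\<epsilon> \<inter> ball (- t) ?\<epsilon> = {}"
    using conjugate_balls_disjoint[of ?\<epsilon> "flip t"] by simp
  have sides: "?C \<subseteq> H \<alpha> ` (exterior \<inter> ball (flip t) ?\<epsilon>) \<or> ?C \<subseteq> H \<alpha> ` (exterior \<inter> ball (- t) ?\<epsilon>)"
    by (rule slit_side[OF \<alpha> connC C open_ball open_ball disj])
  obtain d where d: "d > 0" "\<And>z. 1 \<le> norm z \<Longrightarrow> dist z (flip t) < d \<Longrightarrow> dist (H \<alpha> z) (\<alpha> (flip t)) < r"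
    using H_limit[OF \<alpha> ft(1) r(1)] by metis
  have "Min {\<delta>', d, ?\<epsilon>} > 0" using B(3) d(1) \<epsilon> by simp
  then obtain p q where pq: "p \<in> exterior" "q \<in> exterior" "p \<noteq> q" "dist p t < Min {\<delta>', d, ?\<epsilon>}"
      "dist q (flip t) < Min {\<delta>', d, ?\<epsilon>}" "f (H \<alpha> p) = f (H \<alpha> q)"
    using pinched unfolding pinched_def by meson
  have pB: "p \<in> B" using pq B(4) by (auto simp: dist_commute)
  have "dist (H \<alpha> q) (\<alpha> (flip t)) < r" using d(2)[of q] pq by simp
  then have HqU: "H \<alpha> q \<in> U" using r(2) H_in[OF \<alpha> pq(2)] by (auto simp: dist_commute)
  have "g (f (H \<alpha> p)) = H \<alpha> q" using pq(6) HqU U(4) by (metis homeomorphism_apply1)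
  then have HqC: "H \<alpha> q \<in> ?C" using pB by (metis imageI)
  have "\<not> ?C \<subseteq> H \<alpha> ` (exterior \<inter> ball (- t) ?\<epsilon>)"
  proof
    assume "?C \<subseteq> H \<alpha> ` (exterior \<inter> ball (- t) ?\<epsilon>)"
    then obtain q' where "q' \<in> exterior" "q' \<in> ball (- t) ?\<epsilon>" "H \<alpha> q = H \<alpha> q'" using HqC by blast
    moreover then have "q = q'" using H_inj[OF \<alpha> pq(2)] by blast
    moreover have "q \<in> ball (flip t) ?\<epsilon>" using pq(5) by (simp add: dist_commute)
    ultimately show False using disj by blast
  qed
  then have C': "?C \<subseteq> H \<alpha> ` (exterior \<inter> ball (flip t) ?\<epsilon>)" using sides by blast
  obtain d' where d': "d' > 0" "\<And>s. s \<in> circle \<Longrightarrow> dist s (flip t) < d' \<Longrightarrow> dist (\<alpha> s) (\<alpha> (flip t)) < r"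
    using alpha_limit[OF \<alpha> ft(1) r(1)] by metis
  have "pinched \<alpha> s" if s: "s \<in> half_circle \<tau>" "dist s t < Min {\<delta>', d', \<bar>Re t\<bar>}" for s
    unfolding pinched_def
  proof (intro allI impI)
    fix \<epsilon>' :: real assume \<epsilon>': "\<epsilon>' > 0"
    have sc: "s \<in> circle" using s by auto
    have "\<bar>Re s - Re t\<bar> \<le> dist s t" using abs_Re_le_cmod[of "s - t"] by (simp add: dist_norm)
    then have Res: "Re s \<noteq> 0" using s(2) by auto
    have same: "0 < Im s * Im t" "Im s \<noteq> 0" using s(1) t(1) by (auto simp: zero_less_mult_iff)
    have fs: "flip s \<in> circle" using sc by simp
    have "dist (flip s) (flip t) < d'" using s(2) dist_flip[of s t] by simp
    then have "dist (\<alpha> (flip s)) (\<alpha> (flip t)) < r" using d'(2) fs by blast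
    then have sU: "\<alpha> (flip s) \<in> U" using r(2) alpha_in_S[OF \<alpha> fs] by (auto simp: dist_commute)
    define \<epsilon>2 where "\<epsilon>2 = Min {\<epsilon>', \<bar>Re s\<bar>, \<bar>Im s\<bar>}"
    have \<epsilon>2: "\<epsilon>2 > 0" "\<epsilon>2 \<le> \<epsilon>'" "\<epsilon>2 \<le> \<bar>Re s\<bar>" "\<epsilon>2 \<le> \<bar>Im s\<bar>" using \<epsilon>' Res same by (auto simp: \<epsilon>2_def)
    obtain \<delta>s where \<delta>s: "\<delta>s > 0" "\<And>z. z \<in> exterior \<Longrightarrow> dist z s < \<delta>s \<Longrightarrow> f (H \<alpha> z) \<in> V \<and>
       g (f (H \<alpha> z)) \<in> H \<alpha> ` (exterior \<inter> (ball (flip s) \<epsilon>2 \<union> ball (- s) \<epsilon>2))"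
      using folded_partner[OF \<alpha> fold sc Res U(3,4) sU US \<epsilon>2(1)] by metis
    have "Min {\<delta>s, \<epsilon>2, \<delta>' - dist s t} > 0" using \<delta>s(1) \<epsilon>2(1) s(2) by simp
    then obtain p where p: "p \<in> exterior" "dist p s < Min {\<delta>s, \<epsilon>2, \<delta>' - dist s t}"
      using exterior_near[OF sc] by metis
    have "dist p t < \<delta>'" using p(2) dist_triangle[of p t s] by simp
    then have pB: "p \<in> B" using p(1) B(4) by (auto simp: dist_commute)
    have "f (H \<alpha> p) \<in> V \<and> g (f (H \<alpha> p)) \<in> H \<alpha> ` (exterior \<inter> (ball (flip s) \<epsilon>2 \<union> ball (- s) \<epsilon>2))"
      using \<delta>s(2)[OF p(1)] p(2) by simp
    then obtain q where q: "f (H \<alpha> p) \<in> V" "q \<in> exterior" "g (f (H \<alpha> p)) = H \<alpha> q"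
        "q \<in> ball (flip s) \<epsilon>2 \<union> ball (- s) \<epsilon>2" by blast
    have "H \<alpha> q \<in> ?C" using q(3) pB by (metis imageI)
    then obtain q' where q': "q' \<in> exterior" "q' \<in> ball (flip t) ?\<epsilon>" "H \<alpha> q = H \<alpha> q'" using C' by blast
    then have "q = q'" using H_inj[OF \<alpha> q(2)] by blast
    then have "0 < Im q * Im t" using ball_same_side[OF q'(2)] by simp
    then have "0 < Im q * Im s" using same by (auto simp: zero_less_mult_iff)
    then have "q \<notin> ball (- s) \<epsilon>2" using ball_opposite_side[of q "flip s" \<epsilon>2] \<epsilon>2(4) by auto
    then have q_near: "dist q (flip s) < \<epsilon>2" using q(4) by (simp add: dist_commute)
    have "p \<noteq> q"
    proof
      assume "p = q"
      have "\<bar>Re p - Re s\<bar> < \<bar>Re s\<bar>"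
        using abs_Re_le_cmod[of "p - s"] p(2) \<epsilon>2(3) by (simp add: dist_norm)
      moreover have "\<bar>Re q + Re s\<bar> < \<bar>Re s\<bar>"
        using abs_Re_le_cmod[of "q - flip s"] q_near \<epsilon>2(3) by (simp add: dist_norm)
      ultimately show False using \<open>p = q\<close> by (auto simp: abs_if split: if_splits)
    qed
    moreover have "f (H \<alpha> p) = f (H \<alpha> q)" using q(1,3) U(4) by (metis homeomorphism_apply2)
    moreover have "dist p s < \<epsilon>'" "dist q (flip s) < \<epsilon>'" using p(2) q_near \<epsilon>2(2) by auto
    ultimately show "\<exists>p \<in> exterior. \<exists>q \<in> exterior. p \<noteq> q \<and>
      dist p s < \<epsilon>' \<and> dist q (flip s) < \<epsilon>' \<and> f (H \<alpha> p) = f (H \<alpha> q)"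
      using p(1) q(2) by blast
  qed
  moreover have "Min {\<delta>', d', \<bar>Re t\<bar>} > 0" using B(3) d'(1) t(2) by simp
  ultimately show ?thesis unfolding eventually_at by blast
qed

lemma not_pinched_open:
  assumes "\<not> pinched \<alpha> t"
  shows "\<forall>\<^sub>F s in at t within A. \<not> pinched \<alpha> s"
proof -
  obtain \<epsilon> where \<epsilon>: "\<epsilon> > 0" "\<not> (\<exists>p \<in> exterior. \<exists>q \<in> exterior. p \<noteq> q \<and>
    dist p t < \<epsilon> \<and> dist q (flip t) < \<epsilon> \<and> f (H \<alpha> p) = f (H \<alpha> q))"
    using assms unfolding pinched_def by blast
  have "\<not> pinched \<alpha> s" if s: "dist s t < \<epsilon> / 2" for s
  proof
    assume "pinched \<alpha> s"
    moreover have "\<epsilon> / 2 > 0" using \<epsilon> by simp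
    ultimately obtain p q where pq: "p \<in> exterior" "q \<in> exterior" "p \<noteq> q"
      "dist p s < \<epsilon> / 2" "dist q (flip s) < \<epsilon> / 2" "f (H \<alpha> p) = f (H \<alpha> q)"
      unfolding pinched_def by meson
    have "dist p t < \<epsilon>" using pq(4) s dist_triangle[of p t s] by simp
    moreover have "dist q (flip t) < \<epsilon>" using pq(5) s dist_triangle[of q "flip t" "flip s"] dist_flip[of s t] by simp
    ultimately show False using \<epsilon>(2) pq by blast
  qed
  then show ?thesis unfolding eventually_at using \<epsilon>(1) by (intro exI[of _ "\<epsilon> / 2"]) auto
qed

text \<open>Being pinched is locally constant on each open half circle, and it fails at the midpoint.\<close>

proposition not_pinched:
  assumes \<alpha>: "\<alpha> \<in> \<A>" and fold: "folded_by f \<alpha>" and t: "t \<in> circle" "Im t \<noteq> 0"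
  shows "\<not> pinched \<alpha> t"
proof -
  define \<tau> where "\<tau> = sgn (Im t)"
  have \<tau>: "\<tau> = 1 \<or> \<tau> = -1" using t by (auto simp: \<tau>_def sgn_if)
  have th: "t \<in> half_circle \<tau>" using t by (auto simp: \<tau>_def sgn_if)
  define m where "m = of_real \<tau> * \<i>"
  have m: "m \<in> half_circle \<tau>" "Re m = 0" using \<tau> by (auto simp: m_def)
  have "pinched \<alpha> t = pinched \<alpha> m"
  proof (rule connected_local_const[OF connected_half_circle[OF \<tau>] th m(1)], intro ballI)
    fix s assume s: "s \<in> half_circle \<tau>"
    show "\<forall>\<^sub>F s' in at s within half_circle \<tau>. pinched \<alpha> s = pinched \<alpha> s'"
    proof (cases "pinched \<alpha> s")
      case True
      then have "Re s \<noteq> 0" using not_pinched_midpoint[OF \<alpha> fold] s by blast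
      then show ?thesis using pinched_open[OF \<alpha> fold s] True by simp
    next
      case False
      then show ?thesis using not_pinched_open by simp
    qed
  qed
  then show ?thesis using not_pinched_midpoint[OF \<alpha> fold] m by blast
qed

lemma H_near_injective:
  assumes \<alpha>: "\<alpha> \<in> \<A>" and t: "t \<in> circle" "Re t \<noteq> 0" "Im t \<noteq> 0"
  obtains \<epsilon> where "\<epsilon> > 0" "\<And>z1 z2. 1 \<le> norm z1 \<Longrightarrow> 1 \<le> norm z2 \<Longrightarrow> dist z1 t < \<epsilon> \<Longrightarrow> dist z2 t < \<epsilon> \<Longrightarrow>
    f (H \<alpha> z1) = f (H \<alpha> z2) \<Longrightarrow> z1 = z2"
proof -
  have aS: "\<alpha> t \<in> S" using alpha_in_S \<alpha> t(1) by blast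
  obtain r where r: "r > 0" "inj_on f (ball (\<alpha> t) r \<inter> S)"
    using locally_injective_atE[OF aS regular_locally_injective[OF aS folded_regular[OF \<alpha> t(1,2)]]] by metis
  obtain \<delta> where \<delta>: "\<delta> > 0" "\<And>z. 1 \<le> norm z \<Longrightarrow> dist z t < \<delta> \<Longrightarrow> dist (H \<alpha> z) (\<alpha> t) < r"
    using H_limit[OF \<alpha> t(1) r(1)] by metis
  note HS = H_closed_in_S[OF \<alpha>]
  show thesis
  proof (rule that[of "min \<delta> \<bar>Im t\<bar>"])
    show "0 < min \<delta> \<bar>Im t\<bar>" using \<delta>(1) t(3) by simp
    fix z1 z2 assume z: "1 \<le> norm z1" "1 \<le> norm z2" "dist z1 t < min \<delta> \<bar>Im t\<bar>" "dist z2 t < min \<delta> \<bar>Im t\<bar>"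
      and eq: "f (H \<alpha> z1) = f (H \<alpha> z2)"
    have "H \<alpha> z1 = H \<alpha> z2"
      using inj_onD[OF r(2) eq] \<delta>(2) z HS by (simp add: dist_commute)
    moreover have "0 < Im z1 * Im t" "0 < Im z2 * Im t"
      using ball_same_side[of z1 t "\<bar>Im t\<bar>"] ball_same_side[of z2 t "\<bar>Im t\<bar>"] z by (auto simp: dist_commute)
    then have "0 < Im z1 * Im z2" by (auto simp: zero_less_mult_iff)
    ultimately show "z1 = z2" using H_inj_closed[OF \<alpha> z(1,2)] by blast
  qed
qed

text \<open>The coincidences of \<open>f \<circ> H \<alpha>\<close> that the new identification of \<open>t\<close> with \<open>flip t\<close> accounts for.\<close>

definition fold_related :: "complex \<Rightarrow> complex \<Rightarrow> bool"
  where "fold_related z1 z2 \<longleftrightarrow> z1 = z2 \<or> z1 \<in> circle \<and> z2 = flip z1"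

lemma folded_separation_off_midpoint:
  assumes \<alpha>: "\<alpha> \<in> \<A>" and fold: "folded_by f \<alpha>" and t: "t \<in> circle" "Im t \<noteq> 0" "Re t \<noteq> 0"
  obtains \<epsilon> where "\<epsilon> > 0" "\<And>z1 z2. 1 \<le> norm z1 \<Longrightarrow> 1 \<le> norm z2 \<Longrightarrow>
      dist z1 t < \<epsilon> \<or> dist z1 (flip t) < \<epsilon> \<Longrightarrow> dist z2 t < \<epsilon> \<or> dist z2 (flip t) < \<epsilon> \<Longrightarrow>
      f (H \<alpha> z1) = f (H \<alpha> z2) \<Longrightarrow> fold_related z1 z2"
proof -
  have ft: "flip t \<in> circle" "Re (flip t) \<noteq> 0" "Im (flip t) \<noteq> 0" using t by auto
  obtain \<epsilon>1 where inj1: "\<epsilon>1 > 0" "\<And>z1 z2. 1 \<le> norm z1 \<Longrightarrow> 1 \<le> norm z2 \<Longrightarrow> dist z1 t < \<epsilon>1 \<Longrightarrow> dist z2 t < \<epsilon>1 \<Longrightarrow>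
    f (H \<alpha> z1) = f (H \<alpha> z2) \<Longrightarrow> z1 = z2"
    using H_near_injective[OF \<alpha> t(1,3,2)] by metis
  obtain \<epsilon>2 where inj2: "\<epsilon>2 > 0" "\<And>z1 z2. 1 \<le> norm z1 \<Longrightarrow> 1 \<le> norm z2 \<Longrightarrow> dist z1 (flip t) < \<epsilon>2 \<Longrightarrow>
    dist z2 (flip t) < \<epsilon>2 \<Longrightarrow> f (H \<alpha> z1) = f (H \<alpha> z2) \<Longrightarrow> z1 = z2"
    using H_near_injective[OF \<alpha> ft] by metis
  obtain \<epsilon>3 where sep: "\<epsilon>3 > 0" "\<not> (\<exists>p \<in> exterior. \<exists>q \<in> exterior. p \<noteq> q \<and>
    dist p t < \<epsilon>3 \<and> dist q (flip t) < \<epsilon>3 \<and> f (H \<alpha> p) = f (H \<alpha> q))"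
    using not_pinched[OF \<alpha> fold t(1,2)] unfolding pinched_def by blast
  define \<epsilon> where "\<epsilon> = Min {\<epsilon>1, \<epsilon>2, \<epsilon>3}"
  have \<epsilon>: "\<epsilon> > 0" "\<epsilon> \<le> \<epsilon>1" "\<epsilon> \<le> \<epsilon>2" "\<epsilon> \<le> \<epsilon>3" using inj1(1) inj2(1) sep(1) by (auto simp: \<epsilon>_def)
  have fH_flip: "f (H \<alpha> (flip z)) = f (H \<alpha> z)" if "z \<in> circle" for z
    using folded_eq[OF fold that] H_circle[OF \<alpha> that] H_circle[OF \<alpha>, of "flip z"] that by simp
  have cross: "fold_related z1 z2" if z: "1 \<le> norm z1" "1 \<le> norm z2" "dist z1 t < \<epsilon>" "dist z2 (flip t) < \<epsilon>"
      and eq: "f (H \<alpha> z1) = f (H \<alpha> z2)" for z1 z2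
  proof -
    consider "z1 \<in> circle" | "z2 \<in> circle" | "z1 \<in> exterior" "z2 \<in> exterior" using z(1,2) by fastforce
    then show ?thesis
    proof cases
      case 1
      then have "f (H \<alpha> (flip z1)) = f (H \<alpha> z2)" using fH_flip eq by simp
      moreover have "dist (flip z1) (flip t) < \<epsilon>2" using z(3) \<epsilon> dist_flip[of z1 t] by simp
      ultimately have "flip z1 = z2" using inj2(2)[of "flip z1" z2] z \<epsilon> by simp
      then show ?thesis using 1 by (simp add: fold_related_def)
    next
      case 2
      then have "f (H \<alpha> z1) = f (H \<alpha> (flip z2))" using fH_flip eq by simp
      moreover have "dist (flip z2) t < \<epsilon>1" using z(4) \<epsilon> dist_flip[of z2 "flip t"] by simp
      ultimately have "z1 = flip z2" using inj1(2)[of z1 "flip z2"] z \<epsilon> by simp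
      then show ?thesis using 2 by (simp add: fold_related_def)
    next
      case 3
      then show ?thesis using sep(2) z eq \<epsilon> unfolding fold_related_def
        by (meson less_le_trans)
    qed
  qed
  show thesis
  proof (rule that[OF \<epsilon>(1)])
    fix z1 z2 assume z: "1 \<le> norm z1" "1 \<le> norm z2" and near: "dist z1 t < \<epsilon> \<or> dist z1 (flip t) < \<epsilon>"
      "dist z2 t < \<epsilon> \<or> dist z2 (flip t) < \<epsilon>" and eq: "f (H \<alpha> z1) = f (H \<alpha> z2)"
    consider "dist z1 t < \<epsilon>" "dist z2 t < \<epsilon>" | "dist z1 (flip t) < \<epsilon>" "dist z2 (flip t) < \<epsilon>"
      | "dist z1 t < \<epsilon>" "dist z2 (flip t) < \<epsilon>" | "dist z1 (flip t) < \<epsilon>" "dist z2 t < \<epsilon>" using near by blast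
    then show "fold_related z1 z2"
    proof cases
      case 1 then show ?thesis using inj1(2)[OF z] eq \<epsilon>
        by (simp add: fold_related_def)
    next
      case 2 then show ?thesis using inj2(2)[OF z] eq \<epsilon>
        by (simp add: fold_related_def)
    next
      case 3 then show ?thesis using cross z eq by blast
    next
      case 4
      then have "fold_related z2 z1" using cross z eq by metis
      then show ?thesis by (auto simp: fold_related_def)
    qed
  qed
qed

lemma folded_separation_at_midpoint:
  assumes \<alpha>: "\<alpha> \<in> \<A>" and fold: "folded_by f \<alpha>" and t: "t \<in> circle" "Im t \<noteq> 0" "Re t = 0"
  obtains \<epsilon> where "\<epsilon> > 0" "\<And>z1 z2. 1 \<le> norm z1 \<Longrightarrow> 1 \<le> norm z2 \<Longrightarrow> dist z1 t < \<epsilon> \<Longrightarrow> dist z2 t < \<epsilon> \<Longrightarrow>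
      f (H \<alpha> z1) = f (H \<alpha> z2) \<Longrightarrow> fold_related z1 z2"
proof -
  have flip_t: "flip t = t" using t(3) by (simp add: complex_eq_iff)
  obtain U \<phi> where U: "openin (top_of_set S) U" "\<alpha> t \<in> U" and \<phi>: "continuous_on U \<phi>"
    "(\<phi> :: 'a \<Rightarrow> complex) (\<alpha> t) = 0" "inj_on \<phi> U"
    and \<phi>f: "\<And>u v. u \<in> U \<Longrightarrow> v \<in> U \<Longrightarrow> f u = f v \<longleftrightarrow> \<phi> u = \<phi> v \<or> \<phi> u = - \<phi> v"
    using folded_midpoint_chart[OF \<alpha> fold t(1,3)] by metis
  obtain r where r: "r > 0" "ball (\<alpha> t) r \<inter> S \<subseteq> U" using openin_contains_ball U by metis
  obtain \<delta> where \<delta>: "\<delta> > 0" "\<And>z. 1 \<le> norm z \<Longrightarrow> dist z t < \<delta> \<Longrightarrow> dist (H \<alpha> z) (\<alpha> t) < r"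
    using H_limit[OF \<alpha> t(1) r(1)] by metis
  obtain \<epsilon>3 where sep: "\<epsilon>3 > 0" "\<not> (\<exists>p \<in> exterior. \<exists>q \<in> exterior. p \<noteq> q \<and>
    dist p t < \<epsilon>3 \<and> dist q t < \<epsilon>3 \<and> f (H \<alpha> p) = f (H \<alpha> q))"
    using not_pinched[OF \<alpha> fold t(1,2)] unfolding pinched_def flip_t by blast
  define \<epsilon> where "\<epsilon> = Min {\<delta>, \<bar>Im t\<bar>, \<epsilon>3}"
  have \<epsilon>: "\<epsilon> > 0" "\<epsilon> \<le> \<delta>" "\<epsilon> \<le> \<bar>Im t\<bar>" "\<epsilon> \<le> \<epsilon>3" using \<delta>(1) sep(1) t(2) by (auto simp: \<epsilon>_def)
  note HS = H_closed_in_S[OF \<alpha>]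
  have HU: "H \<alpha> z \<in> U" if "1 \<le> norm z" "dist z t < \<epsilon>" for z
    using \<delta>(2)[of z] that \<epsilon>(2) r(2) HS[of z] by (auto simp: dist_commute)
  have Hinj: "z1 = z2" if "1 \<le> norm z1" "1 \<le> norm z2" "dist z1 t < \<epsilon>" "dist z2 t < \<epsilon>" "H \<alpha> z1 = H \<alpha> z2" for z1 z2
  proof -
    have "0 < Im z1 * Im t" "0 < Im z2 * Im t"
      using ball_same_side[of z1 t \<epsilon>] ball_same_side[of z2 t \<epsilon>] that \<epsilon>(3) by (auto simp: dist_commute)
    then have "0 < Im z1 * Im z2" by (auto simp: zero_less_mult_iff)
    then show ?thesis using H_inj_closed[OF \<alpha> that(1,2) _ that(5)] by blast
  qed
  have circ: "fold_related s z" if s: "s \<in> circle" "dist s t < \<epsilon>" and z: "1 \<le> norm z" "dist z t < \<epsilon>"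
    and eq: "f (H \<alpha> s) = f (H \<alpha> z)" for s z
  proof -
    have s1: "1 \<le> norm s" using s(1) by simp
    have fs: "flip s \<in> circle" "1 \<le> norm (flip s)" "dist (flip s) t < \<epsilon>"
      using s dist_flip[of s t] flip_t by auto
    have feq: "f (H \<alpha> (flip s)) = f (H \<alpha> s)"
      using folded_eq[OF fold s(1)] H_circle[OF \<alpha> s(1)] H_circle[OF \<alpha> fs(1)] by simp
    note sU = HU[OF s1 s(2)] and fsU = HU[OF fs(2,3)] and zU = HU[OF z]
    have "\<phi> (H \<alpha> z) = \<phi> (H \<alpha> s) \<or> \<phi> (H \<alpha> z) = \<phi> (H \<alpha> (flip s))"
    proof (cases "\<phi> (H \<alpha> (flip s)) = - \<phi> (H \<alpha> s)")
      case True
      then show ?thesis using \<phi>f[OF zU sU] eq by simp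
    next
      case False
      then have "\<phi> (H \<alpha> (flip s)) = \<phi> (H \<alpha> s)" using \<phi>f[OF fsU sU] feq by simp
      then have "H \<alpha> (flip s) = H \<alpha> s" using inj_onD[OF \<phi>(3)] fsU sU by blast
      then have "flip s = s" using Hinj[OF fs(2) s1 fs(3) s(2)] by blast
      then have "Re s = 0" by (simp add: complex_eq_iff)
      then have "\<bar>Im s\<bar> = 1" "\<bar>Im t\<bar> = 1" using s(1) t by (auto simp: cmod_def)
      then have "Im s = Im t \<or> Im s = - Im t" by (auto simp: abs_if split: if_splits)
      then have "s = t \<or> s = cnj t" using \<open>Re s = 0\<close> t(3) by (auto simp: complex_eq_iff)
      then have "H \<alpha> s = \<alpha> t" using H_circle[OF \<alpha> s(1)] alpha_eq_iff[OF \<alpha> t(1) s(1)] by simp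
      then show ?thesis using \<phi>f[OF zU sU] eq \<phi>(2) by simp
    qed
    then have "H \<alpha> z = H \<alpha> s \<or> H \<alpha> z = H \<alpha> (flip s)"
      using inj_onD[OF \<phi>(3)] zU sU fsU by blast
    then have "z = s \<or> z = flip s" using Hinj z s1 s(2) fs by blast
    then show ?thesis using s(1) by (auto simp: fold_related_def)
  qed
  show thesis
  proof (rule that[OF \<epsilon>(1)])
    fix z1 z2 assume z: "1 \<le> norm z1" "1 \<le> norm z2" "dist z1 t < \<epsilon>" "dist z2 t < \<epsilon>"
      and eq: "f (H \<alpha> z1) = f (H \<alpha> z2)"
    consider "z1 \<in> circle" | "z2 \<in> circle" | "z1 \<in> exterior" "z2 \<in> exterior" using z(1,2) by fastforce
    then show "fold_related z1 z2"
    proof cases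
      case 1 then show ?thesis using circ z eq by blast
    next
      case 2
      then have "fold_related z2 z1" using circ z eq by metis
      then show ?thesis by (auto simp: fold_related_def)
    next
      case 3
      then show ?thesis using sep(2) z eq \<epsilon>(4) unfolding fold_related_def
        by (meson less_le_trans)
    qed
  qed
qed

text \<open>On one side of a folded arc, away from the tips, \<open>f\<close> separates points up to the new boundary
  identification. This gives local injectivity of the extension at \<open>c \<alpha> t\<close>.\<close>

proposition folded_separation:
  assumes \<alpha>: "\<alpha> \<in> \<A>" and fold: "folded_by f \<alpha>" and t: "t \<in> circle" "Im t \<noteq> 0"
  obtains \<epsilon> where "\<epsilon> > 0" "\<And>z1 z2. 1 \<le> norm z1 \<Longrightarrow> 1 \<le> norm z2 \<Longrightarrow>
      dist z1 t < \<epsilon> \<or> dist z1 (flip t) < \<epsilon> \<Longrightarrow> dist z2 t < \<epsilon> \<or> dist z2 (flip t) < \<epsilon> \<Longrightarrow>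
      f (H \<alpha> z1) = f (H \<alpha> z2) \<Longrightarrow> fold_related z1 z2"
proof (cases "Re t = 0")
  case True
  then have "flip t = t" by (simp add: complex_eq_iff)
  then show ?thesis using folded_separation_at_midpoint[OF \<alpha> fold t True] that by metis
next
  case False
  then show ?thesis using folded_separation_off_midpoint[OF \<alpha> fold t] that by metis
qed

section \<open>The continuous extension\<close>

text \<open>One of the two correspondences provided by \<open>unfolded_boundary_map\<close>.\<close>

definition boundary_map :: "(complex \<Rightarrow> 'a) \<Rightarrow> complex \<Rightarrow> complex"
  where "boundary_map \<alpha> = (SOME \<sigma>. (\<sigma> = id \<or> \<sigma> = cnj) \<and> (\<forall>t \<in> circle. \<forall>\<epsilon>>0. \<exists>\<delta>>0. \<forall>z \<in> exterior \<inter> ball t \<delta>.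
       f (H \<alpha> z) \<in> H (compose circle f \<alpha>) ` (exterior \<inter> ball (\<sigma> t) \<epsilon>)))"

lemma boundary_map:
  assumes \<alpha>: "\<alpha> \<in> \<A>" "unfolded \<alpha>"
  shows "boundary_map \<alpha> = id \<or> boundary_map \<alpha> = cnj"
    and "t \<in> circle \<Longrightarrow> \<epsilon> > 0 \<Longrightarrow> \<exists>\<delta>>0. \<forall>z \<in> exterior \<inter> ball t \<delta>.
       f (H \<alpha> z) \<in> H (compose circle f \<alpha>) ` (exterior \<inter> ball (boundary_map \<alpha> t) \<epsilon>)"
proof -
  let ?P = "\<lambda>\<sigma>. (\<sigma> = id \<or> \<sigma> = cnj) \<and> (\<forall>t \<in> circle. \<forall>\<epsilon>>0. \<exists>\<delta>>0. \<forall>z \<in> exterior \<inter> ball t \<delta>.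
       f (H \<alpha> z) \<in> H (compose circle f \<alpha>) ` (exterior \<inter> ball (\<sigma> t) \<epsilon>))"
  obtain \<sigma> where \<sigma>: "\<sigma> = id \<or> \<sigma> = cnj"
    "\<And>t \<epsilon>. t \<in> circle \<Longrightarrow> \<epsilon> > 0 \<Longrightarrow> \<exists>\<delta>>0. \<forall>z \<in> exterior \<inter> ball t \<delta>.
       f (H \<alpha> z) \<in> H (compose circle f \<alpha>) ` (exterior \<inter> ball (\<sigma> t) \<epsilon>)"
    using unfolded_boundary_map[OF \<alpha>] by metis
  then have "?P \<sigma>" by blast
  then have P: "?P (boundary_map \<alpha>)" unfolding boundary_map_def by (rule someI[of ?P])
  then show "boundary_map \<alpha> = id \<or> boundary_map \<alpha> = cnj" by blast
  from P show "t \<in> circle \<Longrightarrow> \<epsilon> > 0 \<Longrightarrow> \<exists>\<delta>>0. \<forall>z \<in> exterior \<inter> ball t \<delta>.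
       f (H \<alpha> z) \<in> H (compose circle f \<alpha>) ` (exterior \<inter> ball (boundary_map \<alpha> t) \<epsilon>)" by blast
qed

lemma boundary_map_circle:
  assumes "\<alpha> \<in> \<A>" "unfolded \<alpha>" "t \<in> circle"
  shows "boundary_map \<alpha> t \<in> circle"
  using boundary_map(1)[OF assms(1,2)] assms(3) by auto

lemma boundary_map_flip:
  assumes "\<alpha> \<in> \<A>" "unfolded \<alpha>"
  shows "boundary_map \<alpha> (flip t) = flip (boundary_map \<alpha> t)"
  using boundary_map(1)[OF assms] by auto

lemma boundary_map_inj:
  assumes "\<alpha> \<in> \<A>" "unfolded \<alpha>" "boundary_map \<alpha> s = boundary_map \<alpha> t"
  shows "s = t"
  using boundary_map(1)[OF assms(1,2)] assms(3) by auto

text \<open>The value of the extension at \<open>c \<alpha> t\<close>.\<close>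

definition arc_value :: "(complex \<Rightarrow> 'a) \<Rightarrow> complex \<Rightarrow> 'a"
  where "arc_value \<alpha> t = (if unfolded \<alpha> then c (compose circle f \<alpha>) (boundary_map \<alpha> t) else \<Phi> (f (\<alpha> t)))"

definition G :: "'a \<Rightarrow> 'a"
  where "G y = (if y \<in> Y then \<Phi> (f (inv_into X \<Phi> y))
    else case (SOME (\<alpha>, t). \<alpha> \<in> \<A> \<and> t \<in> circle \<and> y = c \<alpha> t) of (\<alpha>, t) \<Rightarrow> arc_value \<alpha> t)"

text \<open>The values at \<open>t\<close> and \<open>flip t\<close> have to agree, since \<open>c \<alpha> t = c \<alpha> (flip t)\<close>.\<close>

lemma arc_value_flip:
  assumes \<alpha>: "\<alpha> \<in> \<A>" "t \<in> circle"
  shows "arc_value \<alpha> (flip t) = arc_value \<alpha> t"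
proof (cases "unfolded \<alpha>")
  case True
  have b: "boundary_map \<alpha> t \<in> circle" "flip (boundary_map \<alpha> t) \<in> circle"
    using boundary_map_circle[OF \<alpha>(1) True \<alpha>(2)] by auto
  have "c (compose circle f \<alpha>) (flip (boundary_map \<alpha> t)) = c (compose circle f \<alpha>) (boundary_map \<alpha> t)"
    using beta_eq_iff[OF True b] by simp
  then show ?thesis using True boundary_map_flip[OF \<alpha>(1) True] by (simp add: arc_value_def)
next
  case False
  then show ?thesis using folded_eq[OF not_unfolded(1)[OF \<alpha>(1) False] \<alpha>(2)] by (simp add: arc_value_def)
qed

lemma G_regular: "x \<in> X \<Longrightarrow> G (\<Phi> x) = \<Phi> (f x)"
  using \<Phi>_in_Y[of x] \<Phi>_bij unfolding G_def bij_betw_def by (simp add: inv_into_f_f)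

lemma G_arc:
  assumes \<alpha>: "\<alpha> \<in> \<A>" "t \<in> circle"
  shows "G (c \<alpha> t) = arc_value \<alpha> t"
proof -
  let ?P = "\<lambda>(\<alpha>', t'). \<alpha>' \<in> \<A> \<and> t' \<in> circle \<and> c \<alpha> t = c \<alpha>' t'"
  define p where "p = (SOME p. ?P p)"
  have "?P (\<alpha>, t)" using \<alpha> by simp
  then have "?P p" unfolding p_def by (rule someI[of ?P])
  then obtain \<alpha>' t' where p: "p = (\<alpha>', t')" "\<alpha>' \<in> \<A>" "t' \<in> circle" "c \<alpha> t = c \<alpha>' t'" by (cases p) auto
  then have "\<alpha>' = \<alpha>" using beta_disjoint[OF \<alpha>(1) p(2) \<alpha>(2) p(3)] by simp
  moreover then have "t' = t \<or> t' = flip t" using beta_eq_iff[OF \<alpha> p(3)] p(4) by simp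
  ultimately have "arc_value \<alpha>' t' = arc_value \<alpha> t" using arc_value_flip[OF \<alpha>] by auto
  moreover have "c \<alpha> t \<notin> Y" using beta_notin_Y[OF \<alpha>] .
  ultimately show ?thesis using p(1) unfolding G_def p_def by (simp only: if_False) simp
qed

lemma \<Phi>_limit:
  assumes "x \<in> X" "\<epsilon> > 0"
  obtains \<delta> where "\<delta> > 0" "\<And>x'. x' \<in> X \<Longrightarrow> dist x' x < \<delta> \<Longrightarrow> dist (\<Phi> x') (\<Phi> x) < \<epsilon>"
  using \<Phi>_cont assms unfolding continuous_on_iff by metis

lemma arc_value_limit:
  assumes \<alpha>: "\<alpha> \<in> \<A>" "t \<in> circle" and \<epsilon>: "\<epsilon> > 0"
  obtains \<delta> where "\<delta> > 0" "\<And>z. z \<in> exterior \<Longrightarrow> dist z t < \<delta> \<Longrightarrow> H \<alpha> z \<in> X \<Longrightarrow>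
     dist (\<Phi> (f (H \<alpha> z))) (arc_value \<alpha> t) < \<epsilon>"
proof (cases "unfolded \<alpha>")
  case True
  let ?\<alpha>' = "compose circle f \<alpha>"
  obtain \<delta>' where \<delta>': "\<delta>' > 0" "\<forall>w \<in> exterior \<inter> ball (boundary_map \<alpha> t) \<delta>'. H ?\<alpha>' w \<notin> Im_paths \<A> \<longrightarrow>
      dist (\<Phi> (H ?\<alpha>' w)) (c ?\<alpha>' (boundary_map \<alpha> t)) < \<epsilon>"
    using \<Phi>_boundary[OF True boundary_map_circle[OF \<alpha>(1) True \<alpha>(2)] \<epsilon>] by blast
  obtain \<delta> where \<delta>: "\<delta> > 0" "\<forall>z \<in> exterior \<inter> ball t \<delta>. f (H \<alpha> z) \<in> H ?\<alpha>' ` (exterior \<inter> ball (boundary_map \<alpha> t) \<delta>')"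
    using boundary_map(2)[OF \<alpha>(1) True \<alpha>(2) \<delta>'(1)] by blast
  show thesis
  proof (rule that[OF \<delta>(1)])
    fix z assume z: "z \<in> exterior" "dist z t < \<delta>" "H \<alpha> z \<in> X"
    have "z \<in> exterior \<inter> ball t \<delta>" using z by (simp add: dist_commute)
    then obtain w where w: "w \<in> exterior \<inter> ball (boundary_map \<alpha> t) \<delta>'" "f (H \<alpha> z) = H ?\<alpha>' w" using \<delta>(2) by blast
    have "H ?\<alpha>' w \<notin> Im_paths \<A>" using f_in_X[OF z(3)] w(2) by simp
    then show "dist (\<Phi> (f (H \<alpha> z))) (arc_value \<alpha> t) < \<epsilon>"
      using \<delta>'(2) w True by (simp add: arc_value_def)
  qed
next
  case False
  obtain \<delta>1 where 1: "\<delta>1 > 0" "\<And>x'. x' \<in> X \<Longrightarrow> dist x' (f (\<alpha> t)) < \<delta>1 \<Longrightarrow> dist (\<Phi> x') (\<Phi> (f (\<alpha> t))) < \<epsilon>"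
    using \<Phi>_limit[OF not_unfolded(2)[OF \<alpha>(1) False \<alpha>(2)] \<epsilon>] by metis
  obtain \<delta> where \<delta>: "\<delta> > 0" "\<And>z. z \<in> exterior \<Longrightarrow> dist z t < \<delta> \<Longrightarrow> dist (f (H \<alpha> z)) (f (\<alpha> t)) < \<delta>1"
    using f_H_limit[OF \<alpha> 1(1)] by metis
  show thesis
    by (rule that[OF \<delta>(1)]) (use 1(2) \<delta>(2) f_in_X False in \<open>simp add: arc_value_def\<close>)
qed

text \<open>A point \<open>\<Phi> x\<close> near \<open>c \<alpha> t\<close> has its slit coordinate near \<open>t\<close> or \<open>flip t\<close>, and along both the values
  tend to \<open>arc_value \<alpha> t\<close>.\<close>

lemma G_limit:
  assumes y: "y \<in> S" and \<epsilon>: "\<epsilon> > 0"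
  shows "\<exists>\<delta>>0. \<forall>x\<in>X. dist (\<Phi> x) y < \<delta> \<longrightarrow> dist (\<Phi> (f x)) (G y) < \<epsilon>"
  using y
proof (cases rule: S_cases_target)
  case (1 x0)
  obtain \<delta>1 where \<delta>1: "\<delta>1 > 0" "\<And>x'. x' \<in> X \<Longrightarrow> dist x' (f x0) < \<delta>1 \<Longrightarrow> dist (\<Phi> x') (\<Phi> (f x0)) < \<epsilon>"
    using \<Phi>_limit[OF f_in_X[OF 1(1)] \<epsilon>] by metis
  have "x0 \<in> S" using 1(1) by simp
  obtain \<delta>2 where \<delta>2: "\<delta>2 > 0" "\<And>x'. x' \<in> S \<Longrightarrow> dist x' x0 < \<delta>2 \<Longrightarrow> dist (f x') (f x0) < \<delta>1"
    using f_limit[OF \<open>x0 \<in> S\<close> \<delta>1(1)] by metis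
  obtain \<delta> where \<delta>: "\<delta> > 0" "\<And>x. x \<in> X \<Longrightarrow> dist (\<Phi> x) (\<Phi> x0) < \<delta> \<Longrightarrow> dist x x0 < \<delta>2"
    using \<Phi>_inverse_limit_regular[OF 1(1) \<delta>2(1)] by metis
  have "dist (\<Phi> (f x)) (G y) < \<epsilon>" if "x \<in> X" "dist (\<Phi> x) y < \<delta>" for x
    using \<delta>(2)[of x] \<delta>2(2)[of x] \<delta>1(2)[of "f x"] f_in_X[of x] that G_regular[OF 1(1)] 1(2) by simp
  then show ?thesis using \<delta>(1) by blast
next
  case (2 \<alpha> t)
  have ft: "flip t \<in> circle" using 2(2) by simp
  obtain \<delta>1 where \<delta>1: "\<delta>1 > 0" "\<And>z. z \<in> exterior \<Longrightarrow> dist z t < \<delta>1 \<Longrightarrow> H \<alpha> z \<in> X \<Longrightarrow>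
     dist (\<Phi> (f (H \<alpha> z))) (arc_value \<alpha> t) < \<epsilon>"
    using arc_value_limit[OF 2(1,2) \<epsilon>] by metis
  obtain \<delta>2 where \<delta>2: "\<delta>2 > 0" "\<And>z. z \<in> exterior \<Longrightarrow> dist z (flip t) < \<delta>2 \<Longrightarrow> H \<alpha> z \<in> X \<Longrightarrow>
     dist (\<Phi> (f (H \<alpha> z))) (arc_value \<alpha> t) < \<epsilon>"
    using arc_value_limit[OF 2(1) ft \<epsilon>] arc_value_flip[OF 2(1,2)] by metis
  have "min \<delta>1 \<delta>2 > 0" using \<delta>1(1) \<delta>2(1) by simp
  then obtain \<delta> where \<delta>: "\<delta> > 0" "\<And>x. x \<in> X \<Longrightarrow> dist (\<Phi> x) (c \<alpha> t) < \<delta> \<Longrightarrow>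
     x \<in> H \<alpha> ` (exterior \<inter> (ball t (min \<delta>1 \<delta>2) \<union> ball (flip t) (min \<delta>1 \<delta>2)))"
    using \<Phi>_inverse_limit_arc[OF 2(1,2)] by metis
  have "dist (\<Phi> (f x)) (G y) < \<epsilon>" if x: "x \<in> X" "dist (\<Phi> x) y < \<delta>" for x
  proof -
    obtain z where z: "z \<in> exterior" "z \<in> ball t (min \<delta>1 \<delta>2) \<union> ball (flip t) (min \<delta>1 \<delta>2)" "x = H \<alpha> z"
      using \<delta>(2)[OF x(1)] x(2) 2(3) by blast
    have "dist z t < \<delta>1 \<or> dist z (flip t) < \<delta>2" using z(2) by (auto simp: dist_commute)
    then show ?thesis using \<delta>1(2)[of z] \<delta>2(2)[of z] z x(1) G_arc[OF 2(1,2)] 2(3) by auto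
  qed
  then show ?thesis using \<delta>(1) by blast
qed

lemma G_continuous: "continuous_on S G"
proof (rule continuous_on_from_dense[where D = Y])
  fix y and \<epsilon> :: real assume *: "y \<in> S" "\<epsilon> > 0"
  show "\<exists>d\<in>Y. dist d y < \<epsilon>" using Y_dense[OF *] \<Phi>_in_Y by metis
  obtain \<delta> where \<delta>: "\<delta> > 0" "\<forall>x\<in>X. dist (\<Phi> x) y < \<delta> \<longrightarrow> dist (\<Phi> (f x)) (G y) < \<epsilon>" using G_limit[OF *] by blast
  have "dist (G d) (G y) < \<epsilon>" if d: "d \<in> Y" "dist d y < \<delta>" for d
  proof -
    obtain x where "x \<in> X" "d = \<Phi> x" using d(1) \<Phi>_bij unfolding bij_betw_def by blast
    then show ?thesis using \<delta>(2) d(2) G_regular by simp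
  qed
  then show "\<exists>\<delta>>0. \<forall>d\<in>Y. dist d y < \<delta> \<longrightarrow> dist (G d) (G y) < \<epsilon>" using \<delta>(1) by blast
qed

lemma G_in_S: "y \<in> S \<Longrightarrow> G y \<in> S"
proof -
  assume "y \<in> S"
  then show "G y \<in> S"
  proof (cases rule: S_cases_target)
    case (1 x)
    then show ?thesis using G_regular[OF 1(1)] \<Phi>_in_Y[OF f_in_X[OF 1(1)]] by simp
  next
    case (2 \<alpha> t)
    show ?thesis
    proof (cases "unfolded \<alpha>")
      case True
      then show ?thesis using beta_in_S[OF True boundary_map_circle[OF 2(1) True 2(2)]] G_arc[OF 2(1,2)] 2(3)
        by (simp add: arc_value_def)
    next
      case False
      then show ?thesis using \<Phi>_in_Y[OF not_unfolded(2)[OF 2(1) False 2(2)]] G_arc[OF 2(1,2)] 2(3)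
        by (simp add: arc_value_def)
    qed
  qed
qed

text \<open>The correspondence between the two spheres that \<open>\<Phi>\<close> induces: single points correspond to single
  points, and every point of an \<open>\<alpha>\<close>-arc to every point of its \<open>\<beta>\<close>-arc. It makes it possible to treat
  points and small arcs alike when \<open>G\<close> is compared with \<open>f\<close>.\<close>

definition lies_over :: "'a \<Rightarrow> 'a \<Rightarrow> bool"
  where "lies_over x y \<longleftrightarrow> x \<in> X \<and> \<Phi> x = y \<or> (\<exists>\<alpha>\<in>\<A>. x \<in> \<alpha> ` circle \<and> y \<in> c \<alpha> ` circle)"

lemma lies_over_regular: "x0 \<in> X \<Longrightarrow> lies_over x (\<Phi> x0) \<Longrightarrow> x = x0"
  unfolding lies_over_def using \<Phi>_inj \<Phi>_in_Y beta_notin_Y by (metis imageE)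

lemma regular_lies_over: "x \<in> X \<Longrightarrow> lies_over x y \<Longrightarrow> y = \<Phi> x"
  unfolding lies_over_def using alpha_notin_X by (metis imageE)

lemma lies_over_arc: "\<alpha> \<in> \<A> \<Longrightarrow> s \<in> circle \<Longrightarrow> t \<in> circle \<Longrightarrow> lies_over (\<alpha> s) (c \<alpha> t)"
  unfolding lies_over_def by blast

lemma lies_over_in_S: "lies_over x y \<Longrightarrow> x \<in> S"
  unfolding lies_over_def using alpha_in_S by blast

lemma common_lies_over:
  assumes "lies_over x y1" "lies_over x y2"
  shows "y1 = y2 \<or> (\<exists>\<alpha>\<in>\<A>. x \<in> \<alpha> ` circle \<and> y1 \<in> c \<alpha> ` circle \<and> y2 \<in> c \<alpha> ` circle)"
proof (cases "x \<in> X")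
  case True
  then show ?thesis using regular_lies_over assms by metis
next
  case False
  then obtain \<alpha>1 \<alpha>2 where a: "\<alpha>1 \<in> \<A>" "x \<in> \<alpha>1 ` circle" "y1 \<in> c \<alpha>1 ` circle"
    "\<alpha>2 \<in> \<A>" "x \<in> \<alpha>2 ` circle" "y2 \<in> c \<alpha>2 ` circle"
    using assms unfolding lies_over_def by blast
  moreover then have "\<alpha>1 = \<alpha>2" using alpha_disjoint by blast
  ultimately show ?thesis by blast
qed

lemma G_cases:
  assumes "y \<in> S"
  obtains (regular) x where "lies_over x y" "f x \<in> X" "G y = \<Phi> (f x)"
  | (arc) \<alpha> t where "\<alpha> \<in> \<A>" "unfolded \<alpha>" "t \<in> circle" "y = c \<alpha> t"
      "G y = c (compose circle f \<alpha>) (boundary_map \<alpha> t)"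
  using assms
proof (cases rule: S_cases_target)
  case (1 x)
  show ?thesis
    by (rule that(1)[of x]) (use 1 G_regular f_in_X in \<open>auto simp: lies_over_def\<close>)
next
  case (2 \<alpha> t)
  show ?thesis
  proof (cases "unfolded \<alpha>")
    case True
    then show ?thesis using that(2)[OF 2(1) True 2(2,3)] G_arc[OF 2(1,2)] 2(3) by (simp add: arc_value_def)
  next
    case False
    then show ?thesis
      using that(1)[of "\<alpha> t"] lies_over_arc[OF 2(1,2,2)] not_unfolded(2)[OF 2(1) False 2(2)] G_arc[OF 2(1,2)] 2(3)
      by (simp add: arc_value_def)
  qed
qed

text \<open>Coincidences of \<open>G\<close> come from coincidences of \<open>f\<close>; for two unfolded arcs with the same image
  arc, any common parameter gives one.\<close>

lemma G_eq_lies_over: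
  assumes y: "y1 \<in> S" "y2 \<in> S" and eq: "G y1 = G y2"
  obtains x1 x2 where "lies_over x1 y1" "lies_over x2 y2" "f x1 = f x2"
  using y(1)
proof (cases rule: G_cases)
  case r1: (regular x1)
  show ?thesis using y(2)
  proof (cases rule: G_cases)
    case r2: (regular x2)
    have "f x1 = f x2" using \<Phi>_inj[OF r1(2) r2(2)] eq r1(3) r2(3) by simp
    then show ?thesis using that r1(1) r2(1) by blast
  next
    case a2: (arc \<alpha> t)
    then show ?thesis using beta_notin_Y[OF a2(2) boundary_map_circle[OF a2(1-3)]] \<Phi>_in_Y[OF r1(2)] eq r1(3) by simp
  qed
next
  case a1: (arc \<alpha>1 t1)
  show ?thesis using y(2)
  proof (cases rule: G_cases)
    case r2: (regular x2)
    then show ?thesis using beta_notin_Y[OF a1(2) boundary_map_circle[OF a1(1-3)]] \<Phi>_in_Y[OF r2(2)] eq a1(5) by simp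
  next
    case a2: (arc \<alpha>2 t2)
    have "compose circle f \<alpha>1 = compose circle f \<alpha>2"
      by (rule beta_disjoint[OF a1(2) a2(2) boundary_map_circle[OF a1(1-3)] boundary_map_circle[OF a2(1-3)]])
        (use eq a1(5) a2(5) in simp)
    moreover have one: "(1::complex) \<in> circle" by simp
    ultimately have "f (\<alpha>1 1) = f (\<alpha>2 1)" by (metis compose_eq)
    moreover have "lies_over (\<alpha>1 1) y1" "lies_over (\<alpha>2 1) y2"
      using lies_over_arc[OF a1(1) one a1(3)] lies_over_arc[OF a2(1) one a2(3)] a1(4) a2(4) by simp_all
    ultimately show ?thesis using that by blast
  qed
qed

lemma G_inj_unfolded:
  assumes \<alpha>: "\<alpha> \<in> \<A>" "unfolded \<alpha>" and t: "s \<in> circle" "t \<in> circle" and eq: "G (c \<alpha> s) = G (c \<alpha> t)"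
  shows "c \<alpha> s = c \<alpha> t"
proof -
  have "c (compose circle f \<alpha>) (boundary_map \<alpha> s) = c (compose circle f \<alpha>) (boundary_map \<alpha> t)"
    using eq G_arc[OF \<alpha>(1)] t \<alpha>(2) by (simp add: arc_value_def)
  then have "boundary_map \<alpha> t = boundary_map \<alpha> s \<or> boundary_map \<alpha> t = boundary_map \<alpha> (flip s)"
    using beta_eq_iff[OF \<alpha>(2) boundary_map_circle[OF \<alpha> t(1)] boundary_map_circle[OF \<alpha> t(2)]]
      boundary_map_flip[OF \<alpha>] by simp
  then have "t = s \<or> t = flip s" using boundary_map_inj[OF \<alpha>] by blast
  then show ?thesis using beta_eq_iff[OF \<alpha>(1) t] by simp
qed

text \<open>A folded arc would contribute its midpoint, where \<open>f\<close> is not locally injective.\<close>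

lemma locally_injective_arc_unfolded:
  assumes \<alpha>: "\<alpha> \<in> \<A>" and inj: "\<And>t. t \<in> circle \<Longrightarrow> locally_injective_at S f (\<alpha> t)"
  shows "unfolded \<alpha>"
proof (rule ccontr)
  assume "\<not> unfolded \<alpha>"
  then have "folded_by f \<alpha>" using not_unfolded(1)[OF \<alpha>] by blast
  then show False using folded_midpoint[OF \<alpha>, of \<i>] inj[of \<i>] by simp
qed

text \<open>Points of \<open>W\<close> with the same value under \<open>G\<close> have a common point over them, so they coincide or lie on
  one arc. That arc lies in \<open>N\<close>, where \<open>f\<close> is injective; hence it is unfolded, and \<open>G\<close> is injective
  on its reglued counterpart.\<close>

lemma G_inj_on:
  assumes W: "W \<subseteq> S" and N: "inj_on f N" "\<And>y x. y \<in> W \<Longrightarrow> lies_over x y \<Longrightarrow> x \<in> N"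
  shows "inj_on G W"
proof (rule inj_onI)
  fix y1 y2 assume y: "y1 \<in> W" "y2 \<in> W" and eq: "G y1 = G y2"
  have yS: "y1 \<in> S" "y2 \<in> S" using y W by auto
  obtain x1 x2 where x: "lies_over x1 y1" "lies_over x2 y2" "f x1 = f x2"
    using G_eq_lies_over[OF yS eq] by metis
  have "x1 = x2" using inj_onD[OF N(1) x(3)] N(2) y x(1,2) by blast
  then consider "y1 = y2" | \<alpha> where "\<alpha> \<in> \<A>" "y1 \<in> c \<alpha> ` circle" "y2 \<in> c \<alpha> ` circle"
    using common_lies_over[of x1 y1 y2] x by blast
  then show "y1 = y2"
  proof cases
    case (2 \<alpha>)
    then obtain t1 t2 where t: "t1 \<in> circle" "y1 = c \<alpha> t1" "t2 \<in> circle" "y2 = c \<alpha> t2" by blast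
    have "unfolded \<alpha>"
    proof (rule ccontr)
      assume "\<not> unfolded \<alpha>"
      then have "f (\<alpha> (flip 1)) = f (\<alpha> 1)" using folded_eq[OF not_unfolded(1)[OF 2(1)], of 1] by simp
      moreover have "\<alpha> s \<in> N" if "s \<in> circle" for s
        using N(2)[OF y(1)] lies_over_arc[OF 2(1) that t(1)] t(2) by simp
      ultimately have "\<alpha> (flip 1) = \<alpha> 1" using inj_onD[OF N(1)] by simp
      then show False using alpha_eq_iff[OF 2(1), of "flip 1" 1] by simp
    qed
    then show ?thesis using G_inj_unfolded[OF 2(1) _ t(1,3)] eq t(2,4) by simp
  qed
qed

lemma lies_over_near_regular:
  assumes x0: "x0 \<in> X" and \<epsilon>: "\<epsilon> > 0"
  obtains \<delta> where "\<delta> > 0" "\<And>y x. y \<in> S \<Longrightarrow> dist y (\<Phi> x0) < \<delta> \<Longrightarrow> lies_over x y \<Longrightarrow> dist x x0 < \<epsilon>"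
proof -
  obtain \<delta>1 where d1: "\<delta>1 > 0" "\<And>x. x \<in> X \<Longrightarrow> dist (\<Phi> x) (\<Phi> x0) < \<delta>1 \<Longrightarrow> dist x x0 < \<epsilon>"
    using \<Phi>_inverse_limit_regular[OF assms] by metis
  obtain \<delta>2 where d2: "\<delta>2 > 0" "\<And>\<alpha> t. \<alpha> \<in> \<A> \<Longrightarrow> t \<in> circle \<Longrightarrow> dist (c \<alpha> t) (\<Phi> x0) < \<delta>2 \<Longrightarrow>
     \<alpha> ` circle \<subseteq> ball x0 \<epsilon>"
    using arcs_near_regular[OF assms] by metis
  show thesis
  proof (rule that[of "min \<delta>1 \<delta>2"])
    show "0 < min \<delta>1 \<delta>2" using d1(1) d2(1) by simp
    fix y x assume y: "y \<in> S" "dist y (\<Phi> x0) < min \<delta>1 \<delta>2" "lies_over x y"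
    from y(3) consider "x \<in> X" "\<Phi> x = y" | \<alpha> t where "\<alpha> \<in> \<A>" "x \<in> \<alpha> ` circle" "t \<in> circle" "y = c \<alpha> t"
      unfolding lies_over_def by blast
    then show "dist x x0 < \<epsilon>"
    proof cases
      case 1 then show ?thesis using d1(2)[of x] y(2) by simp
    next
      case (2 \<alpha> t)
      then have "x \<in> ball x0 \<epsilon>" using d2(2)[OF 2(1,3)] y(2) by auto
      then show ?thesis by (simp add: dist_commute)
    qed
  qed
qed

lemma lies_over_near_arc:
  assumes \<alpha>0: "\<alpha>0 \<in> \<A>" and t0: "t0 \<in> circle" and \<epsilon>: "\<epsilon> > 0"
  obtains \<delta> where "\<delta> > 0" "\<And>y x. y \<in> S - c \<alpha>0 ` circle \<Longrightarrow> dist y (c \<alpha>0 t0) < \<delta> \<Longrightarrow> lies_over x y \<Longrightarrow>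
     x \<in> H \<alpha>0 ` (exterior \<inter> (ball t0 \<epsilon> \<union> ball (flip t0) \<epsilon>))"
proof -
  let ?N = "H \<alpha>0 ` (exterior \<inter> (ball t0 \<epsilon> \<union> ball (flip t0) \<epsilon>))"
  obtain \<delta>1 where d1: "\<delta>1 > 0" "\<And>x. x \<in> X \<Longrightarrow> dist (\<Phi> x) (c \<alpha>0 t0) < \<delta>1 \<Longrightarrow> x \<in> ?N"
    using \<Phi>_inverse_limit_arc[OF assms] by metis
  obtain \<delta>2 where d2: "\<delta>2 > 0" "\<And>\<alpha> t. \<alpha> \<in> \<A> \<Longrightarrow> \<alpha> \<noteq> \<alpha>0 \<Longrightarrow> t \<in> circle \<Longrightarrow>
     dist (c \<alpha> t) (c \<alpha>0 t0) < \<delta>2 \<Longrightarrow> \<alpha> ` circle \<subseteq> ?N"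
    using arcs_near_arc[OF assms] by metis
  show thesis
  proof (rule that[of "min \<delta>1 \<delta>2"])
    show "0 < min \<delta>1 \<delta>2" using d1(1) d2(1) by simp
    fix y x assume y: "y \<in> S - c \<alpha>0 ` circle" "dist y (c \<alpha>0 t0) < min \<delta>1 \<delta>2" "lies_over x y"
    from y(3) consider "x \<in> X" "\<Phi> x = y" | \<alpha> t where "\<alpha> \<in> \<A>" "x \<in> \<alpha> ` circle" "t \<in> circle" "y = c \<alpha> t"
      unfolding lies_over_def by blast
    then show "x \<in> ?N"
    proof cases
      case 1 then show ?thesis using d1(2)[of x] y(2) by simp
    next
      case (2 \<alpha> t)
      then have "\<alpha> \<noteq> \<alpha>0" using y(1) by blast
      then show ?thesis using d2(2)[OF 2(1) _ 2(3)] y(2) 2(2,4) by auto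
    qed
  qed
qed

section \<open>Local injectivity of the extension\<close>

lemma openin_ball: "openin (top_of_set S) (S \<inter> ball y r)"
  by blast

lemma G_locally_injective_regular:
  assumes x0: "x0 \<in> X" and inj: "locally_injective_at S f x0"
  shows "locally_injective_at S G (\<Phi> x0)"
proof -
  have x0S: "x0 \<in> S" using x0 by simp
  obtain r where r: "r > 0" "inj_on f (ball x0 r \<inter> S)" using locally_injective_atE[OF x0S inj] by metis
  obtain \<delta> where \<delta>: "\<delta> > 0" "\<And>y x. y \<in> S \<Longrightarrow> dist y (\<Phi> x0) < \<delta> \<Longrightarrow> lies_over x y \<Longrightarrow> dist x x0 < r"
    using lies_over_near_regular[OF x0 r(1)] by metis
  have "inj_on G (S \<inter> ball (\<Phi> x0) \<delta>)"
  proof (rule G_inj_on[OF _ r(2)])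
    fix y x assume "y \<in> S \<inter> ball (\<Phi> x0) \<delta>" "lies_over x y"
    then show "x \<in> ball x0 r \<inter> S" using \<delta>(2)[of y x] lies_over_in_S by (auto simp: dist_commute)
  qed blast
  moreover have "\<Phi> x0 \<in> S \<inter> ball (\<Phi> x0) \<delta>" using \<Phi>_in_Y[OF x0] \<delta>(1) by simp
  ultimately show ?thesis unfolding locally_injective_at_def using openin_ball by blast
qed

text \<open>Common to both kinds of arcs. Near \<open>c \<alpha>0 t0\<close>, everything off the \<open>\<beta>\<close>-arc lies over slit
  coordinates close to \<open>t0\<close> or \<open>flip t0\<close>; \<open>sep\<close> handles two such points, as well as one of them and a
  point of the \<open>\<beta>\<close>-arc, and \<open>arc\<close> handles two points of the \<open>\<beta>\<close>-arc.\<close>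

lemma G_locally_injective_near_arc:
  assumes \<alpha>0: "\<alpha>0 \<in> \<A>" and t0: "t0 \<in> circle" and \<epsilon>: "\<epsilon> > 0"
    and sep: "\<And>z w. z \<in> exterior \<Longrightarrow> 1 \<le> norm w \<Longrightarrow> dist z t0 < \<epsilon> \<or> dist z (flip t0) < \<epsilon> \<Longrightarrow>
      dist w t0 < \<epsilon> \<or> dist w (flip t0) < \<epsilon> \<Longrightarrow> f (H \<alpha>0 z) = f (H \<alpha>0 w) \<Longrightarrow> z = w"
    and arc: "\<And>s t. s \<in> circle \<Longrightarrow> t \<in> circle \<Longrightarrow> dist s t0 < \<epsilon> \<or> dist s (flip t0) < \<epsilon> \<Longrightarrow>
      dist t t0 < \<epsilon> \<or> dist t (flip t0) < \<epsilon> \<Longrightarrow> G (c \<alpha>0 s) = G (c \<alpha>0 t) \<Longrightarrow> c \<alpha>0 s = c \<alpha>0 t"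
  shows "locally_injective_at S G (c \<alpha>0 t0)"
proof -
  let ?near = "ball t0 \<epsilon> \<union> ball (flip t0) \<epsilon>"
  obtain \<delta>1 where d1: "\<delta>1 > 0" "\<And>y x. y \<in> S - c \<alpha>0 ` circle \<Longrightarrow> dist y (c \<alpha>0 t0) < \<delta>1 \<Longrightarrow> lies_over x y \<Longrightarrow>
     x \<in> H \<alpha>0 ` (exterior \<inter> ?near)"
    using lies_over_near_arc[OF \<alpha>0 t0 \<epsilon>] by metis
  obtain \<delta>2 where d2: "\<delta>2 > 0"
    "\<And>t. t \<in> circle \<Longrightarrow> dist (c \<alpha>0 t) (c \<alpha>0 t0) < \<delta>2 \<Longrightarrow> dist t t0 < \<epsilon> \<or> dist t (flip t0) < \<epsilon>"
    using beta_near[OF \<alpha>0 t0 \<epsilon>] by metis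
  define W where "W = S \<inter> ball (c \<alpha>0 t0) (min \<delta>1 \<delta>2)"
  have off: "inj_on G (W - c \<alpha>0 ` circle)"
  proof (rule G_inj_on)
    show "inj_on f (H \<alpha>0 ` (exterior \<inter> ?near))"
    proof (rule inj_onI)
      fix u v assume "u \<in> H \<alpha>0 ` (exterior \<inter> ?near)" "v \<in> H \<alpha>0 ` (exterior \<inter> ?near)" and eq: "f u = f v"
      then obtain z w where zw: "z \<in> exterior" "z \<in> ?near" "u = H \<alpha>0 z" "w \<in> exterior" "w \<in> ?near" "v = H \<alpha>0 w"
        by blast
      have "z = w" by (rule sep) (use zw eq in \<open>auto simp: dist_commute\<close>)
      then show "u = v" using zw by simp
    qed
    show "x \<in> H \<alpha>0 ` (exterior \<inter> ?near)" if "y \<in> W - c \<alpha>0 ` circle" "lies_over x y" for y x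
      using that d1(2)[of y x] by (auto simp: W_def dist_commute)
  qed (auto simp: W_def)
  have mixed: "G (c \<alpha>0 s) \<noteq> G y" if s: "s \<in> circle" "c \<alpha>0 s \<in> W" and y: "y \<in> W - c \<alpha>0 ` circle" for s y
  proof
    assume eq: "G (c \<alpha>0 s) = G y"
    have yS: "y \<in> S" using y by (simp add: W_def)
    have s_near: "dist s t0 < \<epsilon> \<or> dist s (flip t0) < \<epsilon>" using d2(2)[OF s(1)] s(2) by (simp add: W_def dist_commute)
    have contra: False if u: "u \<in> circle" "dist u t0 < \<epsilon> \<or> dist u (flip t0) < \<epsilon>" and x: "lies_over x y" "f x = f (\<alpha>0 u)" for u x
    proof -
      obtain z where z: "z \<in> exterior" "z \<in> ?near" "x = H \<alpha>0 z" using d1(2)[OF _ _ x(1)] y by (auto simp: W_def dist_commute)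
      have "f (H \<alpha>0 z) = f (H \<alpha>0 u)" using x(2) z(3) H_circle[OF \<alpha>0 u(1)] by simp
      then have "z = u" using sep[OF z(1) _ _ u(2)] z(2) u(1) by (auto simp: dist_commute)
      then show False using z(1) u(1) by simp
    qed
    show False using yS
    proof (cases rule: G_cases)
      case (regular x)
      have "\<not> unfolded \<alpha>0"
      proof
        assume un: "unfolded \<alpha>0"
        have "G (c \<alpha>0 s) \<notin> Y"
          using G_arc[OF \<alpha>0 s(1)] un beta_notin_Y[OF un boundary_map_circle[OF \<alpha>0 un s(1)]] by (simp add: arc_value_def)
        then show False using eq regular(3) \<Phi>_in_Y[OF regular(2)] by simp
      qed
      moreover then have "f (\<alpha>0 s) \<in> X" using not_unfolded(2)[OF \<alpha>0 _ s(1)] by blast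
      ultimately have "f x = f (\<alpha>0 s)"
        using eq G_arc[OF \<alpha>0 s(1)] regular(3) \<Phi>_inj[OF regular(2)] by (simp add: arc_value_def)
      then show False using contra[OF s(1) s_near regular(1)] by blast
    next
      case a: (arc \<alpha> t)
      have un: "unfolded \<alpha>0"
      proof (rule ccontr)
        assume n: "\<not> unfolded \<alpha>0"
        then have "G (c \<alpha>0 s) \<in> Y"
          using G_arc[OF \<alpha>0 s(1)] \<Phi>_in_Y[OF not_unfolded(2)[OF \<alpha>0 n s(1)]] by (simp add: arc_value_def)
        then show False using eq a(5) beta_notin_Y[OF a(2) boundary_map_circle[OF a(1,2,3)]] by simp
      qed
      have "compose circle f \<alpha> = compose circle f \<alpha>0"
        by (rule beta_disjoint[OF a(2) un boundary_map_circle[OF a(1,2,3)] boundary_map_circle[OF \<alpha>0 un s(1)]])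
          (use eq a(5) G_arc[OF \<alpha>0 s(1)] un in \<open>simp add: arc_value_def\<close>)
      then have "f (\<alpha> t0) = f (\<alpha>0 t0)" using t0 by (metis compose_eq)
      moreover have "lies_over (\<alpha> t0) y" using lies_over_arc[OF a(1) t0 a(3)] a(4) by simp
      moreover have "dist t0 t0 < \<epsilon> \<or> dist t0 (flip t0) < \<epsilon>" using \<epsilon> by simp
      ultimately show False using contra[OF t0] by blast
    qed
  qed
  have "inj_on G W"
  proof (rule inj_onI)
    fix y1 y2 assume y: "y1 \<in> W" "y2 \<in> W" and eq: "G y1 = G y2"
    show "y1 = y2"
    proof (cases "y1 \<in> c \<alpha>0 ` circle")
      case True
      then obtain s where s: "s \<in> circle" "y1 = c \<alpha>0 s" by blast
      show ?thesis
      proof (cases "y2 \<in> c \<alpha>0 ` circle")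
        case True
        then obtain t where t: "t \<in> circle" "y2 = c \<alpha>0 t" by blast
        have "dist s t0 < \<epsilon> \<or> dist s (flip t0) < \<epsilon>" "dist t t0 < \<epsilon> \<or> dist t (flip t0) < \<epsilon>"
          using d2(2)[OF s(1)] d2(2)[OF t(1)] y s(2) t(2) by (auto simp: W_def dist_commute)
        then show ?thesis using arc[OF s(1) t(1)] eq s(2) t(2) by simp
      next
        case False
        then show ?thesis using mixed[OF s(1), of y2] y s(2) eq by simp
      qed
    next
      case False
      show ?thesis
      proof (cases "y2 \<in> c \<alpha>0 ` circle")
        case True
        then obtain t where t: "t \<in> circle" "y2 = c \<alpha>0 t" by blast
        then show ?thesis using mixed[OF t(1), of y1] y False eq by simp
      next
        case n: False
        then show ?thesis using inj_onD[OF off eq] y False by blast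
      qed
    qed
  qed
  moreover have "c \<alpha>0 t0 \<in> W" using beta_in_S[OF \<alpha>0 t0] d1(1) d2(1) by (simp add: W_def)
  ultimately show ?thesis unfolding locally_injective_at_def W_def using openin_ball by blast
qed

lemma G_locally_injective_folded:
  assumes \<alpha>: "\<alpha> \<in> \<A>" "\<not> unfolded \<alpha>" and t: "t \<in> circle" "Im t \<noteq> 0"
  shows "locally_injective_at S G (c \<alpha> t)"
proof -
  obtain \<epsilon> where \<epsilon>: "\<epsilon> > 0" "\<And>z1 z2. 1 \<le> norm z1 \<Longrightarrow> 1 \<le> norm z2 \<Longrightarrow>
      dist z1 t < \<epsilon> \<or> dist z1 (flip t) < \<epsilon> \<Longrightarrow> dist z2 t < \<epsilon> \<or> dist z2 (flip t) < \<epsilon> \<Longrightarrow>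
      f (H \<alpha> z1) = f (H \<alpha> z2) \<Longrightarrow> fold_related z1 z2"
    using folded_separation[OF \<alpha>(1) not_unfolded(1)[OF \<alpha>] t] by metis
  show ?thesis
  proof (rule G_locally_injective_near_arc[OF \<alpha>(1) t(1) \<epsilon>(1)])
    fix z w assume *: "z \<in> exterior" "1 \<le> norm w" "dist z t < \<epsilon> \<or> dist z (flip t) < \<epsilon>"
      "dist w t < \<epsilon> \<or> dist w (flip t) < \<epsilon>" "f (H \<alpha> z) = f (H \<alpha> w)"
    have "1 \<le> norm z" using *(1) by simp
    then have "fold_related z w" using \<epsilon>(2) * by blast
    then show "z = w" using *(1) by (auto simp: fold_related_def)
  next
    fix s u assume *: "s \<in> circle" "u \<in> circle" "dist s t < \<epsilon> \<or> dist s (flip t) < \<epsilon>"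
      "dist u t < \<epsilon> \<or> dist u (flip t) < \<epsilon>" "G (c \<alpha> s) = G (c \<alpha> u)"
    have "f (\<alpha> s) = f (\<alpha> u)"
      using *(5) G_arc[OF \<alpha>(1)] *(1,2) \<alpha>(2) \<Phi>_inj not_unfolded(2)[OF \<alpha>] by (simp add: arc_value_def)
    then have "f (H \<alpha> s) = f (H \<alpha> u)" using H_circle[OF \<alpha>(1)] *(1,2) by simp
    moreover have "1 \<le> norm s" "1 \<le> norm u" using *(1,2) by auto
    ultimately have "fold_related s u" using \<epsilon>(2) *(3,4) by blast
    then show "c \<alpha> s = c \<alpha> u" using beta_eq_iff[OF \<alpha>(1) *(1,2)] by (auto simp: fold_related_def)
  qed
qed

lemma f_H_injective_at_regular:
  assumes \<alpha>: "\<alpha> \<in> \<A>" and t: "t \<in> circle" and reg: "\<not> critical (\<alpha> t)"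
  obtains \<epsilon> where "\<epsilon> > 0" "\<And>z w. z \<in> exterior \<Longrightarrow> 1 \<le> norm w \<Longrightarrow> dist z t < \<epsilon> \<Longrightarrow> dist w t < \<epsilon> \<Longrightarrow>
     f (H \<alpha> z) = f (H \<alpha> w) \<Longrightarrow> z = w"
proof -
  have aS: "\<alpha> t \<in> S" using alpha_in_S \<alpha> t by blast
  obtain r where r: "r > 0" "inj_on f (ball (\<alpha> t) r \<inter> S)"
    using locally_injective_atE[OF aS regular_locally_injective[OF aS reg]] by metis
  obtain \<epsilon> where \<epsilon>: "\<epsilon> > 0" "\<And>z. 1 \<le> norm z \<Longrightarrow> dist z t < \<epsilon> \<Longrightarrow> dist (H \<alpha> z) (\<alpha> t) < r"
    using H_limit[OF \<alpha> t r(1)] by metis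
  show thesis
  proof (rule that[OF \<epsilon>(1)])
    fix z w assume *: "z \<in> exterior" "1 \<le> norm w" "dist z t < \<epsilon>" "dist w t < \<epsilon>" "f (H \<alpha> z) = f (H \<alpha> w)"
    have z1: "1 \<le> norm z" using *(1) by simp
    have eq: "H \<alpha> z = H \<alpha> w"
      using inj_onD[OF r(2) *(5)] \<epsilon>(2) z1 * H_closed_in_S[OF \<alpha>] by (simp add: dist_commute)
    have "w \<notin> circle"
    proof
      assume "w \<in> circle"
      then show False using H_in[OF \<alpha> *(1)] eq H_circle[OF \<alpha>] by auto
    qed
    then have "w \<in> exterior" using *(2) by auto
    then show "z = w" using H_inj[OF \<alpha> *(1)] eq by blast
  qed
qed

text \<open>The points near \<open>\<alpha> t\<close> are separated by \<open>f\<close> from each other, and from those near \<open>\<alpha> (flip t)\<close>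
  because \<open>f \<circ> \<alpha>\<close> is an \<open>\<alpha>\<close>-path, which takes different values at \<open>t\<close> and \<open>flip t\<close> unless these coincide.\<close>

lemma G_locally_injective_unfolded:
  assumes \<alpha>: "\<alpha> \<in> \<A>" "unfolded \<alpha>" and t: "t \<in> circle"
  shows "locally_injective_at S G (c \<alpha> t)"
proof -
  have ft: "flip t \<in> circle" using t by simp
  obtain \<epsilon>1 where e1: "\<epsilon>1 > 0" "\<And>z w. z \<in> exterior \<Longrightarrow> 1 \<le> norm w \<Longrightarrow> dist z t < \<epsilon>1 \<Longrightarrow> dist w t < \<epsilon>1 \<Longrightarrow>
     f (H \<alpha> z) = f (H \<alpha> w) \<Longrightarrow> z = w"
    using f_H_injective_at_regular[OF \<alpha>(1) t unfolded_regular[OF \<alpha> t]] by metis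
  obtain \<epsilon>2 where e2: "\<epsilon>2 > 0" "\<And>z w. z \<in> exterior \<Longrightarrow> 1 \<le> norm w \<Longrightarrow> dist z (flip t) < \<epsilon>2 \<Longrightarrow>
     dist w (flip t) < \<epsilon>2 \<Longrightarrow> f (H \<alpha> z) = f (H \<alpha> w) \<Longrightarrow> z = w"
    using f_H_injective_at_regular[OF \<alpha>(1) ft unfolded_regular[OF \<alpha> ft]] by metis
  have "\<exists>\<epsilon>3>0. \<forall>z w. 1 \<le> norm z \<longrightarrow> 1 \<le> norm w \<longrightarrow> dist z t < \<epsilon>3 \<longrightarrow> dist w (flip t) < \<epsilon>3 \<longrightarrow>
      f (H \<alpha> z) = f (H \<alpha> w) \<longrightarrow> flip t = t"
  proof (cases "flip t = t")
    case False
    have "compose circle f \<alpha> t \<noteq> compose circle f \<alpha> (flip t)"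
      using alpha_eq_iff[OF \<alpha>(2) t ft] False t by (auto simp: complex_eq_iff)
    then have ne: "f (\<alpha> t) \<noteq> f (\<alpha> (flip t))" using t ft by (metis compose_eq)
    \<comment> \<open>half the distance between the two image points separates the images of their neighbourhoods\<close>
    define \<eta> where "\<eta> = dist (f (\<alpha> t)) (f (\<alpha> (flip t))) / 2"
    have \<eta>: "\<eta> > 0" using ne by (simp add: \<eta>_def)
    obtain \<delta>1 where 1: "\<delta>1 > 0" "\<And>z. 1 \<le> norm z \<Longrightarrow> dist z t < \<delta>1 \<Longrightarrow> dist (f (H \<alpha> z)) (f (\<alpha> t)) < \<eta>"
      using f_H_limit_closed[OF \<alpha>(1) t \<eta>] by metis
    obtain \<delta>2 where 2: "\<delta>2 > 0" "\<And>z. 1 \<le> norm z \<Longrightarrow> dist z (flip t) < \<delta>2 \<Longrightarrow> dist (f (H \<alpha> z)) (f (\<alpha> (flip t))) < \<eta>"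
      using f_H_limit_closed[OF \<alpha>(1) ft \<eta>] by metis
    have "f (H \<alpha> z) \<noteq> f (H \<alpha> w)" if "1 \<le> norm z" "1 \<le> norm w" "dist z t < min \<delta>1 \<delta>2" "dist w (flip t) < min \<delta>1 \<delta>2" for z w
    proof
      assume "f (H \<alpha> z) = f (H \<alpha> w)"
      then have "dist (f (\<alpha> t)) (f (\<alpha> (flip t))) < \<eta> + \<eta>"
        using 1(2)[of z] 2(2)[of w] that dist_triangle3[of "f (\<alpha> t)" "f (\<alpha> (flip t))" "f (H \<alpha> z)"] by simp
      then show False by (simp add: \<eta>_def)
    qed
    then show ?thesis using 1(1) 2(1) by (intro exI[of _ "min \<delta>1 \<delta>2"]) auto
  qed (auto intro: exI[of _ 1])
  then obtain \<epsilon>3 where e3: "\<epsilon>3 > 0" "\<And>z w. 1 \<le> norm z \<Longrightarrow> 1 \<le> norm w \<Longrightarrow> dist z t < \<epsilon>3 \<Longrightarrow> dist w (flip t) < \<epsilon>3 \<Longrightarrow>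
      f (H \<alpha> z) = f (H \<alpha> w) \<Longrightarrow> flip t = t" by blast
  define \<epsilon> where "\<epsilon> = Min {\<epsilon>1, \<epsilon>2, \<epsilon>3}"
  have \<epsilon>: "\<epsilon> > 0" "\<epsilon> \<le> \<epsilon>1" "\<epsilon> \<le> \<epsilon>2" "\<epsilon> \<le> \<epsilon>3" using e1(1) e2(1) e3(1) by (auto simp: \<epsilon>_def)
  show ?thesis
  proof (rule G_locally_injective_near_arc[OF \<alpha>(1) t \<epsilon>(1)])
    fix z w assume *: "z \<in> exterior" "1 \<le> norm w" "dist z t < \<epsilon> \<or> dist z (flip t) < \<epsilon>"
      "dist w t < \<epsilon> \<or> dist w (flip t) < \<epsilon>" "f (H \<alpha> z) = f (H \<alpha> w)"
    have z1: "1 \<le> norm z" using *(1) by simp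
    consider "dist z t < \<epsilon>" "dist w t < \<epsilon>" | "dist z (flip t) < \<epsilon>" "dist w (flip t) < \<epsilon>"
      | "flip t = t"
      using *(3,4) e3(2)[OF z1 *(2) _ _ *(5)] e3(2)[OF *(2) z1 _ _ *(5)[symmetric]] \<epsilon>(4) by fastforce
    then show "z = w"
    proof cases
      case 1 then show ?thesis using e1(2)[OF *(1,2) _ _ *(5)] \<epsilon>(2) by simp
    next
      case 2 then show ?thesis using e2(2)[OF *(1,2) _ _ *(5)] \<epsilon>(3) by simp
    next
      case 3
      then have "dist z t < \<epsilon>" "dist w t < \<epsilon>" using *(3,4) by auto
      then show ?thesis using e1(2)[OF *(1,2) _ _ *(5)] \<epsilon>(2) by simp
    qed
  next
    fix s u assume "s \<in> circle" "u \<in> circle" "G (c \<alpha> s) = G (c \<alpha> u)"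
    then show "c \<alpha> s = c \<alpha> u" using G_inj_unfolded[OF \<alpha>] by blast
  qed
qed

lemma G_locally_injective_over:
  assumes y: "y \<in> S" and inj: "\<And>x. lies_over x y \<Longrightarrow> locally_injective_at S f x"
  shows "locally_injective_at S G y"
  using y
proof (cases rule: S_cases_target)
  case (1 x)
  then have "lies_over x y" by (simp add: lies_over_def)
  then show ?thesis using G_locally_injective_regular[OF 1(1)] inj 1(2) by simp
next
  case (2 \<alpha> t)
  have "locally_injective_at S f (\<alpha> s)" if "s \<in> circle" for s
    using inj lies_over_arc[OF 2(1) that 2(2)] 2(3) by simp
  then have "unfolded \<alpha>" using locally_injective_arc_unfolded[OF 2(1)] by blast
  then show ?thesis using G_locally_injective_unfolded[OF 2(1) _ 2(2)] 2(3) by simp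
qed

text \<open>Near \<open>x0\<close> there is no other branch point of \<open>f\<close>, hence no folded arc either.\<close>

lemma G_isolated_regular:
  assumes x0: "x0 \<in> X"
  shows "\<exists>W. openin (top_of_set S) W \<and> \<Phi> x0 \<in> W \<and>
    (\<forall>y \<in> W - {\<Phi> x0}. G y \<noteq> G (\<Phi> x0) \<and> locally_injective_at S G y)"
proof -
  have x0S: "x0 \<in> S" using x0 by simp
  have y0: "\<Phi> x0 \<in> S" using \<Phi>_in_Y[OF x0] by simp
  obtain U where U: "openin (top_of_set S) U" "x0 \<in> U"
    "\<And>x'. x' \<in> U - {x0} \<Longrightarrow> f x' \<noteq> f x0 \<and> locally_injective_at S f x'"
    using branch_point_isolated[OF x0S] by metis
  obtain r where r: "r > 0" "ball x0 r \<inter> S \<subseteq> U" using openin_contains_ball U(1,2) by metis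
  obtain \<delta> where \<delta>: "\<delta> > 0" "\<And>y x. y \<in> S \<Longrightarrow> dist y (\<Phi> x0) < \<delta> \<Longrightarrow> lies_over x y \<Longrightarrow> dist x x0 < r"
    using lies_over_near_regular[OF x0 r(1)] by metis
  have "G y \<noteq> G (\<Phi> x0) \<and> locally_injective_at S G y" if y: "y \<in> S \<inter> ball (\<Phi> x0) \<delta> - {\<Phi> x0}" for y
  proof -
    have over: "x \<in> U - {x0}" if x: "lies_over x y" for x
    proof -
      have "dist x x0 < r" using \<delta>(2)[OF _ _ x] y by (simp add: dist_commute)
      moreover have "x \<noteq> x0" using regular_lies_over[OF x0] x y by blast
      ultimately show ?thesis using r(2) lies_over_in_S[OF x] by (auto simp: dist_commute)
    qed
    have "locally_injective_at S G y"
      by (rule G_locally_injective_over) (use y over U(3) in auto)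
    moreover have "G y \<noteq> G (\<Phi> x0)"
    proof
      assume eq: "G y = G (\<Phi> x0)"
      have "y \<in> S" using y by simp
      then obtain x1 x2 where x: "lies_over x1 y" "lies_over x2 (\<Phi> x0)" "f x1 = f x2"
        using G_eq_lies_over[OF _ y0 eq] by metis
      have "x2 = x0" using lies_over_regular[OF x0 x(2)] .
      then show False using U(3)[OF over[OF x(1)]] x(3) by simp
    qed
    ultimately show ?thesis by blast
  qed
  then show ?thesis using openin_ball[of "\<Phi> x0" \<delta>] y0 \<delta>(1)
    by (intro exI[of _ "S \<inter> ball (\<Phi> x0) \<delta>"]) auto
qed

text \<open>The two tips \<open>\<alpha> t\<close> and \<open>\<alpha> (flip t)\<close> have neighbourhoods on which \<open>f\<close> is injective, and
  the points over anything near \<open>c \<alpha> t\<close> but off the new arc lie in them. These neighbourhoods contain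
  no whole folded arc, and only \<open>\<alpha> t\<close> and \<open>\<alpha> (flip t)\<close> have the image \<open>f (\<alpha> t)\<close>; on the target side both tips become the point \<open>c \<alpha> t\<close> itself.\<close>

lemma G_isolated_folded_tip:
  assumes \<alpha>: "\<alpha> \<in> \<A>" "\<not> unfolded \<alpha>" and t: "t \<in> circle" "Im t = 0"
  shows "\<exists>W. openin (top_of_set S) W \<and> c \<alpha> t \<in> W \<and>
    (\<forall>y \<in> W - {c \<alpha> t}. G y \<noteq> G (c \<alpha> t) \<and> locally_injective_at S G y)"
proof -
  have fold: "folded_by f \<alpha>" using not_unfolded(1)[OF \<alpha>] .
  have Ret: "\<bar>Re t\<bar> = 1" using t by (simp add: cmod_def)
  have ft: "flip t \<in> circle" using t by simp
  have tips: "s = t \<or> s = flip t" if "s \<in> circle" "Im s = 0" for s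
  proof -
    have "\<bar>Re s\<bar> = 1" using that by (simp add: cmod_def)
    then have "Re s = Re t \<or> Re s = - Re t" using Ret by (auto simp: abs_if split: if_splits)
    then show ?thesis using that(2) t(2) by (auto simp: complex_eq_iff)
  qed
  have ball_at: "\<exists>r>0. inj_on f (ball (\<alpha> s) r \<inter> S)" if s: "s \<in> circle" "Re s \<noteq> 0" for s
  proof -
    have aS: "\<alpha> s \<in> S" using alpha_in_S \<alpha>(1) s(1) by blast
    show ?thesis
      using locally_injective_atE[OF aS regular_locally_injective[OF aS folded_regular[OF \<alpha>(1) s]]] by metis
  qed
  have "Re t \<noteq> 0" using Ret by auto
  then obtain r where r: "r > 0" "inj_on f (ball (\<alpha> t) r \<inter> S)" using ball_at[OF t(1)] by blast
  have "Re (flip t) \<noteq> 0" using Ret by auto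
  then obtain r' where r': "r' > 0" "inj_on f (ball (\<alpha> (flip t)) r' \<inter> S)" using ball_at[OF ft] by blast
  define N where "N = (ball (\<alpha> t) r \<inter> S) \<union> (ball (\<alpha> (flip t)) r' \<inter> S)"
  have N_inj: "locally_injective_at S f x" if "x \<in> N" for x
    using that r(2) r'(2) openin_ball unfolding N_def locally_injective_at_def by (metis Int_commute UnE)
  have N_fiber: "x = \<alpha> t \<or> x = \<alpha> (flip t)" if x: "x \<in> N" "f x = f (\<alpha> t)" for x
  proof -
    have "f x = f (\<alpha> (flip t))" using folded_eq[OF fold t(1)] x(2) by simp
    moreover have "\<alpha> t \<in> ball (\<alpha> t) r \<inter> S" "\<alpha> (flip t) \<in> ball (\<alpha> (flip t)) r' \<inter> S"
      using alpha_in_S[OF \<alpha>(1)] t(1) ft r(1) r'(1) by auto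
    ultimately show ?thesis using x inj_onD[OF r(2)] inj_onD[OF r'(2)] unfolding N_def by blast
  qed
  obtain \<epsilon>1 where e1: "\<epsilon>1 > 0" "\<And>z. 1 \<le> norm z \<Longrightarrow> dist z t < \<epsilon>1 \<Longrightarrow> dist (H \<alpha> z) (\<alpha> t) < r"
    using H_limit[OF \<alpha>(1) t(1) r(1)] by metis
  obtain \<epsilon>2 where e2: "\<epsilon>2 > 0" "\<And>z. 1 \<le> norm z \<Longrightarrow> dist z (flip t) < \<epsilon>2 \<Longrightarrow> dist (H \<alpha> z) (\<alpha> (flip t)) < r'"
    using H_limit[OF \<alpha>(1) ft r'(1)] by metis
  define \<epsilon> where "\<epsilon> = min \<epsilon>1 \<epsilon>2"
  have \<epsilon>: "\<epsilon> > 0" "\<epsilon> \<le> \<epsilon>1" "\<epsilon> \<le> \<epsilon>2" using e1(1) e2(1) by (auto simp: \<epsilon>_def)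
  have HN: "H \<alpha> z \<in> N" if "1 \<le> norm z" "dist z t < \<epsilon> \<or> dist z (flip t) < \<epsilon>" for z
    using e1(2)[of z] e2(2)[of z] that \<epsilon> H_closed_in_S[OF \<alpha>(1) that(1)] by (auto simp: N_def dist_commute)
  obtain \<delta>1 where d1: "\<delta>1 > 0" "\<And>y x. y \<in> S - c \<alpha> ` circle \<Longrightarrow> dist y (c \<alpha> t) < \<delta>1 \<Longrightarrow> lies_over x y \<Longrightarrow>
     x \<in> H \<alpha> ` (exterior \<inter> (ball t \<epsilon> \<union> ball (flip t) \<epsilon>))"
    using lies_over_near_arc[OF \<alpha>(1) t(1) \<epsilon>(1)] by metis
  obtain \<delta>2 where d2: "\<delta>2 > 0"
    "\<And>s. s \<in> circle \<Longrightarrow> dist (c \<alpha> s) (c \<alpha> t) < \<delta>2 \<Longrightarrow> dist s t < \<epsilon> \<or> dist s (flip t) < \<epsilon>"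
    using beta_near[OF \<alpha>(1) t(1) \<epsilon>(1)] by metis
  have Gt: "G (c \<alpha> t) = \<Phi> (f (\<alpha> t))" using G_arc[OF \<alpha>(1) t(1)] \<alpha>(2) by (simp add: arc_value_def)
  have ftX: "f (\<alpha> t) \<in> X" using not_unfolded(2)[OF \<alpha> t(1)] .
  have "G y \<noteq> G (c \<alpha> t) \<and> locally_injective_at S G y"
    if y: "y \<in> S \<inter> ball (c \<alpha> t) (min \<delta>1 \<delta>2) - {c \<alpha> t}" for y
  proof (cases "y \<in> c \<alpha> ` circle")
    case True
    then obtain s where s: "s \<in> circle" "y = c \<alpha> s" by blast
    have s_near: "dist s t < \<epsilon> \<or> dist s (flip t) < \<epsilon>" using d2(2)[OF s(1)] y s(2) by (simp add: dist_commute)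
    have "c \<alpha> t \<noteq> c \<alpha> s" using y s(2) by auto
    then have ne: "s \<noteq> t" "s \<noteq> flip t" using beta_eq_iff[OF \<alpha>(1) t(1) s(1)] by blast+
    then have "Im s \<noteq> 0" using tips[OF s(1)] by blast
    then have "locally_injective_at S G y" using G_locally_injective_folded[OF \<alpha> s(1)] s(2) by simp
    moreover have "G y \<noteq> G (c \<alpha> t)"
    proof
      assume "G y = G (c \<alpha> t)"
      then have "\<Phi> (f (\<alpha> s)) = \<Phi> (f (\<alpha> t))" using Gt G_arc[OF \<alpha>(1) s(1)] s(2) \<alpha>(2) by (simp add: arc_value_def)
      then have eq: "f (\<alpha> s) = f (\<alpha> t)" using \<Phi>_inj ftX not_unfolded(2)[OF \<alpha> s(1)] by blast
      have "\<alpha> s \<in> N" using HN[of s] s_near s(1) H_circle[OF \<alpha>(1) s(1)] by simp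
      then have "\<alpha> s = \<alpha> t \<or> \<alpha> s = \<alpha> (flip t)" using N_fiber eq by blast
      then have "t = s \<or> t = cnj s \<or> flip t = s \<or> flip t = cnj s"
        using alpha_eq_iff[OF \<alpha>(1) s(1) t(1)] alpha_eq_iff[OF \<alpha>(1) s(1) ft] by blast
      then show False using ne \<open>Im s \<noteq> 0\<close> t(2) by (auto simp: complex_eq_iff)
    qed
    ultimately show ?thesis by blast
  next
    case False
    then have off: "y \<in> S - c \<alpha> ` circle" "dist y (c \<alpha> t) < \<delta>1" using y by (auto simp: dist_commute)
    have yS: "y \<in> S" using y by simp
    have over: "x \<in> N - \<alpha> ` circle" if x: "lies_over x y" for x
    proof -
      obtain z where z: "z \<in> exterior" "z \<in> ball t \<epsilon> \<union> ball (flip t) \<epsilon>" "x = H \<alpha> z"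
        using d1(2)[OF off x] by blast
      then show ?thesis using HN[of z] H_in[OF \<alpha>(1) z(1)] by (auto simp: dist_commute)
    qed
    have "locally_injective_at S G y"
      by (rule G_locally_injective_over[OF yS]) (use over N_inj in blast)
    moreover have "G y \<noteq> G (c \<alpha> t)"
      using yS
    proof (cases rule: G_cases)
      case (regular x)
      show ?thesis
      proof
        assume "G y = G (c \<alpha> t)"
        then have "f x = f (\<alpha> t)" using Gt regular(3) \<Phi>_inj[OF regular(2) ftX] by simp
        then show False using N_fiber over[OF regular(1)] t(1) ft by blast
      qed
    next
      case a: (arc \<alpha>' s)
      then show ?thesis using Gt \<Phi>_in_Y[OF ftX] beta_notin_Y[OF a(2) boundary_map_circle[OF a(1,2,3)]] by auto
    qed
    ultimately show ?thesis by blast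
  qed
  then show ?thesis using openin_ball[of "c \<alpha> t" "min \<delta>1 \<delta>2"] beta_in_S[OF \<alpha>(1) t(1)] d1(1) d2(1)
    by (intro exI[of _ "S \<inter> ball (c \<alpha> t) (min \<delta>1 \<delta>2)"]) auto
qed

lemma G_isolated:
  assumes y: "y \<in> S"
  shows "\<exists>W. openin (top_of_set S) W \<and> y \<in> W \<and>
    (\<forall>y' \<in> W - {y}. G y' \<noteq> G y \<and> locally_injective_at S G y')"
proof -
  have loc: ?thesis if inj: "locally_injective_at S G y"
  proof -
    obtain W where W: "openin (top_of_set S) W" "y \<in> W" "inj_on G W"
      using inj by (auto simp: locally_injective_at_def)
    then have "\<forall>y' \<in> W - {y}. G y' \<noteq> G y \<and> locally_injective_at S G y'"
      unfolding locally_injective_at_def by (blast dest: inj_onD)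
    then show ?thesis using W by blast
  qed
  show ?thesis using y
  proof (cases rule: S_cases_target)
    case (1 x)
    then show ?thesis using G_isolated_regular[OF 1(1)] by simp
  next
    case (2 \<alpha> t)
    consider "unfolded \<alpha>" | "\<not> unfolded \<alpha>" "Im t = 0" | "\<not> unfolded \<alpha>" "Im t \<noteq> 0" by blast
    then show ?thesis
    proof cases
      case u: 1
      then show ?thesis using loc G_locally_injective_unfolded[OF 2(1) u 2(2)] 2(3) by simp
    next
      case n: 2
      then show ?thesis using G_isolated_folded_tip[OF 2(1) n(1) 2(2) n(2)] 2(3) by simp
    next
      case n: 3
      then show ?thesis using loc G_locally_injective_folded[OF 2(1) n(1) 2(2) n(2)] 2(3) by simp
    qed
  qed
qed

proposition G_ramified_covering: "ramified_covering S G"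
  unfolding ramified_covering_def
proof (intro conjI ballI)
  show "continuous_on S G" by (rule G_continuous)
  show im: "G ` S \<subseteq> S" using G_in_S by blast
  fix y assume y: "y \<in> S"
  obtain W where W: "openin (top_of_set S) W" "y \<in> W"
    "\<forall>y' \<in> W - {y}. G y' \<noteq> G y \<and> locally_injective_at S G y'" using G_isolated[OF y] by blast
  show "\<exists>k. has_local_degree S G y k"
  proof (rule isolated_branch_point_has_local_degree[OF _ G_continuous im y W(1,2)])
    fix x assume "x \<in> S"
    then obtain k where "has_local_degree S f x k" using local_degree_exists by blast
    then show "\<exists>U \<phi> \<phi>'. openin (top_of_set S) U \<and> x \<in> U \<and>
      homeomorphism U (ball (0::complex) 1) \<phi> \<phi>' \<and> \<phi> x = 0"
      unfolding has_local_degree_def by blast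
  qed (use W(3) in auto)
qed

end

section \<open>The regluing theorem\<close>

theorem theorem4:
  fixes S :: "'a::metric_space set"
    and \<O> :: "('a set \<times> ('a \<Rightarrow> complex)) set"
    and f \<Phi> :: "'a \<Rightarrow> 'a"
    and \<A> \<B> :: "(complex \<Rightarrow> 'a) set"
    and c :: "(complex \<Rightarrow> 'a) \<Rightarrow> (complex \<Rightarrow> 'a)"
  assumes "oriented_sphere S \<O>"
    and "ramified_covering S f"
    and "disjoint_alpha_paths S \<A>" and "contracted \<A>" and "strongly_f_stable S f \<A>"
    and "disjoint_beta_paths S \<B>" and "contracted \<B>"
    and "regluing S \<O> \<A> \<B> c \<Phi>"
  shows "\<exists>G. ramified_covering S G \<and>
    (\<forall>y \<in> S - Im_paths \<B>. G y = (\<Phi> \<circ> f \<circ> inv_into (S - Im_paths \<A>) \<Phi>) y)"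
proof -
  have reg: "bij_betw c \<A> \<B>" "continuous_on (S - Im_paths \<A>) \<Phi>"
    "bij_betw \<Phi> (S - Im_paths \<A>) (S - Im_paths \<B>)"
    "\<And>\<alpha>. \<alpha> \<in> \<A> \<Longrightarrow> \<exists>h. alpha_extension S \<O> \<alpha> h \<and>
       (\<exists>E \<in> closed_Delta_inf \<rightarrow> S.
          (\<forall>p \<in> Delta_inf. h p \<notin> Im_paths \<A> \<longrightarrow> E p = \<Phi> (h p)) \<and>
          (\<forall>t \<in> circle. E (Some t) = c \<alpha> t) \<and>
          (\<forall>t \<in> circle. topcontinuous_at (subtopology plane_compactification closed_Delta_inf)
             (top_of_set S) E (Some t)))"
    using assms(8) unfolding regluing_def by blast+
  then obtain h where h: "\<And>\<alpha>. \<alpha> \<in> \<A> \<Longrightarrow> alpha_extension S \<O> \<alpha> (h \<alpha>) \<and>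
       (\<exists>E \<in> closed_Delta_inf \<rightarrow> S.
          (\<forall>p \<in> Delta_inf. h \<alpha> p \<notin> Im_paths \<A> \<longrightarrow> E p = \<Phi> (h \<alpha> p)) \<and>
          (\<forall>t \<in> circle. E (Some t) = c \<alpha> t) \<and>
          (\<forall>t \<in> circle. topcontinuous_at (subtopology plane_compactification closed_Delta_inf)
             (top_of_set S) E (Some t)))" by metis
  define H where "H = (\<lambda>\<alpha> z. h \<alpha> (Some z))"
  have \<B>: "\<B> = c ` \<A>" using reg(1) by (simp add: bij_betw_def)
  interpret regluing_setup S f \<Phi> \<A> c H
  proof
    have "S homeomorphic sphere (0 :: real^3) 1" using assms(1) by (simp add: oriented_sphere_def)
    then have "compact S \<longleftrightarrow> compact (sphere (0 :: real^3) 1)" by (rule homeomorphic_compactness)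
    then show "compact S" by simp
    show "ramified_covering S f" "strongly_f_stable S f \<A>" by fact+
    show "disjoint_beta_paths S (c ` \<A>)" using assms(6) \<B> by simp
    show "inj_on c \<A>" using reg(1) by (simp add: bij_betw_def)
    show "continuous_on (S - Im_paths \<A>) \<Phi>" by (rule reg(2))
    show "bij_betw \<Phi> (S - Im_paths \<A>) (S - Im_paths (c ` \<A>))" using reg(3) \<B> by simp
    fix \<alpha> assume \<alpha>: "\<alpha> \<in> \<A>"
    have "alpha_path S \<alpha>" using assms(3) \<alpha> by (simp add: disjoint_alpha_paths_def)
    moreover have "alpha_extension S \<O> \<alpha> (h \<alpha>)" using h[OF \<alpha>] by blast
    ultimately show "slit S \<alpha> (H \<alpha>)" unfolding H_def by (rule alpha_extension_slit)
    fix t :: complex and \<epsilon> :: real assume t: "t \<in> circle" and \<epsilon>: "\<epsilon> > 0"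
    obtain E where E: "E \<in> closed_Delta_inf \<rightarrow> S"
      "\<forall>p \<in> Delta_inf. h \<alpha> p \<notin> Im_paths \<A> \<longrightarrow> E p = \<Phi> (h \<alpha> p)"
      "\<forall>t \<in> circle. E (Some t) = c \<alpha> t"
      "\<forall>t \<in> circle. topcontinuous_at (subtopology plane_compactification closed_Delta_inf)
             (top_of_set S) E (Some t)"
      using h[OF \<alpha>] by blast
    have "Some t \<in> closed_Delta_inf" using t by (simp add: closed_Delta_inf_eq)
    then have "E (Some t) \<in> S" using E(1) by blast
    from boundary_limit[OF E(4)[rule_format, OF t] t \<epsilon> this]
    obtain \<delta> where \<delta>: "\<delta> > 0" "\<forall>z \<in> exterior \<inter> ball t \<delta>. dist (E (Some z)) (E (Some t)) < \<epsilon>"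
      by blast
    have "dist (\<Phi> (H \<alpha> z)) (c \<alpha> t) < \<epsilon>" if z: "z \<in> exterior \<inter> ball t \<delta>" "H \<alpha> z \<notin> Im_paths \<A>" for z
    proof -
      have "Some z \<in> Delta_inf" using z(1) by (simp add: Delta_inf_def)
      then have "E (Some z) = \<Phi> (H \<alpha> z)" using E(2) z(2) by (simp add: H_def)
      moreover have "dist (E (Some z)) (E (Some t)) < \<epsilon>" using \<delta>(2) z(1) by blast
      moreover have "E (Some t) = c \<alpha> t" using E(3) t by blast
      ultimately show ?thesis by simp
    qed
    then show "\<exists>\<delta>>0. \<forall>z \<in> exterior \<inter> ball t \<delta>. H \<alpha> z \<notin> Im_paths \<A> \<longrightarrow> dist (\<Phi> (H \<alpha> z)) (c \<alpha> t) < \<epsilon>"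
      using \<delta>(1) by blast
  qed
  have "G y = (\<Phi> \<circ> f \<circ> inv_into X \<Phi>) y" if "y \<in> S - Im_paths \<B>" for y
    using that \<B> by (simp add: G_def)
  then show ?thesis using G_ramified_covering by blast
qed

end
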